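(* Let $m \in \mathbb{N}$ with $m \ge 2$, let $r_m = \sqrt{\frac{2(m+1)}{m}}$, and let $\Phi:\mathbb{RP}^m(r_m)\to \mathbb{R}^{\frac{m(m+3)}{2}}$ be the isometric embedding described in the context (whose image lies in the unit sphere $\mathbb{S}^{\frac{m(m+3)}{2}-1}$). Let $X$ be a random variable with values in $\mathbb{RP}^m(r_m)$, equipped with the residual metric. Then: 1) $E_\infty^{lower}(X)$ and $E_\infty^{upper}(X)$ are contained in $$M := \Phi^{-1}\Big(\operatorname{argmin}_{z \in \Phi(\mathbb{RP}^m(r_m))} \mathbb{E}\big[\|\Phi(X) - z\|^2\big]\Big),$$ and they are equal to $M$ if the largest eigenvalue of $\mathbb{E}[XX^T]$ has (algebraic/geometric) multiplicity $1$. 2) If the largest eigenvalue of $\mathbb{E}[XX^T]$ has multiplicity $1$, and additionally $\mathbb{E}[\Phi(X)] \neq 0$ and $\frac{\mathbb{E}[\Phi(X)]}{\|\mathbb{E}[\Phi(X)]\|} \in \Phi(\mathbb{RP}^m(r_m))$, then $E_\infty^{lower}(X)$ and $E_\infty^{upper}(X)$ both coincide with $\{[y]_\infty\}$, where $[y]_\infty := \Phi^{-1}\Big(\frac{\mathbb{E}[\Phi(X)]}{\|\mathbb{E}[\Phi(X)]\|}\Big)$ is the extrinsic mean of $X$ with respect to $\Phi$.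
   Context: For $r>0$, $\mathbb{S}^m(r)\subset\mathbb{R}^{m+1}$ is the sphere of radius $r$ centered at $0$, and $\mathbb{RP}^m(r) = \{[x] : x \in \mathbb{S}^m(r)\}$ where $[x]=\{x,-x\}$; it carries the Riemannian metric induced from the round metric of $\mathbb{S}^m(r)$. For a random variable $X$ in $\mathbb{RP}^m(r)$, $XX^T$ means $xx^T$ for a representative $x\in\mathbb{S}^m(r)$ (independent of the choice), and $\Phi(X)$, $\langle X, y\rangle^2$ are understood likewise. The residual metric on $\mathbb{RP}^m(r)$ is $d_{res}([x],[y]) = \sqrt{1 - \langle x/r, y/r\rangle^2}$. Heat kernel: $p(x,y,t)$ is the minimal heat kernel, i.e. the minimal solution of $\frac{\partial}{\partial t} p(x,y,t) = \frac12 \Delta_{g,x} p(x,y,t)$ with $\int p(x,y,t)\,dy = 1$, where $\Delta_g$ is the Laplace–Beltrami operator. For $t>0$, the diffusion $t$-mean set is $E_t(X) = \operatorname{argmin}_{y} \mathbb{E}[-\ln p(X,y,t)]$. Kuratowski limits in a metric space: for sets $A_k$, $\mathrm{Li}_{k\to\infty} A_k$ is the set of points $x$ for which there exist $x_k\in A_k$ with $x_k\to x$; $\mathrm{Ls}_{k\to\infty}A_k$ is the set of points $x$ for which there exist a strictly increasing sequence of indices $(k_j)$ and $x_{k_j}\in A_{k_j}$ with $x_{k_j}\to x$. Then $E_\infty^{lower}(X) := \bigcap \mathrm{Li}_{k\to\infty} E_{t_k}(X)$ and $E_\infty^{upper}(X) := \bigcap \mathrm{Ls}_{k\to\infty} E_{t_k}(X)$,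 the intersections running over all monotone increasing sequences $0<t_k\to\infty$, limits taken in the given metric. The embedding $\Phi$: define $F_m:\mathbb{R}^{m+1}\times\mathbb{R}^{m+1}\to\mathbb{R}^{\frac{m(m+3)}{2}}$ recursively by $F_1((x_1,x_2),(y_1,y_2)) = (x_1y_1 - x_2y_2,\ x_1y_2 + x_2y_1)$ and, for $x,y\in\mathbb{R}^{m+1}$, $x_{m+2},y_{m+2}\in\mathbb{R}$, $F_{m+1}((x,x_{m+2}),(y,y_{m+2})) = \big(F_m(x,y),\ x_{m+2}y + y_{m+2}x,\ \tau_{m+1}(\langle x,y\rangle - (m+1)x_{m+2}y_{m+2})\big)$ with $\tau_{m+1} = \sqrt{\frac{2}{(m+1)(m+2)}}$. Then $\Phi([x]) := \frac12\sqrt{\frac{m}{2(m+1)}}\,F_m(x,x)$ for $x \in \mathbb{S}^m(r_m)$; this is an isometric embedding of $\mathbb{RP}^m(r_m)$ into $\mathbb{S}^{\frac{m(m+3)}{2}-1}$. *)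

theory Defs
  imports "HOL-Analysis.Analysis" "HOL-Probability.Probability"
begin

section \<open>Real projective space RP^m(r) inside real^'n (CARD('n) = m+1)\<close>

definition rp :: "real \<Rightarrow> (real^'n) set set" where
  "rp r = {{x, -x} | x. norm x = r}"

definition rep :: "(real^'n) set \<Rightarrow> real^'n" where
  "rep P = (SOME x. x \<in> P)"

definition d_res :: "real \<Rightarrow> (real^'n) set \<Rightarrow> (real^'n) set \<Rightarrow> real" where
  "d_res r P Q = sqrt (1 - ((rep P \<bullet> rep Q) / r\<^sup>2)\<^sup>2)"

text \<open>Integral over RP^m(r) w.r.t. its Riemannian volume, for even functions f on the sphere:
  half of the surface integral over S^m(r), the latter written through the cone formula
  int_{S(r)} f dsigma = ((m+1)/r) int_{ball 0 r} f(r y/|y|) dy.\<close>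
definition rp_integrable :: "nat \<Rightarrow> real \<Rightarrow> (real^'n \<Rightarrow> real) \<Rightarrow> bool" where
  "rp_integrable m r f \<longleftrightarrow> set_integrable lborel (ball 0 r) (\<lambda>y. f ((r / norm y) *\<^sub>R y))"

definition rp_int :: "nat \<Rightarrow> real \<Rightarrow> (real^'n \<Rightarrow> real) \<Rightarrow> real" where
  "rp_int m r f = (1/2) * ((real m + 1) / r) * (LINT y:ball 0 r|lborel. f ((r / norm y) *\<^sub>R y))"

definition has_second_deriv :: "(real \<Rightarrow> real) \<Rightarrow> real \<Rightarrow> real \<Rightarrow> bool" where
  "has_second_deriv f a d \<longleftrightarrow>
     (\<exists>g. (\<forall>\<^sub>F b in nhds a. (f has_real_derivative g b) (at b)) \<and> (g has_real_derivative d) (at a))"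

text \<open>u solves du/dt = (1/2) Laplace-Beltrami_x u on S^m(r) x (0,oo).  The Laplace--Beltrami
  operator of the round sphere S^m(r) is computed as the Euclidean Laplacian of the
  degree-0 homogeneous extension z \<mapsto> u(r z/|z|).\<close>
definition heat_sol :: "real \<Rightarrow> (real^'n \<Rightarrow> real \<Rightarrow> real) \<Rightarrow> bool" where
  "heat_sol r u \<longleftrightarrow>
     (\<forall>x\<in>sphere 0 r. \<forall>t>0. \<exists>dt d2.
        ((\<lambda>s. u x s) has_real_derivative dt) (at t) \<and>
        (\<forall>i. has_second_deriv (\<lambda>a. u ((r / norm (x + a *\<^sub>R axis i 1)) *\<^sub>R (x + a *\<^sub>R axis i 1)) t) 0 (d2 i)) \<and>
        dt = (1/2) * (\<Sum>i\<in>UNIV. d2 i))"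

text \<open>Nonnegative fundamental solutions of the heat equation on RP^m(r) (functions of
  representatives, even in both space arguments), with total mass one.\<close>
definition heat_fund :: "nat \<Rightarrow> real \<Rightarrow> (real^'n \<Rightarrow> real^'n \<Rightarrow> real \<Rightarrow> real) \<Rightarrow> bool" where
  "heat_fund m r q \<longleftrightarrow>
     (\<forall>x\<in>sphere 0 r. \<forall>y\<in>sphere 0 r. \<forall>t>0.
        q x y t \<ge> 0 \<and> q (-x) y t = q x y t \<and> q x (-y) t = q x y t) \<and>
     continuous_on (sphere 0 r \<times> sphere 0 r \<times> {0<..}) (\<lambda>(x, y, t). q x y t) \<and>
     (\<forall>y\<in>sphere 0 r. heat_sol r (\<lambda>x t. q x y t)) \<and>
     (\<forall>x\<in>sphere 0 r. \<forall>t>0. rp_integrable m r (\<lambda>y. q x y t) \<and> rp_int m r (\<lambda>y. q x y t) = 1) \<and>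
     (\<forall>f. continuous_on (sphere 0 r) f \<longrightarrow> (\<forall>y. f (-y) = f y) \<longrightarrow>
        (\<forall>x\<in>sphere 0 r. ((\<lambda>t. rp_int m r (\<lambda>y. q x y t * f y)) \<longlongrightarrow> f x) (at_right 0)))"

definition min_heat_kernel :: "nat \<Rightarrow> real \<Rightarrow> (real^'n \<Rightarrow> real^'n \<Rightarrow> real \<Rightarrow> real) \<Rightarrow> bool" where
  "min_heat_kernel m r p \<longleftrightarrow>
     heat_fund m r p \<and>
     (\<forall>q. heat_fund m r q \<longrightarrow>
        (\<forall>x\<in>sphere 0 r. \<forall>y\<in>sphere 0 r. \<forall>t>0. p x y t \<le> q x y t)) \<and>
     (\<forall>x y t. \<not> (x \<in> sphere 0 r \<and> y \<in> sphere 0 r \<and> t > 0) \<longrightarrow> p x y t = 0)"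

definition heat_kernel :: "nat \<Rightarrow> real \<Rightarrow> real^'n \<Rightarrow> real^'n \<Rightarrow> real \<Rightarrow> real" where
  "heat_kernel m r = (THE p. min_heat_kernel m r p)"

text \<open>Diffusion t-mean set of an RP^m(r)-valued random variable X (given by representatives).\<close>
definition diffusion_mean :: "nat \<Rightarrow> real \<Rightarrow> 'a measure \<Rightarrow> ('a \<Rightarrow> real^'n) \<Rightarrow> real \<Rightarrow> (real^'n) set set" where
  "diffusion_mean m r M X t =
     {y \<in> rp r. \<forall>z \<in> rp r.
        integral\<^sup>L M (\<lambda>\<omega>. - ln (heat_kernel m r (X \<omega>) (rep y) t))
        \<le> integral\<^sup>L M (\<lambda>\<omega>. - ln (heat_kernel m r (X \<omega>) (rep z) t))}"

definition kur_Li :: "'p set \<Rightarrow> ('p \<Rightarrow> 'p \<Rightarrow> real) \<Rightarrow> (nat \<Rightarrow> 'p set) \<Rightarrow> 'p set" where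
  "kur_Li S d A = {x \<in> S. \<exists>xs. (\<forall>k. xs k \<in> A k) \<and> (\<lambda>k. d (xs k) x) \<longlonglongrightarrow> 0}"

definition kur_Ls :: "'p set \<Rightarrow> ('p \<Rightarrow> 'p \<Rightarrow> real) \<Rightarrow> (nat \<Rightarrow> 'p set) \<Rightarrow> 'p set" where
  "kur_Ls S d A = {x \<in> S. \<exists>s xs. strict_mono s \<and> (\<forall>j. xs j \<in> A (s j)) \<and> (\<lambda>j. d (xs j) x) \<longlonglongrightarrow> 0}"

definition admissible_times :: "(nat \<Rightarrow> real) \<Rightarrow> bool" where
  "admissible_times t \<longleftrightarrow> incseq t \<and> (\<forall>k. 0 < t k) \<and> filterlim t at_top sequentially"

definition E_lower :: "nat \<Rightarrow> real \<Rightarrow> 'a measure \<Rightarrow> ('a \<Rightarrow> real^'n) \<Rightarrow> (real^'n) set set" where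
  "E_lower m r M X = (\<Inter>t\<in>{t. admissible_times t}.
      kur_Li (rp r) (d_res r) (\<lambda>k. diffusion_mean m r M X (t k)))"

definition E_upper :: "nat \<Rightarrow> real \<Rightarrow> 'a measure \<Rightarrow> ('a \<Rightarrow> real^'n) \<Rightarrow> (real^'n) set set" where
  "E_upper m r M X = (\<Inter>t\<in>{t. admissible_times t}.
      kur_Ls (rp r) (d_res r) (\<lambda>k. diffusion_mean m r M X (t k)))"

text \<open>F m xs ys is F_m on R^{m+1} x R^{m+1} (lists of length m+1), m \<ge> 1.\<close>
fun F :: "nat \<Rightarrow> real list \<Rightarrow> real list \<Rightarrow> real list" where
  "F 0 xs ys = []"
| "F (Suc 0) xs ys = [xs!0 * ys!0 - xs!1 * ys!1, xs!0 * ys!1 + xs!1 * ys!0]"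
| "F (Suc (Suc k)) xs ys =
     (let m = Suc k; x = take (m+1) xs; y = take (m+1) ys; a = xs!(m+1); b = ys!(m+1) in
      F m x y @ map (\<lambda>i. a * y!i + b * x!i) [0..<m+1] @
      [sqrt (2 / ((real m + 1) * (real m + 2))) *
         ((\<Sum>i<m+1. x!i * y!i) - (real m + 1) * a * b)])"

definition coords :: "real^'n::{finite,linorder} \<Rightarrow> real list" where
  "coords x = map (\<lambda>i. x $ i) (sorted_list_of_set (UNIV :: 'n set))"

definition phi_vec :: "nat \<Rightarrow> real^'n::{finite,linorder} \<Rightarrow> real list" where
  "phi_vec m x = map (\<lambda>c. (1/2) * sqrt (real m / (2 * (real m + 1))) * c) (F m (coords x) (coords x))"

definition phi :: "nat \<Rightarrow> (real^'n::{finite,linorder}) set \<Rightarrow> real list" where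
  "phi m P = phi_vec m (rep P)"

definition lnorm :: "real list \<Rightarrow> real" where
  "lnorm v = sqrt (\<Sum>k<length v. (v!k)\<^sup>2)"

definition ldiff :: "real list \<Rightarrow> real list \<Rightarrow> real list" where
  "ldiff u v = map2 (-) u v"

definition r_m :: "nat \<Rightarrow> real" where
  "r_m m = sqrt (2 * (real m + 1) / real m)"

definition E_phi :: "nat \<Rightarrow> 'a measure \<Rightarrow> ('a \<Rightarrow> real^'n::{finite,linorder}) \<Rightarrow> real list" where
  "E_phi m M X = map (\<lambda>k. integral\<^sup>L M (\<lambda>\<omega>. phi_vec m (X \<omega>) ! k)) [0..<m * (m + 3) div 2]"

definition extrinsic_argmin_set :: "nat \<Rightarrow> 'a measure \<Rightarrow> ('a \<Rightarrow> real^'n::{finite,linorder}) \<Rightarrow> (real^'n::{finite,linorder}) set set" where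
  "extrinsic_argmin_set m M X =
     {P \<in> rp (r_m m). phi m P \<in>
        {z \<in> phi m ` (rp (r_m m) :: (real^'n::{finite,linorder}) set set). \<forall>w \<in> phi m ` (rp (r_m m) :: (real^'n::{finite,linorder}) set set).
            integral\<^sup>L M (\<lambda>\<omega>. (lnorm (ldiff (phi_vec m (X \<omega>)) z))\<^sup>2)
            \<le> integral\<^sup>L M (\<lambda>\<omega>. (lnorm (ldiff (phi_vec m (X \<omega>)) w))\<^sup>2)}}"

definition second_moment :: "'a measure \<Rightarrow> ('a \<Rightarrow> real^'n) \<Rightarrow> real^'n^'n" where
  "second_moment M X = (\<chi> i j. integral\<^sup>L M (\<lambda>\<omega>. X \<omega> $ i * X \<omega> $ j))"

definition is_eigenvalue :: "real^'n^'n \<Rightarrow> real \<Rightarrow> bool" where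
  "is_eigenvalue A lam \<longleftrightarrow> (\<exists>v. v \<noteq> 0 \<and> A *v v = lam *\<^sub>R v)"

definition top_eigenvalue_simple :: "real^'n^'n \<Rightarrow> bool" where
  "top_eigenvalue_simple A \<longleftrightarrow>
     (\<exists>lam. is_eigenvalue A lam \<and> (\<forall>\<mu>. is_eigenvalue A \<mu> \<longrightarrow> \<mu> \<le> lam) \<and>
          dim {v. A *v v = lam *\<^sub>R v} = 1)"

end

theory Submission
  imports Defs
begin

text \<open>
  The heat kernel of \<open>RP\<^sup>m(r)\<close> is constructed from a pure death chain: relative to normalized volume,
  \<open>p(x, y, t) = (\<Sum>j. \<pi>\<^sub>j(t) w\<^sub>j \<langle>x/r, y/r\<rangle>\<^bsup>2j\<^esup>)\<close>, where \<open>1 / w\<^sub>j\<close> is the spherical mean of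
  \<open>\<langle>x/r, y/r\<rangle>\<^bsup>2j\<^esup>\<close> and \<open>\<pi>\<^sub>j(t)\<close> is the law at time \<open>t\<close> of the chain started at infinity that jumps from
  \<open>j\<close> to \<open>j - 1\<close> at rate \<open>d\<^sub>j = j (2 j + m - 1) / r\<^sup>2\<close>. Indeed \<open>1/2 \<Delta>\<close> maps \<open>w\<^sub>j \<langle>x/r, y/r\<rangle>\<^bsup>2j\<^esup>\<close> to \<open>d\<^sub>j\<close> times the
  difference of the functions with index \<open>j - 1\<close> and \<open>j\<close>. Positivity and unit mass are then
  immediate, and since the chain is near infinity at small times, the kernel concentrates on \<open>y = \<plusminus>x\<close>.
  Any other fundamental solution \<open>q\<close> satisfies \<open>q(x, y, t + s) = \<integral> p(x, z, t) q(z, y, s) dz\<close> by the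
  maximum principle, and \<open>s \<rightarrow> 0\<close> gives \<open>q = p\<close>.

  As \<open>t \<rightarrow> \<infinity>\<close>, \<open>ln p = const + \<pi>\<^sub>1(t) ((m + 1) \<langle>x/r, y/r\<rangle>\<^sup>2 - 1) + o(\<pi>\<^sub>1(t))\<close> uniformly, so diffusion means
  converge to maximizers of \<open>y\<^sup>T E[XX\<^sup>T] y\<close>. These are the extrinsic means, because \<open>\<langle>\<Phi>(x), \<Phi>(y)\<rangle>\<close> is an
  increasing affine function of \<open>\<langle>x, y\<rangle>\<^sup>2\<close>; the maximizer is unique if the top eigenvalue is simple.
\<close>

section \<open>Pure death chain started at infinity\<close>

text \<open>\<open>heat_kernel\<close> is given by a description, so nothing can be said about it
  before a fundamental solution is shown to exist and to be unique; strict positivity is needed as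
  well, because the logarithm of the kernel is averaged. An expansion in eigenfunctions has terms of
  both signs, which hides positivity and the behaviour at small times. Even powers normalized to
  mean 1 are nonnegative instead, and the jump rates are exactly the eigenvalues of -1/2 Delta on
  spherical harmonics of degree 2j. The chain can be started at infinity because the reciprocals of
  the rates are summable. The price is that the tail estimates decay only at half of the true rate;
  this suffices because \<open>d 2 / 2 > d 1\<close>. In the uniqueness proof a competitor
  \<open>q\<close> is known to concentrate only weakly, pointwise in its first argument. It is
  therefore propagated from a positive time \<open>s\<close>, where it is continuous, and
  \<open>s\<close> tends to 0 only after integration against a test function.\<close>

lemma continuous_on_halfline:
  fixes f :: "real \<Rightarrow> real"
  assumes "\<And>b. continuous_on {0..b} f"
  shows "continuous_on {0..} f"
  unfolding continuous_on_eq_continuous_within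
proof
  fix t :: real assume "t \<in> {0..}"
  then have "continuous (at t within {0..t+1}) f"
    using assms[of "t + 1"] by (auto simp: continuous_on_eq_continuous_within)
  moreover have "at t within {0..t+1} = at t within {0..}"
    by (rule at_within_nhd[of _ "{..<t+1}"]) auto
  ultimately show "continuous (at t within {0..}) f" by simp
qed

text \<open>Variation of constants: the hypothesis on \<open>f\<close> is the integral form of
  \<open>f' = - c (f - g)\<close>, \<open>f 0 = 1\<close>.\<close>
lemma relaxation_derivative:
  fixes f g :: "real \<Rightarrow> real"
  assumes g: "continuous_on {0..} g" and t: "0 \<le> t"
    and f: "\<And>t. 0 \<le> t \<Longrightarrow> f t = exp (- c * t) * (1 + integral {0..t} (\<lambda>u. c * exp (c * u) * g u))"
  shows "(f has_real_derivative - c * (f t - g t)) (at t within {0..})"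
proof -
  let ?h = "\<lambda>u. c * exp (c * u) * g u"
  have h: "continuous_on {0..t+1} ?h"
    by (intro continuous_intros continuous_on_subset[OF g]) auto
  have "at t within {0..t+1} = at t within {0..}"
    by (rule at_within_nhd[of _ "{..<t+1}"]) (use t in auto)
  moreover have "((\<lambda>x. integral {0..x} ?h) has_real_derivative ?h t) (at t within {0..t+1})"
    using integral_has_real_derivative[OF h] t by simp
  ultimately have I: "((\<lambda>x. integral {0..x} ?h) has_real_derivative ?h t) (at t within {0..})"
    by simp
  have e: "exp (- c * t) * exp (c * t) = 1"
    by (simp flip: exp_add)
  have "((\<lambda>t. exp (- c * t) * (1 + integral {0..t} ?h)) has_real_derivative
      - c * exp (- c * t) * (1 + integral {0..t} ?h) + exp (- c * t) * ?h t) (at t within {0..})"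
    by (rule derivative_eq_intros I refl)+ simp
  then have "(f has_real_derivative
      - c * exp (- c * t) * (1 + integral {0..t} ?h) + exp (- c * t) * ?h t) (at t within {0..})"
    by (rule has_field_derivative_transform_within[OF _ zero_less_one])
       (simp_all only: atLeast_iff t f[symmetric])
  moreover have "- c * exp (- c * t) * (1 + integral {0..t} ?h) + exp (- c * t) * ?h t =
      - c * (f t - g t)"
    using e unfolding f[OF t] by algebra
  ultimately show ?thesis by simp
qed

text \<open>The integrating factor \<open>exp (c * u)\<close> turns the hypothesis into monotonicity
  of the weighted difference. Comparing \<open>f' + c f\<close> with \<open>g' + c g\<close> means
  that, for relaxation equations, only the source terms have to be compared.\<close>

lemma relaxation_comparison:
  fixes f g :: "real \<Rightarrow> real"
  assumes t: "0 \<le> t" and cf: "continuous_on {0..} f" and cg: "continuous_on {0..} g"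
    and f: "\<And>u. 0 < u \<Longrightarrow> (f has_real_derivative f' u) (at u)"
    and g: "\<And>u. 0 < u \<Longrightarrow> (g has_real_derivative g' u) (at u)"
    and le: "\<And>u. 0 < u \<Longrightarrow> f' u + c * f u \<le> g' u + c * g u"
    and init: "f 0 \<le> g 0"
  shows "f t \<le> g t"
proof (cases "t = 0")
  case False
  define k where "k u = exp (c * u) * (f u - g u)" for u
  have "k t \<le> k 0"
  proof (rule DERIV_nonpos_imp_decreasing_open[of 0 t k])
    show "0 \<le> t" by fact
    fix u assume "0 < u" "u < t"
    have "(k has_real_derivative exp (c * u) * c * (f u - g u) + exp (c * u) * (f' u - g' u)) (at u)"
      unfolding k_def by (rule derivative_eq_intros f g refl \<open>0 < u\<close>)+ simp
    moreover have "exp (c * u) * c * (f u - g u) + exp (c * u) * (f' u - g' u) =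
        exp (c * u) * ((f' u + c * f u) - (g' u + c * g u))" by (simp add: algebra_simps)
    moreover have "\<dots> \<le> 0"
      using le[OF \<open>0 < u\<close>] by (simp add: mult_nonneg_nonpos)
    ultimately show "\<exists>y. (k has_real_derivative y) (at u) \<and> y \<le> 0" by auto
  next
    show "continuous_on {0..t} k" unfolding k_def
      by (intro continuous_intros continuous_on_subset[OF cf] continuous_on_subset[OF cg]) auto
  qed
  then have "exp (c * t) * (f t - g t) \<le> 0" using init by (simp add: k_def)
  then show ?thesis by (simp add: mult_le_0_iff not_le)
qed (use init in simp)

lemma DERIV_at_of_halfline:
  "(f has_real_derivative D) (at t within {0..}) \<Longrightarrow> 0 < t \<Longrightarrow> (f has_real_derivative D) (at t)"
  using at_within_interior[of t "{0..}"] by simp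

text \<open>\<open>truncated_tail d k j t\<close> is the probability that the pure death chain with rates \<open>d\<close>,
  started in \<open>j + k - 1\<close>, is still at least \<open>j\<close> at time \<open>t\<close>.\<close>
primrec truncated_tail :: "(nat \<Rightarrow> real) \<Rightarrow> nat \<Rightarrow> nat \<Rightarrow> real \<Rightarrow> real" where
  "truncated_tail d 0 j = (\<lambda>t. 0)"
| "truncated_tail d (Suc k) j = (\<lambda>t. exp (- d j * t) *
     (1 + integral {0..t} (\<lambda>u. d j * exp (d j * u) * truncated_tail d k (Suc j) u)))"

text \<open>The chain started at infinity.\<close>
definition death_tail :: "(nat \<Rightarrow> real) \<Rightarrow> nat \<Rightarrow> real \<Rightarrow> real" where
  "death_tail d j t = (SUP k. truncated_tail d k j t)"

definition death_prob :: "(nat \<Rightarrow> real) \<Rightarrow> nat \<Rightarrow> real \<Rightarrow> real" where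
  "death_prob d j t = death_tail d j t - death_tail d (Suc j) t"

text \<open>\<open>d_sum\<close> bounds, uniformly in \<open>n\<close>, the mean time of the descent
  from \<open>n - 1\<close> to \<open>j - 1\<close> in units of \<open>1 / d j\<close>; this is what
  allows a start at infinity. Its linear growth in \<open>j\<close> is later beaten by the quadratic
  growth of the rates in \<open>d_growth\<close>.\<close>

locale death_rates =
  fixes d :: "nat \<Rightarrow> real" and b \<kappa> :: real
  assumes d_zero: "d 0 = 0"
    and d_pos: "j > 0 \<Longrightarrow> d j > 0"
    and d_mono: "i \<le> j \<Longrightarrow> d i \<le> d j"
    and d_sum: "j > 0 \<Longrightarrow> (\<Sum>i=j..<n. d j / d i) \<le> b + 2 * real j"
    and kappa_pos: "\<kappa> > 0"
    and d_growth: "\<kappa> * (real j)\<^sup>2 \<le> d j"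
begin

abbreviation T :: "nat \<Rightarrow> nat \<Rightarrow> real \<Rightarrow> real" where "T \<equiv> truncated_tail d"
abbreviation S :: "nat \<Rightarrow> real \<Rightarrow> real" where "S \<equiv> death_tail d"
abbreviation \<pi> :: "nat \<Rightarrow> real \<Rightarrow> real" where "\<pi> \<equiv> death_prob d"

section \<open>Tails of the chain with a finite starting level\<close>

lemma d_nonneg: "d j \<ge> 0"
  using d_zero d_pos[of j] by (cases "j = 0") auto

lemma T_cont: "continuous_on {0..} (T k j)"
proof (induction k arbitrary: j)
  case (Suc k)
  show ?case
  proof (rule DERIV_continuous_on)
    fix t :: real assume "t \<in> {0..}"
    then show "(T (Suc k) j has_real_derivative - d j * (T (Suc k) j t - T k (Suc j) t)) (at t within {0..})"
      by (intro relaxation_derivative Suc.IH) auto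
  qed
qed simp

lemma T_deriv:
  assumes "0 < t"
  shows "(T (Suc k) j has_real_derivative - d j * (T (Suc k) j t - T k (Suc j) t)) (at t)"
proof (rule DERIV_at_of_halfline)
  show "(T (Suc k) j has_real_derivative - d j * (T (Suc k) j t - T k (Suc j) t)) (at t within {0..})"
    using assms by (intro relaxation_derivative T_cont) auto
qed fact

lemma T_zero: "T (Suc k) j 0 = 1"
  by simp

text \<open>The shape in which \<open>relaxation_comparison\<close> meets these functions: the decay
  term cancels and the source remains.\<close>

lemma T_deriv_add: "- d j * (T (Suc k) j t - y) + d j * T (Suc k) j t = d j * y"
  by (simp add: right_diff_distrib)

text \<open>To fall below \<open>j\<close> the chain must at least sit out the exponential holding
  time at \<open>j\<close>. Analytically, the source term is nonnegative.\<close>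

lemma T_ge_exp:
  assumes "0 \<le> t" shows "exp (- d j * t) \<le> T (Suc k) j t"
  using assms
proof (induction k arbitrary: j t)
  case 0
  then show ?case by simp
next
  case (Suc k)
  show ?case
  proof (rule relaxation_comparison[where c = "d j" and f = "\<lambda>t. exp (- d j * t)" and
      g = "T (Suc (Suc k)) j"])
    show "((\<lambda>t. exp (- d j * t)) has_real_derivative - d j * exp (- d j * u)) (at u)" for u
      by (auto intro!: derivative_eq_intros)
    show "(T (Suc (Suc k)) j has_real_derivative
        - d j * (T (Suc (Suc k)) j u - T (Suc k) (Suc j) u)) (at u)" if "0 < u" for u
      using that by (rule T_deriv)
    show "- d j * exp (- d j * u) + d j * exp (- d j * u) \<le>
        - d j * (T (Suc (Suc k)) j u - T (Suc k) (Suc j) u) + d j * T (Suc (Suc k)) j u"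
      if "0 < u" for u
    proof -
      have "0 \<le> T (Suc k) (Suc j) u"
        using Suc.IH[of u "Suc j"] that less_imp_le order_trans[OF exp_ge_zero] by blast
      then show ?thesis unfolding T_deriv_add by (simp add: d_nonneg del: truncated_tail.simps)
    qed
  qed ((simp only: Suc.prems T_zero order_refl) | (intro T_cont continuous_intros) | (simp del: truncated_tail.simps add: T_zero))+
qed

lemma T_nonneg: "0 \<le> t \<Longrightarrow> 0 \<le> T k j t"
  using order_trans[OF exp_ge_zero T_ge_exp] by (cases k) (auto simp del: truncated_tail.simps(2))

lemma T_le_1: "0 \<le> t \<Longrightarrow> T k j t \<le> 1"
proof (induction k arbitrary: j t)
  case (Suc k)
  show ?case
  proof (rule relaxation_comparison[where c = "d j" and f = "T (Suc k) j" and
      g = "\<lambda>_. 1"])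
    show "(T (Suc k) j has_real_derivative - d j * (T (Suc k) j u - T k (Suc j) u)) (at u)"
      if "0 < u" for u
      using that by (rule T_deriv)
    show "((\<lambda>_. 1) has_real_derivative 0) (at u)" for u :: real by simp
    show "- d j * (T (Suc k) j u - T k (Suc j) u) + d j * T (Suc k) j u \<le> 0 + d j * 1"
      if "0 < u" for u
      unfolding T_deriv_add using Suc.IH[of u "Suc j"] that d_nonneg[of j]
      by (simp add: mult_left_le del: truncated_tail.simps)
  qed ((simp only: Suc.prems T_zero order_refl) | (intro T_cont continuous_intros) | (simp del: truncated_tail.simps add: T_zero))+
qed simp

text \<open>Starting one level higher only delays the descent. This monotonicity turns the supremum
  in \<open>death_tail\<close> into a limit.\<close>

lemma T_mono: "0 \<le> t \<Longrightarrow> T k j t \<le> T (Suc k) j t"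
proof (induction k arbitrary: j t)
  case 0
  then show ?case using T_nonneg[of t "Suc 0" j] by (simp del: truncated_tail.simps(2))
next
  case (Suc k)
  show ?case
  proof (rule relaxation_comparison[where c = "d j" and f = "T (Suc k) j" and
      g = "T (Suc (Suc k)) j"])
    show "(T (Suc k) j has_real_derivative - d j * (T (Suc k) j u - T k (Suc j) u)) (at u)"
      if "0 < u" for k u
      using that by (rule T_deriv)
    then show "(T (Suc (Suc k)) j has_real_derivative
        - d j * (T (Suc (Suc k)) j u - T (Suc k) (Suc j) u)) (at u)"
      if "0 < u" for u
      using that by blast
    show "- d j * (T (Suc k) j u - T k (Suc j) u) + d j * T (Suc k) j u \<le>
      - d j * (T (Suc (Suc k)) j u - T (Suc k) (Suc j) u) + d j * T (Suc (Suc k)) j u"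
      if "0 < u" for u
      unfolding T_deriv_add using Suc.IH[of u "Suc j"] that d_nonneg[of j]
      by (simp add: mult_left_mono del: truncated_tail.simps)
  qed ((simp only: Suc.prems T_zero order_refl) | (intro T_cont continuous_intros) | (simp del: truncated_tail.simps add: T_zero))+
qed

text \<open>Both sides describe the chain started in \<open>j + k\<close>, and being at least
  \<open>j + 1\<close> implies being at least \<open>j\<close>.\<close>

lemma T_Suc_le: "0 \<le> t \<Longrightarrow> T k (Suc j) t \<le> T (Suc k) j t"
proof (induction k arbitrary: j t)
  case 0
  then show ?case using T_nonneg[of t "Suc 0" j] by (simp del: truncated_tail.simps(2))
next
  case (Suc k)
  show ?case
  proof (rule relaxation_comparison[where c = "d j" and f = "T (Suc k) (Suc j)" and
      g = "T (Suc (Suc k)) j"])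
    show "(T (Suc k) (Suc j) has_real_derivative
        - d (Suc j) * (T (Suc k) (Suc j) u - T k (Suc (Suc j)) u)) (at u)"
      if "0 < u" for u
      using that by (rule T_deriv)
    show "(T (Suc (Suc k)) j has_real_derivative
        - d j * (T (Suc (Suc k)) j u - T (Suc k) (Suc j) u)) (at u)"
      if "0 < u" for u
      using that by (rule T_deriv)
    \<comment> \<open>By the induction hypothesis the derivative of the smaller function is
      nonpositive; what remains on both sides is \<open>d j\<close> times the same tail.\<close>
    show "- d (Suc j) * (T (Suc k) (Suc j) u - T k (Suc (Suc j)) u) + d j * T (Suc k) (Suc j) u \<le>
      - d j * (T (Suc (Suc k)) j u - T (Suc k) (Suc j) u) + d j * T (Suc (Suc k)) j u"
      if "0 < u" for u
      unfolding T_deriv_add using Suc.IH[of u "Suc j"] that d_nonneg[of "Suc j"]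
      by (simp del: truncated_tail.simps)
  qed ((simp only: Suc.prems T_zero order_refl) | (intro T_cont continuous_intros) | (simp del: truncated_tail.simps add: T_zero))+
qed

text \<open>A Chernoff bound for the time the chain needs to fall below \<open>j\<close>, uniform in the starting point.\<close>
lemma T_le_exp:
  assumes "j > 0" "0 \<le> \<theta>" "2 * \<theta> \<le> d j" "0 \<le> t"
  shows "T k j t \<le> exp (\<Sum>i=j..<j+k. 2 * \<theta> / d i) * exp (- \<theta> * t)"
  using assms
proof (induction k arbitrary: j t)
  case (Suc k)
  define C where "C = exp (\<Sum>i=Suc j..<j + Suc k. 2 * \<theta> / d i)"
  define x where "x = \<theta> / d j"
  have dj: "d j > 0" using d_pos Suc.prems by blast
  have sum: "exp (\<Sum>i=j..<j + Suc k. 2 * \<theta> / d i) = exp (2 * x) * C"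
    unfolding C_def x_def by (simp add: sum.atLeast_Suc_lessThan flip: exp_add)
  have x: "0 \<le> x" "x \<le> 1/2" "\<theta> = d j * x"
    using Suc.prems dj by (auto simp: x_def field_simps)
  \<comment> \<open>An exponential holding time of rate \<open>d j\<close> has moment generating
    function \<open>1 / (1 - x)\<close> at \<open>\<theta>\<close>. It is at most
    \<open>exp (2 * x)\<close> for \<open>x \<le> 1/2\<close>, which explains both the factor 2 in
    the exponent and the restriction \<open>2 * \<theta> \<le> d j\<close>.\<close>
  have "1 \<le> (1 + 2 * x) * (1 - x)"
    using x mult_left_le[of "2 * x" x] by (simp add: algebra_simps)
  also have "\<dots> \<le> exp (2 * x) * (1 - x)"
    using x by (intro mult_right_mono exp_ge_add_one_self) auto
  finally have x_exp: "1 \<le> exp (2 * x) * (1 - x)" .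
  show ?case unfolding sum
  proof (rule relaxation_comparison[where c = "d j" and f = "T (Suc k) j" and
      g = "\<lambda>t. exp (2 * x) * C * exp (- \<theta> * t)"])
    show "(T (Suc k) j has_real_derivative - d j * (T (Suc k) j u - T k (Suc j) u)) (at u)"
      if "0 < u" for u
      using that by (rule T_deriv)
    show "((\<lambda>t. exp (2 * x) * C * exp (- \<theta> * t)) has_real_derivative
        - \<theta> * (exp (2 * x) * C * exp (- \<theta> * u))) (at u)" for u
      by (auto intro!: derivative_eq_intros)
    show "- d j * (T (Suc k) j u - T k (Suc j) u) + d j * T (Suc k) j u
      \<le> - \<theta> * (exp (2 * x) * C * exp (- \<theta> * u)) + d j * (exp (2 * x) * C * exp (- \<theta> * u))"
      if u: "0 < u" for u
    proof -
      have "T k (Suc j) u \<le> C * exp (- \<theta> * u)"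
        unfolding C_def using Suc.IH[of "Suc j" u] Suc.prems u d_mono[of j "Suc j"]
        by (simp del: truncated_tail.simps)
      also have "\<dots> \<le> (exp (2 * x) * (1 - x)) * (C * exp (- \<theta> * u))"
        using mult_right_mono[OF x_exp, of "C * exp (- \<theta> * u)"] by (simp add: C_def)
      finally have "d j * T k (Suc j) u \<le> d j * ((exp (2 * x) * (1 - x)) * (C * exp (- \<theta> * u)))"
        using dj by (simp del: truncated_tail.simps)
      also have "\<dots> = - \<theta> * (exp (2 * x) * C * exp (- \<theta> * u)) + d j * (exp (2 * x) * C * exp (- \<theta> * u))"
        unfolding x(3) by (simp add: algebra_simps)
      finally show ?thesis unfolding T_deriv_add .
    qed
    have "0 \<le> (\<Sum>i=Suc j..<j + Suc k. 2 * \<theta> / d i)"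
      using Suc.prems d_nonneg by (intro sum_nonneg divide_nonneg_nonneg) auto
    then have "1 \<le> C" unfolding C_def by (simp only: one_le_exp_iff)
    then have "1 * 1 \<le> exp (2 * x) * C" using x by (intro mult_mono) auto
    then show "T (Suc k) j 0 \<le> exp (2 * x) * C * exp (- \<theta> * 0)"
      by (simp del: truncated_tail.simps add: T_zero)
  qed ((simp only: Suc.prems T_zero order_refl) | (intro T_cont continuous_intros) | (simp del: truncated_tail.simps add: T_zero))+
qed simp

section \<open>Passage to the chain started at infinity\<close>

lemma T_tendsto: "0 \<le> t \<Longrightarrow> (\<lambda>k. T k j t) \<longlonglongrightarrow> S j t"
  unfolding death_tail_def
  by (rule LIMSEQ_incseq_SUP) (auto intro!: bdd_aboveI[where M=1] incseq_SucI T_mono T_le_1)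

lemma S_bounds:
  assumes "0 \<le> t" shows "exp (- d j * t) \<le> S j t" "S j t \<le> 1" "S (Suc j) t \<le> S j t"
proof -
  show "exp (- d j * t) \<le> S j t"
    by (rule LIMSEQ_le_const[OF T_tendsto[OF assms]])
       (metis T_ge_exp assms Suc_le_D)
  show "S j t \<le> 1"
    by (rule LIMSEQ_le_const2[OF T_tendsto[OF assms]]) (use T_le_1 assms in blast)
  show "S (Suc j) t \<le> S j t"
    by (rule LIMSEQ_le[OF T_tendsto[OF assms] LIMSEQ_Suc[OF T_tendsto[OF assms]]])
       (use T_Suc_le assms in blast)
qed

lemma S_nonneg: "0 \<le> t \<Longrightarrow> 0 \<le> S j t"
  using S_bounds(1) order_trans[OF exp_ge_zero] by blast

lemma S_0: "0 \<le> t \<Longrightarrow> S 0 t = 1"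
  using S_bounds[of t 0] d_zero by simp

text \<open>Since all truncated tails lie between 0 and 1, dominated convergence carries the
  integral equation over to the limit. Continuity and differentiability of \<open>S\<close> are then
  read off from this equation.\<close>

lemma S_integral:
  assumes "0 \<le> t"
  shows "(\<lambda>u. d j * exp (d j * u) * S (Suc j) u) integrable_on {0..t}"
    and "S j t = exp (- d j * t) * (1 + integral {0..t} (\<lambda>u. d j * exp (d j * u) * S (Suc j) u))"
proof -
  have *: "(\<lambda>u. d j * exp (d j * u) * T k (Suc j) u) integrable_on {0..t}" for k
    by (intro integrable_continuous_interval continuous_intros continuous_on_subset[OF T_cont]) auto
  have h: "(\<lambda>u. d j * exp (d j * u)) integrable_on {0..t}"
    by (intro integrable_continuous_interval continuous_intros)
  have le: "norm (d j * exp (d j * u) * T k (Suc j) u) \<le> d j * exp (d j * u)" if "u \<in> {0..t}" for k u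
    using that T_nonneg[of u] T_le_1[of u] d_nonneg[of j] by (simp add: abs_mult mult_left_le)
  have conv: "(\<lambda>k. d j * exp (d j * u) * T k (Suc j) u) \<longlonglongrightarrow> d j * exp (d j * u) * S (Suc j) u"
    if "u \<in> {0..t}" for u
    using that by (intro tendsto_intros T_tendsto) auto
  show "(\<lambda>u. d j * exp (d j * u) * S (Suc j) u) integrable_on {0..t}"
    by (rule dominated_convergence(1)[OF * h le conv])
  have "(\<lambda>k. integral {0..t} (\<lambda>u. d j * exp (d j * u) * T k (Suc j) u)) \<longlonglongrightarrow>
      integral {0..t} (\<lambda>u. d j * exp (d j * u) * S (Suc j) u)"
    by (rule dominated_convergence(2)[OF * h le conv])
  then have "(\<lambda>k. T (Suc k) j t) \<longlonglongrightarrow>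
      exp (- d j * t) * (1 + integral {0..t} (\<lambda>u. d j * exp (d j * u) * S (Suc j) u))"
    unfolding truncated_tail.simps by (intro tendsto_intros)
  with LIMSEQ_Suc[OF T_tendsto[OF assms]]
  show "S j t = exp (- d j * t) * (1 + integral {0..t} (\<lambda>u. d j * exp (d j * u) * S (Suc j) u))"
    by (rule LIMSEQ_unique)
qed

lemma S_cont: "continuous_on {0..} (S j)"
proof (rule continuous_on_halfline)
  fix c :: real
  show "continuous_on {0..c} (S j)"
  proof (cases "0 \<le> c")
    case True
    have "continuous_on {0..c}
        (\<lambda>t. exp (- d j * t) * (1 + integral {0..t} (\<lambda>u. d j * exp (d j * u) * S (Suc j) u)))"
      by (intro continuous_intros indefinite_integral_continuous_1 S_integral True)
    then show ?thesis
      by (subst continuous_on_cong[OF refl S_integral(2)]) auto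
  qed auto
qed

lemma S_deriv:
  assumes "0 < t" shows "(S j has_real_derivative - d j * \<pi> j t) (at t)"
proof (rule DERIV_at_of_halfline)
  show "(S j has_real_derivative - d j * \<pi> j t) (at t within {0..})"
    unfolding death_prob_def
    using assms by (intro relaxation_derivative S_cont S_integral) auto
qed fact

text \<open>\<open>T_le_exp\<close> with the largest admissible parameter \<open>d j / 2\<close>;
  \<open>d_sum\<close> then bounds the constant independently of the starting level.\<close>

lemma S_le_exp:
  assumes "j > 0" "0 \<le> t" shows "S j t \<le> exp (b + 2 * real j - d j / 2 * t)"
proof (rule LIMSEQ_le_const2[OF T_tendsto[OF assms(2)]], intro exI allI impI)
  fix k :: nat
  have "T k j t \<le> exp (\<Sum>i=j..<j+k. 2 * (d j / 2) / d i) * exp (- (d j / 2) * t)"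
    by (rule T_le_exp) (use assms d_nonneg in auto)
  also have "(\<Sum>i=j..<j+k. 2 * (d j / 2) / d i) \<le> b + 2 * real j"
    using d_sum[OF assms(1)] by simp
  then have "exp (\<Sum>i=j..<j+k. 2 * (d j / 2) / d i) * exp (- (d j / 2) * t) \<le>
      exp (b + 2 * real j) * exp (- (d j / 2) * t)"
    by (intro mult_right_mono) auto
  finally show "T k j t \<le> exp (b + 2 * real j - d j / 2 * t)"
    by (simp flip: exp_add)
qed

text \<open>Completing the square: \<open>(2 + \<beta>) j\<close> is dominated by
  \<open>\<kappa> * \<tau> / 2\<close> times \<open>j\<close> squared, up to a constant independent
  of \<open>j\<close>.\<close>

lemma quadratic_exponent_bound:
  assumes "\<tau> > 0"
  shows "b + 2 * real j - d j / 2 * \<tau> \<le> b + (2 + \<beta>)\<^sup>2 / (2 * \<kappa> * \<tau>) - \<beta> * real j"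
proof -
  let ?a = "2 + \<beta>" and ?c = "\<kappa> * \<tau> / 2"
  have c: "?c > 0" using kappa_pos assms by simp
  have "0 \<le> (2 * ?c * real j - ?a)\<^sup>2" by simp
  then have "(?a * real j - ?c * (real j)\<^sup>2) * (4 * ?c) \<le> ?a\<^sup>2"
    by (simp only: power2_diff power_mult_distrib) (simp add: algebra_simps power2_eq_square)
  then have "?a * real j - ?c * (real j)\<^sup>2 \<le> ?a\<^sup>2 / (4 * ?c)"
    using c pos_le_divide_eq[of "4 * ?c"] by simp
  moreover have "?c * (real j)\<^sup>2 \<le> d j / 2 * \<tau>"
    using mult_right_mono[OF d_growth[of j], of "\<tau> / 2"] assms by (simp add: algebra_simps)
  moreover have "4 * ?c = 2 * \<kappa> * \<tau>" by simp
  ultimately show ?thesis by (simp only: distrib_right)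
qed

text \<open>\<open>\<beta>\<close> is arbitrary, so at times bounded away from 0 the tail beats
  every geometric factor. The power series built from the chain therefore converge
  everywhere.\<close>

lemma S_decay:
  assumes "\<tau> > 0"
  obtains C where "C > 0" "\<And>j t. \<tau> \<le> t \<Longrightarrow> S j t \<le> C * exp (- \<beta> * real j)"
proof
  \<comment> \<open>The maximum with 1 covers \<open>j = 0\<close>, where the tail is constantly
    1.\<close>
  let ?C = "max 1 (exp (b + (2 + \<beta>)\<^sup>2 / (2 * \<kappa> * \<tau>)))"
  show "?C > 0" by simp
  fix j t assume t: "\<tau> \<le> t"
  show "S j t \<le> ?C * exp (- \<beta> * real j)"
  proof (cases "j = 0")
    case True
    then show ?thesis using S_0[of t] t assms by simp
  next
    case False
    then have "S j t \<le> exp (b + 2 * real j - d j / 2 * t)"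
      using S_le_exp t assms by simp
    also have "\<dots> \<le> exp (b + 2 * real j - d j / 2 * \<tau>)"
      using t d_nonneg[of j] by (simp add: mult_left_mono)
    also have "\<dots> \<le> exp (b + (2 + \<beta>)\<^sup>2 / (2 * \<kappa> * \<tau>) - \<beta> * real j)"
      using quadratic_exponent_bound[OF assms] by simp
    also have "\<dots> = exp (b + (2 + \<beta>)\<^sup>2 / (2 * \<kappa> * \<tau>)) * exp (- \<beta> * real j)"
      by (simp flip: exp_add)
    also have "\<dots> \<le> ?C * exp (- \<beta> * real j)"
      by (intro mult_right_mono) auto
    finally show ?thesis .
  qed
qed

text \<open>Decay in \<open>j\<close> and in \<open>t\<close> at once, for the part of the kernel
  beyond \<open>j = 1\<close> at large times.\<close>

lemma S_decay_late:
  obtains C where "C > 0"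
    "\<And>j t. 2 \<le> j \<Longrightarrow> 1 \<le> t \<Longrightarrow> S j t \<le> C * exp (- \<beta> * real j) * exp (- d 2 / 2 * t)"
proof
  let ?C = "exp (b + (2 + \<beta>)\<^sup>2 / (2 * \<kappa> * 1) + d 2 / 2)"
  show "?C > 0" by simp
  fix j :: nat and t :: real assume *: "2 \<le> j" "1 \<le> t"
  have "S j t \<le> exp (b + 2 * real j - d j / 2 * t)"
    using S_le_exp * by simp
  \<comment> \<open>Split \<open>t\<close> as \<open>(t - 1) + 1\<close>: over the first piece the
    rate is lowered to \<open>d 2\<close>, while the last unit of time keeps the rate
    \<open>d j\<close> and pays for the decay in \<open>j\<close>.\<close>
  also have "d j / 2 * t \<ge> d 2 / 2 * (t - 1) + d j / 2 * 1"
    using mult_right_mono[OF d_mono[OF *(1)], of "t - 1"] * by (simp add: field_simps)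
  then have "exp (b + 2 * real j - d j / 2 * t) \<le>
      exp (b + (2 + \<beta>)\<^sup>2 / (2 * \<kappa> * 1) + d 2 / 2 - \<beta> * real j - d 2 / 2 * t)"
    using quadratic_exponent_bound[of 1 j \<beta>] by (simp only: exp_le_cancel_iff) (simp add: right_diff_distrib)
  also have "\<dots> = ?C * exp (- \<beta> * real j) * exp (- d 2 / 2 * t)"
    by (simp flip: exp_add)
  finally show "S j t \<le> ?C * exp (- \<beta> * real j) * exp (- d 2 / 2 * t)" .
qed

section \<open>Point probabilities of the chain\<close>

lemma \<pi>_nonneg: "0 \<le> t \<Longrightarrow> 0 \<le> \<pi> j t"
  using S_bounds(3) by (simp add: death_prob_def)

lemma \<pi>_le_S: "0 \<le> t \<Longrightarrow> \<pi> j t \<le> S j t"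
  using S_nonneg by (simp add: death_prob_def)

lemma \<pi>_deriv:
  "0 < t \<Longrightarrow> (\<pi> j has_real_derivative - d j * \<pi> j t + d (Suc j) * \<pi> (Suc j) t) (at t)"
  unfolding death_prob_def[abs_def]
  by (rule derivative_eq_intros S_deriv refl | assumption)+ (simp add: death_prob_def)

text \<open>At positive times no mass is left at infinity: the tails tend to 0, so their differences
  telescope to \<open>S 0 t = 1\<close>.\<close>

lemma \<pi>_sums:
  assumes "0 < t" shows "(\<lambda>j. \<pi> j t) sums 1"
proof -
  obtain C where C: "\<And>j u. t \<le> u \<Longrightarrow> S j u \<le> C * exp (- 1 * real j)"
    using S_decay[OF assms] by metis
  have "(\<lambda>j. S j t) \<longlonglongrightarrow> 0"
  proof (rule tendsto_sandwich[of "\<lambda>_. 0" _ _ "\<lambda>j. C * exp (- 1 * real j)"])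
    show "(\<lambda>j. C * exp (- 1 * real j)) \<longlonglongrightarrow> 0"
      by real_asymp
  qed (use C S_nonneg assms in auto)
  from telescope_sums'[OF this] show ?thesis
    using S_0[of t] assms by (simp add: death_prob_def)
qed

text \<open>State 0 is absorbing, so if \<open>\<pi> 0\<close> vanished at \<open>t\<close> it would
  vanish on all of (0, t). The forward equation for state \<open>j\<close> then forces
  \<open>\<pi> (Suc j)\<close> to vanish as well, and all point probabilities would be 0, against
  their sum 1.\<close>

lemma \<pi>_0_pos:
  assumes t: "0 < t" shows "0 < \<pi> 0 t"
proof (rule ccontr)
  assume "\<not> 0 < \<pi> 0 t"
  then have z: "\<pi> 0 t \<le> 0" by simp
  have "\<pi> j u = 0" if "0 < u" "u < t" for j u
    using that
  proof (induction j arbitrary: u)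
    case 0
    have "\<pi> 0 u \<le> \<pi> 0 t"
    proof (rule DERIV_nonneg_imp_nondecreasing[of u t "\<pi> 0"])
      fix x assume "u \<le> x" "x \<le> t"
      then show "\<exists>y. (\<pi> 0 has_real_derivative y) (at x) \<and> 0 \<le> y"
        using \<pi>_deriv[of x 0] \<pi>_nonneg[of x 1] d_nonneg[of 1] d_zero 0 by fastforce
    qed (use 0 in simp)
    then show ?case using \<pi>_nonneg[of u 0] z 0 by simp
  next
    case (Suc j)
    have "(\<pi> j has_real_derivative 0) (at u)"
    proof (rule has_field_derivative_transform_within_open)
      show "((\<lambda>_. 0) has_real_derivative 0) (at u)" by simp
    qed (use Suc in \<open>auto intro: open_greaterThanLessThan[of 0 t]\<close>)
    then have "- d j * \<pi> j u + d (Suc j) * \<pi> (Suc j) u = 0"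
      using \<pi>_deriv[of u j] Suc.prems DERIV_unique by blast
    then show ?case using Suc.IH[OF Suc.prems] d_pos[of "Suc j"] by simp
  qed
  then have "(\<lambda>j. \<pi> j (t / 2)) = (\<lambda>_. 0)" using t by auto
  with \<pi>_sums[of "t/2"] t show False by (metis half_gt_zero sums_zero sums_unique2 zero_neq_one)
qed

lemma \<pi>_1_ge: "0 \<le> t \<Longrightarrow> exp (- d 1 * t) - S 2 t \<le> \<pi> 1 t"
  using S_bounds(1)[of t 1] by (simp add: death_prob_def numeral_2_eq_2)

end

section \<open>The zonal heat kernel\<close>

text \<open>The eigenvalue of -1/2 Delta on spherical harmonics of degree \<open>2 j\<close> on the
  sphere of radius \<open>r\<close> in dimension \<open>m + 1\<close>.\<close>

definition sphere_rate :: "nat \<Rightarrow> real \<Rightarrow> nat \<Rightarrow> real" where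
  "sphere_rate m r j = real j * (2 * real j + real m - 1) / r\<^sup>2"

text \<open>Reciprocal of the mean of \<open>\<langle>x, y\<rangle>\<^bsup>2j\<^esup>\<close> over unit vectors \<open>y\<close>, for a unit vector \<open>x\<close> in dimension \<open>m + 1\<close>.\<close>
definition sphere_weight :: "nat \<Rightarrow> nat \<Rightarrow> real" where
  "sphere_weight m j = (\<Prod>i<j. (2 * real i + 1 + real m) / (2 * real i + 1))"

definition zonal_coeff :: "nat \<Rightarrow> real \<Rightarrow> real \<Rightarrow> nat \<Rightarrow> real" where
  "zonal_coeff m r t j = death_prob (sphere_rate m r) j t * sphere_weight m j"

text \<open>The heat kernel of the projective space relative to normalized volume, as a function of
  \<open>v = (x \<bullet> y / r\<^sup>2)\<^sup>2\<close>.\<close>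
definition zonal :: "nat \<Rightarrow> real \<Rightarrow> real \<Rightarrow> real \<Rightarrow> real" where
  "zonal m r v t = (\<Sum>j. zonal_coeff m r t j * v ^ j)"

definition zonal1 :: "nat \<Rightarrow> real \<Rightarrow> real \<Rightarrow> real \<Rightarrow> real" where
  "zonal1 m r v t = (\<Sum>j. diffs (zonal_coeff m r t) j * v ^ j)"

definition zonal2 :: "nat \<Rightarrow> real \<Rightarrow> real \<Rightarrow> real \<Rightarrow> real" where
  "zonal2 m r v t = (\<Sum>j. diffs (diffs (zonal_coeff m r t)) j * v ^ j)"

text \<open>Half the Laplace-Beltrami operator in the variable \<open>v\<close>: the squared
  gradient of \<open>v\<close> is 4v(1 - v)/r^2 and its Laplacian is (2 - 2(m + 1)v)/r^2.\<close>

definition zonal_dt :: "nat \<Rightarrow> real \<Rightarrow> real \<Rightarrow> real \<Rightarrow> real" where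
  "zonal_dt m r v t = (2 * v * (1 - v) * zonal2 m r v t + (1 - (real m + 1) * v) * zonal1 m r v t) / r\<^sup>2"

text \<open>For n at least 1, 1/n^2 is at most 2/(n(n + 1)), which telescopes.\<close>

lemma sum_inverse_squares_le:
  assumes "j > 0"
  shows "(\<Sum>i=j..<n. 1 / (real i)\<^sup>2) \<le> 2 / real j"
proof (cases "j \<le> n")
  case True
  then have "(\<Sum>i=j..<n. 1 / (real i)\<^sup>2) \<le> 2 / real j - 2 / real n"
  proof (induction n rule: dec_induct)
    case (step n)
    have n: "0 < real n" "1 \<le> real n" using step assms by auto
    have "1 / (real n)\<^sup>2 = 2 / (real n * (real n + real n))"
      by (simp add: power2_eq_square)
    also have "\<dots> \<le> 2 / (real n * (real n + 1))"
      using n by (intro divide_left_mono mult_left_mono mult_pos_pos) auto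
    also have "\<dots> = 2 / real n - 2 / real (Suc n)"
      using n by (simp add: field_simps)
    finally have "1 / (real n)\<^sup>2 \<le> 2 / real n - 2 / real (Suc n)" .
    then show ?case using step by simp
  qed simp
  then show ?thesis by (rule order_trans) simp
qed (use assms in simp)

locale sphere_heat =
  fixes m :: nat and r :: real
  assumes m: "1 \<le> m" and r: "0 < r"

text \<open>For m at least 1 the rates satisfy d_i at least 2i^2/r^2, which gives the growth
  constant. The same bound in the denominators and \<open>sum_inverse_squares_le\<close> bound the
  sum in \<open>d_sum\<close> by 2j + m - 1.\<close>

sublocale sphere_heat \<subseteq> death_rates "sphere_rate m r" "real m" "2 / r\<^sup>2"
proof
  show "sphere_rate m r 0 = 0" by (simp add: sphere_rate_def)
  show "0 < sphere_rate m r j" if "j > 0" for j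
    using that m r by (simp add: sphere_rate_def)
  show "sphere_rate m r i \<le> sphere_rate m r j" if "i \<le> j" for i j
    using that m r unfolding sphere_rate_def by (intro divide_right_mono mult_mono) auto
  show "2 / r\<^sup>2 * (real j)\<^sup>2 \<le> sphere_rate m r j" for j
  proof -
    have "2 * (real j)\<^sup>2 \<le> real j * (2 * real j + real m - 1)"
      using m mult_left_mono[of 1 "real m" "real j"] by (simp add: power2_eq_square algebra_simps)
    then show ?thesis
      using r by (simp add: sphere_rate_def divide_right_mono)
  qed
  show "0 < 2 / r\<^sup>2" using r by simp
  show "(\<Sum>i=j..<n. sphere_rate m r j / sphere_rate m r i) \<le> real m + 2 * real j" if j: "j > 0" for j n
  proof -
    define q where "q = real j * (2 * real j + real m - 1)"
    have q: "0 \<le> q" using m by (simp add: q_def)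
    have "(\<Sum>i=j..<n. sphere_rate m r j / sphere_rate m r i) \<le> (\<Sum>i=j..<n. q / 2 * (1 / (real i)\<^sup>2))"
    proof (rule sum_mono)
      fix i assume "i \<in> {j..<n}"
      then have i: "0 < real i" using j by simp
      have "sphere_rate m r j / sphere_rate m r i = q / (real i * (2 * real i + real m - 1))"
        using r by (simp add: sphere_rate_def q_def)
      also have "\<dots> \<le> q / (2 * (real i)\<^sup>2)"
      proof (rule divide_left_mono[OF _ q])
        show "2 * (real i)\<^sup>2 \<le> real i * (2 * real i + real m - 1)"
          using m mult_left_mono[of 1 "real m" "real i"] by (simp add: power2_eq_square algebra_simps)
        show "0 < real i * (2 * real i + real m - 1) * (2 * (real i)\<^sup>2)"
          using i m by (intro mult_pos_pos) auto
      qed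
      finally show "sphere_rate m r j / sphere_rate m r i \<le> q / 2 * (1 / (real i)\<^sup>2)" by simp
    qed
    also have "\<dots> = q / 2 * (\<Sum>i=j..<n. 1 / (real i)\<^sup>2)" by (simp add: sum_distrib_left)
    also have "\<dots> \<le> q / 2 * (2 / real j)"
      using sum_inverse_squares_le[OF j] q by (intro mult_left_mono) auto
    also have "\<dots> \<le> real m + 2 * real j"
      using j by (simp add: q_def)
    finally show ?thesis .
  qed
qed

context sphere_heat
begin

abbreviation "d \<equiv> sphere_rate m r"
abbreviation "w \<equiv> sphere_weight m"
abbreviation "c \<equiv> zonal_coeff m r"

section \<open>Geometric bounds for weights, rates and coefficients\<close>

lemma w_pos: "0 < w j"
  unfolding sphere_weight_def by (intro prod_pos) auto

lemma w_Suc: "w (Suc j) = w j * ((2 * real j + 1 + real m) / (2 * real j + 1))"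
  by (simp add: sphere_weight_def)

lemma w_le: "w j \<le> (1 + real m) ^ j"
proof -
  have "w j \<le> (\<Prod>i<j. 1 + real m)"
    unfolding sphere_weight_def
    by (intro prod_mono) (auto simp: field_simps)
  then show ?thesis by simp
qed

text \<open>Quadratic growth is traded for \<open>4 ^ j\<close>, so that every factor is geometric
  and can be absorbed by \<open>S_power_decay\<close>.\<close>

lemma d_le: "d j \<le> (2 + real m) / r\<^sup>2 * 4 ^ j"
proof -
  have j: "real j \<le> 2 ^ j" using of_nat_less_two_power[of j] by (simp add: less_imp_le)
  have "real m * 1 \<le> real m * 2 ^ j" by (intro mult_left_mono) auto
  then have "2 * real j + real m - 1 \<le> 2 * 2 ^ j + real m * 2 ^ j" using j by linarith
  then have "real j * (2 * real j + real m - 1) \<le> 2 ^ j * (2 * 2 ^ j + real m * 2 ^ j)"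
    using j m by (intro mult_mono) auto
  also have "\<dots> = (2 + real m) * 4 ^ j"
    by (simp add: algebra_simps flip: power_mult_distrib)
  finally show ?thesis
    using r by (simp add: sphere_rate_def divide_right_mono)
qed

lemma S_power_decay:
  assumes "0 < \<tau>" "0 < B"
  obtains C where "0 < C" "\<And>j t. \<tau> \<le> t \<Longrightarrow> S j t * B ^ j \<le> C"
proof -
  obtain C where C: "0 < C" "\<And>j t. \<tau> \<le> t \<Longrightarrow> S j t \<le> C * exp (- ln B * real j)"
    using S_decay[OF assms(1)] by metis
  have "S j t * B ^ j \<le> C" if "\<tau> \<le> t" for j t
  proof -
    have e: "exp (- ln B * real j) * B ^ j = 1"
      using assms(2) by (simp add: exp_minus mult.commute[of "ln B"] exp_of_nat_mult field_simps)
    have "S j t * B ^ j \<le> C * exp (- ln B * real j) * B ^ j"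
      using C(2)[OF that] assms(2) by (intro mult_right_mono) auto
    then show ?thesis using e by (simp add: mult.assoc)
  qed
  with C(1) show ?thesis using that by blast
qed

lemma c_nonneg: "0 \<le> t \<Longrightarrow> 0 \<le> c t j"
  unfolding zonal_coeff_def by (intro mult_nonneg_nonneg \<pi>_nonneg less_imp_le[OF w_pos])

text \<open>The base \<open>(1 + real m) * B * 2\<close> absorbs the weight and the power of
  \<open>B\<close>; the spare factor 2 leaves a summable majorant, uniform in
  \<open>t \<ge> \<tau>\<close>.\<close>

lemma c_decay:
  assumes "0 < \<tau>" "0 < B"
  obtains C where "0 < C" "\<And>j t. \<tau> \<le> t \<Longrightarrow> c t j * B ^ j \<le> C * (1/2) ^ j"
proof -
  obtain C where C: "0 < C" "\<And>j t. \<tau> \<le> t \<Longrightarrow> S j t * ((1 + real m) * B * 2) ^ j \<le> C"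
    using S_power_decay[of \<tau> "(1 + real m) * B * 2"] assms by auto
  have "c t j * B ^ j \<le> C * (1/2) ^ j" if "\<tau> \<le> t" for t j
  proof -
    have "c t j * B ^ j * 2 ^ j \<le> S j t * (1 + real m) ^ j * B ^ j * 2 ^ j"
      unfolding zonal_coeff_def using that assms
      by (intro mult_right_mono mult_mono \<pi>_le_S w_le S_nonneg less_imp_le[OF w_pos]) auto
    also have "\<dots> \<le> C" using C(2)[OF that, of j] by (simp only: power_mult_distrib mult_ac)
    finally show ?thesis by (simp add: field_simps)
  qed
  with C(1) show ?thesis using that by blast
qed

lemma summable_c: "0 < t \<Longrightarrow> summable (\<lambda>j. c t j * v ^ j)" for v :: real
proof -
  assume t: "0 < t"
  have "0 < \<bar>v\<bar> + 1" by simp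
  then obtain C where C: "0 < C" "\<And>j u. t \<le> u \<Longrightarrow> c u j * (\<bar>v\<bar> + 1) ^ j \<le> C * (1/2) ^ j"
    using c_decay[OF t] by metis
  show ?thesis
  proof (rule summable_comparison_test')
    show "summable (\<lambda>j. C * (1/2::real) ^ j)" by (intro summable_mult summable_geometric) simp
    fix j :: nat
    have "norm (c t j * v ^ j) = c t j * \<bar>v\<bar> ^ j"
      using c_nonneg[of t j] t by (simp add: abs_mult power_abs)
    also have "\<dots> \<le> c t j * (\<bar>v\<bar> + 1) ^ j"
      using c_nonneg[of t j] t by (intro mult_left_mono power_mono) auto
    also have "\<dots> \<le> C * (1/2) ^ j" using C(2)[of t j] by simp
    finally show "norm (c t j * v ^ j) \<le> C * (1/2) ^ j" .
  qed
qed

lemma summable_diffs_everywhere: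
  fixes a :: "nat \<Rightarrow> real"
  assumes "\<And>v. summable (\<lambda>j. a j * v ^ j)"
  shows "summable (\<lambda>j. diffs a j * v ^ j)"
  using termdiff_converges_all[OF assms] .

lemma zonal_deriv: "0 < t \<Longrightarrow> ((\<lambda>v. zonal m r v t) has_real_derivative zonal1 m r v t) (at v)"
  unfolding zonal_def zonal1_def
  by (intro termdiffs_strong_converges_everywhere summable_c)

lemma zonal1_deriv: "0 < t \<Longrightarrow> ((\<lambda>v. zonal1 m r v t) has_real_derivative zonal2 m r v t) (at v)"
  unfolding zonal1_def zonal2_def
  by (intro termdiffs_strong_converges_everywhere summable_diffs_everywhere summable_c)

lemma zonal_cont_v: "0 < t \<Longrightarrow> continuous_on A (\<lambda>v. zonal m r v t)"
  by (rule DERIV_continuous_on, rule has_field_derivative_at_within, rule zonal_deriv)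

lemma zonal1_cont_v: "0 < t \<Longrightarrow> continuous_on A (\<lambda>v. zonal1 m r v t)"
  by (rule DERIV_continuous_on, rule has_field_derivative_at_within, rule zonal1_deriv)

lemma zonal2_cont_v: "0 < t \<Longrightarrow> continuous_on A (\<lambda>v. zonal2 m r v t)"
  unfolding zonal2_def
  by (rule DERIV_continuous_on, rule has_field_derivative_at_within,
      rule termdiffs_strong_converges_everywhere)
     (intro summable_diffs_everywhere summable_c)

section \<open>The heat equation for the zonal series\<close>

definition c_dt :: "real \<Rightarrow> nat \<Rightarrow> real" where
  "c_dt t j = (- d j * \<pi> j t + d (Suc j) * \<pi> (Suc j) t) * w j"

text \<open>The ratio of consecutive weights turns the flow from \<open>j + 1\<close> to
  \<open>j\<close> into a multiple of \<open>c t (Suc j)\<close>. In this form the time derivative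
  can be compared with the coefficients of a differentiated power series.\<close>

lemma c_dt_eq:
  "c_dt t j = ((real j + 1) * (2 * real j + 1) * c t (Suc j) - real j * (2 * real j + real m - 1) * c t j) / r\<^sup>2"
proof -
  have "2 * real j + 1 \<noteq> 0" by linarith
  then have w: "w j * (2 * real j + 1 + real m) = w (Suc j) * (2 * real j + 1)"
    by (simp add: w_Suc)
  have "d (Suc j) * w j = (real j + 1) * (w j * (2 * real j + 1 + real m)) / r\<^sup>2"
    by (simp add: sphere_rate_def algebra_simps)
  then have "\<pi> (Suc j) t * (d (Suc j) * w j) = \<pi> (Suc j) t * ((real j + 1) * (w (Suc j) * (2 * real j + 1)) / r\<^sup>2)"
    unfolding w by simp
  then have "d (Suc j) * \<pi> (Suc j) t * w j = (real j + 1) * (2 * real j + 1) * c t (Suc j) / r\<^sup>2"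
    by (simp add: zonal_coeff_def mult_ac)
  moreover have "d j * \<pi> j t * w j = real j * (2 * real j + real m - 1) * c t j / r\<^sup>2"
    by (simp add: sphere_rate_def zonal_coeff_def)
  ultimately show ?thesis
    unfolding c_dt_def distrib_right diff_divide_distrib mult_minus_left by (simp only: diff_conv_add_uminus add.commute)
qed

text \<open>Comparison of coefficients: in 2v(1 - v)f'' + (1 - (m + 1)v)f' the power v^j carries (j
  + 1)(2j + 1)c_{j+1} - j(2j + m - 1)c_j, which is \<open>c_dt_eq\<close> up to the factor
  1/r^2.\<close>

lemma zonal_dt_sums:
  assumes t: "0 < t"
  shows "(\<lambda>j. c_dt t j * v ^ j) sums zonal_dt m r v t"
proof -
  have s1: "summable (\<lambda>j. diffs (c t) j * v ^ j)" for v
    by (intro summable_diffs_everywhere summable_c t)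
  have s2: "summable (\<lambda>j. diffs (diffs (c t)) j * v ^ j)" for v
    by (intro summable_diffs_everywhere summable_c t)
  have shift: "v * (real j * x * v ^ (j - Suc 0)) = real j * x * v ^ j" for j x
    by (cases j) auto
  have a: "(\<lambda>j. (real j + 1) * c t (Suc j) * v ^ j) sums zonal1 m r v t"
    using summable_sums[OF s1] by (simp add: zonal1_def diffs_def add.commute)
  have b: "(\<lambda>j. real j * c t j * v ^ j) sums (v * zonal1 m r v t)"
    using sums_mult[OF diffs_equiv[OF s1[of v]], of v] unfolding shift zonal1_def by simp
  have e: "(\<lambda>j. real j * ((real j + 1) * c t (Suc j)) * v ^ j) sums (v * zonal2 m r v t)"
    using sums_mult[OF diffs_equiv[OF s2[of v]], of v] unfolding shift zonal2_def
    by (simp add: diffs_def add.commute)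
  have "(\<lambda>j. real (Suc j) * (real (Suc j) - 1) * c t (Suc j) * v ^ Suc j) sums (v * (v * zonal2 m r v t))"
    using sums_mult[OF e, of v] by (simp add: algebra_simps)
  then have f: "(\<lambda>j. real j * (real j - 1) * c t j * v ^ j) sums (v * (v * zonal2 m r v t))"
    using sums_Suc_iff[of "\<lambda>j. real j * (real j - 1) * c t j * v ^ j"] by simp
  have "(\<lambda>j. (2 * (real j * ((real j + 1) * c t (Suc j)) * v ^ j) - 2 * (real j * (real j - 1) * c t j * v ^ j)
      + (real j + 1) * c t (Suc j) * v ^ j - (real m + 1) * (real j * c t j * v ^ j)) / r\<^sup>2)
    sums ((2 * (v * zonal2 m r v t) - 2 * (v * (v * zonal2 m r v t)) + zonal1 m r v t
      - (real m + 1) * (v * zonal1 m r v t)) / r\<^sup>2)"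
    by (intro sums_divide sums_add sums_diff sums_mult a b e f)
  moreover have "(2 * (real j * ((real j + 1) * c t (Suc j)) * v ^ j) - 2 * (real j * (real j - 1) * c t j * v ^ j)
      + (real j + 1) * c t (Suc j) * v ^ j - (real m + 1) * (real j * c t j * v ^ j)) / r\<^sup>2 = c_dt t j * v ^ j" for j
    unfolding c_dt_eq by (simp add: algebra_simps diff_divide_distrib add_divide_distrib)
  moreover have "(2 * (v * zonal2 m r v t) - 2 * (v * (v * zonal2 m r v t)) + zonal1 m r v t
      - (real m + 1) * (v * zonal1 m r v t)) / r\<^sup>2 = zonal_dt m r v t"
    unfolding zonal_dt_def by (simp add: algebra_simps)
  ultimately show ?thesis by simp
qed

lemma c_dt_bound:
  assumes "0 < \<tau>"
  obtains C where "0 < C" "\<And>j t. \<tau> \<le> t \<Longrightarrow> \<bar>c_dt t j\<bar> \<le> C * (1/2) ^ j"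
proof -
  define K where "K = (2 + real m) / r\<^sup>2"
  have K: "0 < K" using r by (simp add: K_def)
  \<comment> \<open>4 for the growth of the rates, \<open>1 + real m\<close> for the weights, and 2
    for the factor \<open>(1/2) ^ j\<close> in the conclusion.\<close>
  define B where "B = 8 * (1 + real m)"
  have B: "1 \<le> B" by (simp add: B_def)
  obtain C where C: "0 < C" "\<And>j t. \<tau> \<le> t \<Longrightarrow> S j t * B ^ j \<le> C"
    using S_power_decay[of \<tau> B] assms B by auto
  have "\<bar>c_dt t j\<bar> \<le> (5 * K * C) * (1/2) ^ j" if t: "\<tau> \<le> t" for t j
  proof -
    have t0: "0 \<le> t" using t assms by simp
    have d: "d j \<le> K * 4 ^ j" for j using d_le by (simp add: K_def)
    have W: "w j * 2 ^ j * 4 ^ j \<le> B ^ j"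
    proof -
      have "w j * 2 ^ j * 4 ^ j = 8 ^ j * w j"
        by (simp flip: power_mult_distrib)
      also have "\<dots> \<le> 8 ^ j * (1 + real m) ^ j"
        by (intro mult_left_mono w_le) auto
      finally show ?thesis by (simp only: B_def power_mult_distrib)
    qed
    have 1: "d j * \<pi> j t * w j * 2 ^ j \<le> K * C"
    proof -
      have "d j * \<pi> j t * w j * 2 ^ j \<le> (K * 4 ^ j) * S j t * w j * 2 ^ j"
        using d \<pi>_le_S[OF t0] \<pi>_nonneg[OF t0] w_pos[of j] K
        by (intro mult_right_mono mult_mono) auto
      also have "\<dots> = K * (S j t * (w j * 2 ^ j * 4 ^ j))" by simp
      also have "\<dots> \<le> K * (S j t * B ^ j)"
        using W K S_nonneg[OF t0] by (intro mult_left_mono) auto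
      also have "\<dots> \<le> K * C" using C(2)[OF t] K by simp
      finally show ?thesis .
    qed
    have 2: "d (Suc j) * \<pi> (Suc j) t * w j * 2 ^ j \<le> 4 * K * C"
    proof -
      have "d (Suc j) * \<pi> (Suc j) t * w j * 2 ^ j \<le> (K * 4 ^ Suc j) * S (Suc j) t * w j * 2 ^ j"
        using d[of "Suc j"] \<pi>_le_S[OF t0] \<pi>_nonneg[OF t0] w_pos[of j] K
        by (intro mult_right_mono mult_mono) auto
      also have "\<dots> = 4 * K * (S (Suc j) t * (w j * 2 ^ j * 4 ^ j))" by simp
      also have "\<dots> \<le> 4 * K * (S (Suc j) t * B ^ Suc j)"
      proof -
        have "B ^ j \<le> B ^ Suc j" using B by (intro power_increasing) auto
        with W show ?thesis using K S_nonneg[OF t0] by (intro mult_left_mono) auto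
      qed
      also have "\<dots> \<le> 4 * K * C" using C(2)[OF t, of "Suc j"] K by simp
      finally show ?thesis .
    qed
    have "\<bar>c_dt t j\<bar> \<le> d j * \<pi> j t * w j + d (Suc j) * \<pi> (Suc j) t * w j"
      unfolding c_dt_def distrib_right
      using d_nonneg[of j] d_nonneg[of "Suc j"] \<pi>_nonneg[OF t0, of j] \<pi>_nonneg[OF t0, of "Suc j"] w_pos[of j]
      by (intro order_trans[OF abs_triangle_ineq]) (simp add: abs_mult)
    then have "\<bar>c_dt t j\<bar> * 2 ^ j \<le> (d j * \<pi> j t * w j + d (Suc j) * \<pi> (Suc j) t * w j) * 2 ^ j"
      by (intro mult_right_mono) auto
    also have "\<dots> \<le> 5 * K * C" using 1 2 by (simp add: distrib_right)
    finally show ?thesis by (simp add: field_simps)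
  qed
  moreover have "0 < 5 * K * C" using K C by simp
  ultimately show ?thesis using that by blast
qed

lemma half_sums: "(\<lambda>j. C * (1/2) ^ j) sums (2 * C)" for C :: real
  using sums_mult[OF geometric_sums[of "1/2::real"], of C] by (simp add: mult.commute)

lemma power_le_one_mult:
  fixes x v :: real assumes "0 \<le> v" "v \<le> 1" shows "\<bar>x * v ^ j\<bar> \<le> \<bar>x\<bar>"
  using assms by (simp add: abs_mult mult_left_le power_le_one)

lemma zonal_dt_bounded:
  assumes "0 < \<tau>"
  obtains C where "\<And>v t. 0 \<le> v \<Longrightarrow> v \<le> 1 \<Longrightarrow> \<tau> \<le> t \<Longrightarrow> \<bar>zonal_dt m r v t\<bar> \<le> C"
proof -
  obtain C where C: "0 < C" "\<And>j t. \<tau> \<le> t \<Longrightarrow> \<bar>c_dt t j\<bar> \<le> C * (1/2) ^ j"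
    using c_dt_bound[OF assms] by metis
  have "\<bar>zonal_dt m r v t\<bar> \<le> 2 * C" if "0 \<le> v" "v \<le> 1" "\<tau> \<le> t" for v t
  proof -
    have "norm (\<Sum>j. c_dt t j * v ^ j) \<le> (\<Sum>j. C * (1/2) ^ j)"
    proof (rule norm_suminf_le)
    qed (use order_trans[OF power_le_one_mult C(2)] that half_sums sums_summable in auto)
    then show ?thesis
      using sums_unique[OF zonal_dt_sums[of t v]] sums_unique[OF half_sums[of C]] that assms by simp
  qed
  then show ?thesis using that by blast
qed

lemma zonal_bounded:
  assumes "0 < \<tau>"
  obtains C where "\<And>v t. 0 \<le> v \<Longrightarrow> v \<le> 1 \<Longrightarrow> \<tau> \<le> t \<Longrightarrow> \<bar>zonal m r v t\<bar> \<le> C"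
proof -
  obtain C where C: "0 < C" "\<And>j t. \<tau> \<le> t \<Longrightarrow> c t j * 1 ^ j \<le> C * (1/2) ^ j"
    using c_decay[OF assms zero_less_one] by metis
  have "\<bar>zonal m r v t\<bar> \<le> 2 * C" if "0 \<le> v" "v \<le> 1" "\<tau> \<le> t" for v t
  proof -
    have "\<bar>c t j\<bar> \<le> C * (1/2) ^ j" for j
      using C(2)[OF that(3), of j] c_nonneg[of t j] that assms by simp
    then have "norm (\<Sum>j. c t j * v ^ j) \<le> (\<Sum>j. C * (1/2) ^ j)"
      using that by (intro norm_suminf_le) (auto intro: order_trans[OF power_le_one_mult] sums_summable[OF half_sums])
    then show ?thesis
      using sums_unique[OF half_sums[of C]] by (simp add: zonal_def)
  qed
  then show ?thesis using that by blast
qed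

lemma zonal_deriv_t:
  assumes v: "0 \<le> v" "v \<le> 1" and t: "0 < t"
  shows "((\<lambda>t. zonal m r v t) has_real_derivative zonal_dt m r v t) (at t)"
proof -
  \<comment> \<open>Coefficient bounds are uniform only away from time 0, so the series is
    differentiated termwise on times above \<open>t / 2\<close>.\<close>
  let ?A = "{t/2<..}"
  obtain C where C: "0 < C" "\<And>j u. t/2 \<le> u \<Longrightarrow> \<bar>c_dt u j\<bar> \<le> C * (1/2) ^ j"
    using c_dt_bound[of "t/2"] t by auto
  have "((\<lambda>u. \<Sum>j. c u j * v ^ j) has_real_derivative (\<Sum>j. c_dt t j * v ^ j)) (at t)"
  proof (rule has_field_derivative_series'(2))
    show "convex ?A" by simp
    show "((\<lambda>u. c u j * v ^ j) has_real_derivative c_dt u j * v ^ j) (at u within ?A)"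
      if "u \<in> ?A" for j u
    proof -
      have "(\<pi> j has_real_derivative - d j * \<pi> j u + d (Suc j) * \<pi> (Suc j) u) (at u)"
        using \<pi>_deriv[of u j] that t by auto
      from DERIV_cmult_right[OF DERIV_cmult_right[OF this]] show ?thesis
        unfolding zonal_coeff_def c_dt_def by (rule has_field_derivative_at_within)
    qed
    show "uniformly_convergent_on ?A (\<lambda>n u. \<Sum>j<n. c_dt u j * v ^ j)"
    proof (rule Weierstrass_m_test')
      show "norm (c_dt u j * v ^ j) \<le> C * (1/2) ^ j" if "u \<in> ?A" for j u
        using order_trans[OF power_le_one_mult[OF v] C(2)[of u j]] that by simp
      show "summable (\<lambda>j. C * (1/2) ^ j)" using half_sums sums_summable by blast
    qed
    show "t \<in> ?A" "t \<in> interior ?A" using t by (auto simp: interior_open)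
    show "summable (\<lambda>j. c t j * v ^ j)" by (rule summable_c[OF t])
  qed
  then show ?thesis
    using sums_unique[OF zonal_dt_sums[OF t]] unfolding zonal_def by simp
qed

lemma zonal_cont: "continuous_on ({0..1} \<times> {0<..}) (\<lambda>(v, t). zonal m r v t)"
  unfolding continuous_on_eq_continuous_within
proof
  fix p :: "real \<times> real" assume p: "p \<in> {0..1} \<times> {0<..}"
  define \<tau> where "\<tau> = snd p / 2"
  have \<tau>: "0 < \<tau>" using p by (auto simp: \<tau>_def)
  let ?A = "{0..1} \<times> {\<tau>..}"
  obtain C where C: "0 < C" "\<And>j t. \<tau> \<le> t \<Longrightarrow> c t j * 1 ^ j \<le> C * (1/2) ^ j"
    using c_decay[OF \<tau> zero_less_one] by metis
  have \<pi>_cont: "continuous_on {\<tau>..} (\<pi> j)" for j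
    using \<tau> by (intro DERIV_continuous_on[OF has_field_derivative_at_within[OF \<pi>_deriv]]) auto
  have "continuous_on ?A (\<lambda>q. \<Sum>j. c (snd q) j * fst q ^ j)"
  proof (rule uniform_limit_theorem[OF always_eventually])
    show "\<forall>n. continuous_on ?A (\<lambda>q. \<Sum>j<n. c (snd q) j * fst q ^ j)"
      unfolding zonal_coeff_def
      by (intro allI continuous_intros continuous_on_compose2[OF \<pi>_cont]) auto
    show "uniform_limit ?A (\<lambda>n q. \<Sum>j<n. c (snd q) j * fst q ^ j) (\<lambda>q. \<Sum>j. c (snd q) j * fst q ^ j) sequentially"
    proof (rule Weierstrass_m_test)
      show "norm (c (snd q) j * fst q ^ j) \<le> C * (1/2) ^ j" if "q \<in> ?A" for q j
        using that order_trans[OF power_le_one_mult[of "fst q" "c (snd q) j" j], of "C * (1/2) ^ j"]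
          C(2)[of "snd q" j] c_nonneg[of "snd q" j] \<tau> by auto
      show "summable (\<lambda>j. C * (1/2) ^ j)" using half_sums sums_summable by blast
    qed
  qed simp
  then have "continuous_on ?A (\<lambda>(v, t). zonal m r v t)"
    by (simp add: zonal_def case_prod_unfold)
  then have "continuous (at p within ?A) (\<lambda>(v, t). zonal m r v t)"
    using p \<tau> by (auto simp: continuous_on_eq_continuous_within \<tau>_def)
  moreover have "at p within ?A = at p within {0..1} \<times> {0<..}"
    by (rule at_within_nhd[of _ "UNIV \<times> {\<tau><..}"]) (use p \<tau> in \<open>auto simp: \<tau>_def open_Times\<close>)
  ultimately show "continuous (at p within {0..1} \<times> {0<..}) (\<lambda>(v, t). zonal m r v t)" by simp
qed

text \<open>The constant term alone is positive, because the chain has reached 0 with positive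
  probability.\<close>

lemma zonal_pos:
  assumes "0 \<le> v" "0 < t" shows "0 < zonal m r v t"
proof -
  have "sum (\<lambda>j. c t j * v ^ j) {0} \<le> zonal m r v t"
    unfolding zonal_def using c_nonneg assms
    by (intro sum_le_suminf summable_c) auto
  moreover have "0 < c t 0" using \<pi>_0_pos[OF assms(2)] w_pos by (simp add: zonal_coeff_def)
  ultimately show ?thesis by simp
qed

section \<open>Large and small times\<close>

lemma w_01: "w 0 = 1" "w (Suc 0) = real m + 1"
  by (simp_all add: sphere_weight_def)

text \<open>As the \<open>\<pi> j t\<close> sum to 1, \<open>zonal - 1\<close> is the sum of
  \<open>\<pi> j t * (w j * v ^ j - 1)\<close>. The term \<open>j = 0\<close> vanishes,
  \<open>j = 1\<close> is the first-order term, and the others are controlled by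
  \<open>S_decay_late\<close>.\<close>

lemma zonal_first_order:
  obtains C where "0 < C"
    "\<And>v t. 0 \<le> v \<Longrightarrow> v \<le> 1 \<Longrightarrow> 1 \<le> t \<Longrightarrow>
      \<bar>zonal m r v t - 1 - \<pi> 1 t * ((real m + 1) * v - 1)\<bar> \<le> C * exp (- d 2 / 2 * t)"
    "\<And>t. 1 \<le> t \<Longrightarrow> exp (- d 1 * t) - C * exp (- d 2 / 2 * t) \<le> \<pi> 1 t"
proof -
  \<comment> \<open>Chosen so that the decay in \<open>j\<close> outweighs the bound
    \<open>(1 + real m) ^ j\<close> for the weights by \<open>2 ^ j\<close>.\<close>
  define \<beta> where "\<beta> = ln (2 * (1 + real m))"
  have \<beta>: "0 \<le> \<beta>" unfolding \<beta>_def by (intro ln_ge_zero) auto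
  have exp_\<beta>: "exp (- \<beta> * real j) * (1 + real m) ^ j = (1/2) ^ j" for j
    by (simp add: \<beta>_def exp_minus mult.commute[of "ln _"] exp_of_nat_mult power_mult_distrib
        field_simps flip: power_mult_distrib)
  obtain C where C: "0 < C"
    "\<And>j t. 2 \<le> j \<Longrightarrow> 1 \<le> t \<Longrightarrow> S j t \<le> C * exp (- \<beta> * real j) * exp (- d 2 / 2 * t)"
    using S_decay_late[of \<beta>] by metis
  have 1: "\<bar>zonal m r v t - 1 - \<pi> 1 t * ((real m + 1) * v - 1)\<bar> \<le> 2 * C * exp (- d 2 / 2 * t)"
    if v: "0 \<le> v" "v \<le> 1" and t: "1 \<le> t" for v t
  proof -
    define f where "f j = \<pi> j t * (w j * v ^ j - 1)" for j
    have "(\<lambda>j. c t j * v ^ j - \<pi> j t) sums (zonal m r v t - 1)"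
      unfolding zonal_def using t by (intro sums_diff summable_sums summable_c \<pi>_sums) auto
    then have "f sums (zonal m r v t - 1)"
      by (simp add: f_def[abs_def] zonal_coeff_def right_diff_distrib mult.assoc)
    then have tail: "(\<lambda>j. f (j + 2)) sums (zonal m r v t - 1 - \<pi> 1 t * ((real m + 1) * v - 1))"
      by (subst sums_iff_shift) (simp add: f_def w_01 numeral_2_eq_2)
    define C' where "C' = C * exp (- d 2 / 2 * t)"
    have "norm (f (j + 2)) \<le> C' * (1/2) ^ j" for j
    proof -
      let ?k = "j + 2"
      have "0 \<le> w ?k * v ^ ?k" using w_pos[of ?k] v by simp
      moreover have "w ?k * v ^ ?k \<le> (1 + real m) ^ ?k * 1"
        using w_pos[of ?k] v w_le[of ?k] by (intro mult_mono power_le_one) auto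
      moreover have "1 \<le> (1 + real m) ^ ?k" by (intro one_le_power) simp
      ultimately have "\<bar>w ?k * v ^ ?k - 1\<bar> \<le> (1 + real m) ^ ?k" by linarith
      then have "norm (f ?k) \<le> S ?k t * (1 + real m) ^ ?k"
        unfolding f_def real_norm_def abs_mult
        using \<pi>_le_S[of t ?k] \<pi>_nonneg[of t ?k] t by (intro mult_mono) auto
      also have "\<dots> \<le> (C * exp (- \<beta> * real ?k) * exp (- d 2 / 2 * t)) * (1 + real m) ^ ?k"
        using C(2)[of ?k t] t by (intro mult_right_mono) auto
      also have "\<dots> = C' * (exp (- \<beta> * real ?k) * (1 + real m) ^ ?k)"
        by (simp only: C'_def mult_ac)
      also have "\<dots> = C' * (1/2) ^ ?k" by (simp only: exp_\<beta>)
      also have "\<dots> \<le> C' * (1/2) ^ j" using C(1) by (simp add: C'_def)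
      finally show ?thesis .
    qed
    then have "norm (\<Sum>j. f (j + 2)) \<le> (\<Sum>j. C' * (1/2) ^ j)"
      by (intro norm_suminf_le sums_summable[OF half_sums])
    then show ?thesis
      unfolding sums_unique[OF tail, symmetric] sums_unique[OF half_sums, symmetric] C'_def by simp
  qed
  have 2: "exp (- d 1 * t) - 2 * C * exp (- d 2 / 2 * t) \<le> \<pi> 1 t" if t: "1 \<le> t" for t
  proof -
    have "exp (- \<beta> * real 2) \<le> 2" using \<beta> by (simp add: order_trans[of _ 1])
    then have "C * exp (- \<beta> * real 2) * exp (- d 2 / 2 * t) \<le> C * 2 * exp (- d 2 / 2 * t)"
      using C(1) by (intro mult_right_mono mult_left_mono) auto
    with C(2)[of 2 t] \<pi>_1_ge[of t] t show ?thesis by (simp add: mult.commute)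
  qed
  show ?thesis using that[of "2 * C"] 1 2 C(1) by simp
qed

text \<open>The scale \<open>\<epsilon>\<close> is \<open>\<pi> 1\<close>. It is at least of order
  exp(-d_1 t), hence dominates the remainder of order exp(-d_2 t/2), and passing to the logarithm
  costs only a term quadratic in it.\<close>

lemma zonal_long_time:
  "\<exists>\<epsilon>. \<forall>\<delta>>0. \<forall>\<^sub>F t in at_top. 0 < \<epsilon> t \<and>
     (\<forall>v\<in>{0..1}. \<bar>ln (zonal m r v t) - \<epsilon> t * ((real m + 1) * v - 1)\<bar> \<le> \<delta> * \<epsilon> t)"
proof (intro exI allI impI)
  fix \<delta> :: real assume \<delta>: "0 < \<delta>"
  obtain C where C: "0 < C"
    "\<And>v t. 0 \<le> v \<Longrightarrow> v \<le> 1 \<Longrightarrow> 1 \<le> t \<Longrightarrow>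
      \<bar>zonal m r v t - 1 - \<pi> 1 t * ((real m + 1) * v - 1)\<bar> \<le> C * exp (- d 2 / 2 * t)"
    "\<And>t. 1 \<le> t \<Longrightarrow> exp (- d 1 * t) - C * exp (- d 2 / 2 * t) \<le> \<pi> 1 t"
    using zonal_first_order by metis
  \<comment> \<open>This equals 2/r^2: even the halved exponent of the tail bound leaves a
    gap.\<close>
  define \<gamma> where "\<gamma> = d 2 / 2 - d 1"
  have \<gamma>: "0 < \<gamma>" using r by (simp add: \<gamma>_def sphere_rate_def field_simps)
  define A where "A = real m + 1 + \<delta>"
  have A: "0 < A" using \<delta> by (simp add: A_def)
  \<comment> \<open>With \<open>u\<close> the deviation of the kernel from 1 and
    \<open>\<bar>u\<bar> \<le> A * \<pi> 1 t\<close>, the first entry yields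
    \<open>\<bar>u\<bar> \<le> 1/2\<close>, as the logarithm estimate demands, and the second makes
    its quadratic error at most half of the tolerance.\<close>
  define \<eta> where "\<eta> = min (1 / (2 * A)) (\<delta> / (4 * A\<^sup>2))"
  have \<eta>: "0 < \<eta>" using A \<delta> by (simp add: \<eta>_def)
  have d1: "0 < d 1" by (rule d_pos) simp
  have "((\<lambda>t. exp (real m + 2 - d 1 / 2 * t)) \<longlongrightarrow> 0) at_top"
    using d1 by real_asymp
  then have "\<forall>\<^sub>F t in at_top. exp (real m + 2 - d 1 / 2 * t) < \<eta>"
    using \<eta> by (rule order_tendstoD)
  moreover have "filterlim (\<lambda>t. exp (\<gamma> * t)) at_top at_top"
    using \<gamma> by real_asymp
  \<comment> \<open>Multiplied by the size \<open>E\<close> of the remainder this says that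
    \<open>\<pi> 1 t\<close> is at least \<open>(2 * C / \<delta> + 1) * E\<close>: it is positive,
    and \<open>C * E\<close> is at most \<open>\<delta> / 2 * \<pi> 1 t\<close>.\<close>
  then have "\<forall>\<^sub>F t in at_top. C + 2 * C / \<delta> + 1 \<le> exp (\<gamma> * t)"
    unfolding filterlim_at_top by blast
  moreover have "\<forall>\<^sub>F t::real in at_top. 1 \<le> t" by (rule eventually_ge_at_top)
  ultimately show "\<forall>\<^sub>F t in at_top. 0 < \<pi> 1 t \<and>
     (\<forall>v\<in>{0..1}. \<bar>ln (zonal m r v t) - \<pi> 1 t * ((real m + 1) * v - 1)\<bar> \<le> \<delta> * \<pi> 1 t)"
  proof eventually_elim
    case (elim t)
    define E where "E = exp (- d 2 / 2 * t)"
    have E: "0 < E" by (simp add: E_def)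
    have "(2 * C / \<delta> + 1) * E \<le> (exp (\<gamma> * t) - C) * E"
      using elim E by (intro mult_right_mono) auto
    also have "\<dots> = exp (- d 1 * t) - C * E"
      by (simp add: E_def \<gamma>_def left_diff_distrib algebra_simps flip: exp_add)
    also have "\<dots> \<le> \<pi> 1 t" using C(3) elim by (simp add: E_def)
    finally have p: "2 * C / \<delta> * E + E \<le> \<pi> 1 t" by (simp add: distrib_right)
    have p0: "0 < \<pi> 1 t"
      using p E C \<delta> by (smt (verit) divide_pos_pos mult_pos_pos)
    have CE: "C * E \<le> \<delta> / 2 * \<pi> 1 t"
    proof -
      have "2 * C / \<delta> * E \<le> \<pi> 1 t" using p E by simp
      then have "\<delta> / 2 * (2 * C / \<delta> * E) \<le> \<delta> / 2 * \<pi> 1 t" using \<delta> by (intro mult_left_mono) auto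
      then show ?thesis using \<delta> by simp
    qed
    have "\<pi> 1 t \<le> exp (real m + 2 - d 1 / 2 * t)"
      using \<pi>_le_S[of t 1] S_le_exp[of 1 t] elim by simp
    then have small: "\<pi> 1 t \<le> \<eta>" using elim by simp
    have "\<bar>ln (zonal m r v t) - \<pi> 1 t * ((real m + 1) * v - 1)\<bar> \<le> \<delta> * \<pi> 1 t" if v: "v \<in> {0..1}" for v
    proof -
      define u where "u = zonal m r v t - 1"
      have u1: "\<bar>u - \<pi> 1 t * ((real m + 1) * v - 1)\<bar> \<le> \<delta> / 2 * \<pi> 1 t"
        using C(2)[of v t] v elim CE by (simp add: u_def E_def)
      have "0 \<le> (real m + 1) * v" "(real m + 1) * v \<le> (real m + 1) * 1"
        using v by (intro mult_nonneg_nonneg mult_left_mono; simp)+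
      moreover have "\<bar>y - 1\<bar> \<le> real m + 1" if "0 \<le> y" "y \<le> (real m + 1) * 1" for y
        using that by (simp add: abs_le_iff)
      ultimately have "\<bar>(real m + 1) * v - 1\<bar> \<le> real m + 1" by blast
      then have "\<bar>\<pi> 1 t * ((real m + 1) * v - 1)\<bar> \<le> \<pi> 1 t * (real m + 1)"
        using p0 by (simp add: abs_mult)
      moreover have "\<delta> / 2 * \<pi> 1 t \<le> \<delta> * \<pi> 1 t" using \<delta> p0 by simp
      ultimately have u2: "\<bar>u\<bar> \<le> A * \<pi> 1 t"
      proof -
        define X where "X = \<pi> 1 t * ((real m + 1) * v - 1)"
        assume "\<bar>\<pi> 1 t * ((real m + 1) * v - 1)\<bar> \<le> \<pi> 1 t * (real m + 1)"
          and "\<delta> / 2 * \<pi> 1 t \<le> \<delta> * \<pi> 1 t"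
        then have "\<bar>u\<bar> \<le> \<delta> * \<pi> 1 t + \<pi> 1 t * (real m + 1)"
          using u1 abs_triangle_ineq[of "u - X" X] unfolding X_def[symmetric] by simp
        also have "\<dots> = A * \<pi> 1 t" by (simp add: A_def algebra_simps)
        finally show ?thesis .
      qed
      have "A * \<pi> 1 t \<le> A * (1 / (2 * A))"
        using small A by (intro mult_left_mono) (auto simp: \<eta>_def)
      then have "\<bar>u\<bar> \<le> 1 / 2" using u2 A by simp
      from abs_ln_one_plus_x_minus_x_bound[OF this] have u3: "\<bar>ln (1 + u) - u\<bar> \<le> 2 * u\<^sup>2" .
      have "u\<^sup>2 \<le> (A * \<pi> 1 t)\<^sup>2" using power_mono[OF u2, of 2] by simp
      also have "\<dots> = A\<^sup>2 * \<pi> 1 t * \<pi> 1 t" by (simp add: power2_eq_square)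
      also have "\<dots> \<le> A\<^sup>2 * (\<delta> / (4 * A\<^sup>2)) * \<pi> 1 t"
        using small p0 by (intro mult_right_mono mult_left_mono) (auto simp: \<eta>_def)
      also have "\<dots> = \<delta> / 4 * \<pi> 1 t" using A by simp
      finally have "2 * u\<^sup>2 \<le> \<delta> / 2 * \<pi> 1 t" by simp
      then have "\<bar>ln (1 + u) - \<pi> 1 t * ((real m + 1) * v - 1)\<bar> \<le> \<delta> / 2 * \<pi> 1 t + \<delta> / 2 * \<pi> 1 t"
        using u1 u3 abs_triangle_ineq[of "ln (1 + u) - u" "u - \<pi> 1 t * ((real m + 1) * v - 1)"] by simp
      then show ?thesis by (simp add: u_def)
    qed
    with p0 show ?case by blast
  qed
qed

text \<open>The sum is the expectation of a sequence tending to 0, evaluated at the chain, and at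
  small times the chain is above any fixed \<open>J\<close> with probability at least
  \<open>exp (- d J * t)\<close>. In \<open>zonal_concentration\<close> it becomes the kernel mean
  of \<open>1 - v\<close>.\<close>

lemma small_time_concentration:
  "((\<lambda>t. \<Sum>j. \<pi> j t * (real m / (2 * real j + 1 + real m))) \<longlongrightarrow> 0) (at_right 0)"
proof (rule tendstoI)
  fix e :: real assume e: "0 < e"
  define q where "q j = real m / (2 * real j + 1 + real m)" for j :: nat
  have q: "0 \<le> q j" "q j \<le> 1" for j by (auto simp: q_def)
  have "q \<longlonglongrightarrow> 0" unfolding q_def[abs_def] by real_asymp
  then have "\<forall>\<^sub>F j in sequentially. q j < e / 2" using e by (intro order_tendstoD(2)) auto
  then obtain J where J: "q J < e / 2" by (auto simp: eventually_sequentially)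
  have "((\<lambda>t. exp (- d J * t)) \<longlongrightarrow> exp (- d J * 0)) (at_right 0)"
    by (intro tendsto_intros)
  then have "\<forall>\<^sub>F t in at_right 0. 1 - e / 2 < exp (- d J * t)"
    using e by (intro order_tendstoD(1)) auto
  moreover have "\<forall>\<^sub>F t::real in at_right 0. 0 < t" by (simp add: eventually_at_filter)
  ultimately show "\<forall>\<^sub>F t in at_right 0. dist (\<Sum>j. \<pi> j t * (real m / (2 * real j + 1 + real m))) 0 < e"
  proof eventually_elim
    case (elim t)
    have \<pi>0: "0 \<le> \<pi> j t" for j using \<pi>_nonneg elim by simp
    have s: "summable (\<lambda>j. \<pi> j t * q j)"
      by (rule summable_comparison_test'[OF sums_summable[OF \<pi>_sums[OF elim(2)]]])
         (use q \<pi>0 in \<open>auto simp: mult_left_le abs_mult\<close>)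
    have "(\<Sum>j. \<pi> j t * q j) \<le> (\<Sum>j<J. \<pi> j t) + q J * 1"
    proof (rule sums_le[OF _ summable_sums[OF s]])
      show "(\<lambda>j. (if j \<in> {..<J} then \<pi> j t else 0) + q J * \<pi> j t) sums ((\<Sum>j<J. \<pi> j t) + q J * 1)"
        by (intro sums_add sums_If_finite_set sums_mult \<pi>_sums elim) simp
    next
      fix j
      have "\<pi> j t * q j \<le> \<pi> j t * q J" if "J \<le> j"
        using that \<pi>0 m by (intro mult_left_mono) (auto simp: q_def intro!: divide_left_mono)
      moreover have "\<pi> j t * q j \<le> \<pi> j t" using \<pi>0 q by (simp add: mult_left_le)
      moreover have "0 \<le> q J * \<pi> j t" using \<pi>0 q by simp
      ultimately show "\<pi> j t * q j \<le> (if j \<in> {..<J} then \<pi> j t else 0) + q J * \<pi> j t"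
        by (auto simp: mult.commute not_less)
    qed
    also have "(\<Sum>j<J. \<pi> j t) = S 0 t - S J t"
      unfolding death_prob_def by (rule sum_lessThan_telescope')
    also have "\<dots> \<le> 1 - exp (- d J * t)" using S_0 S_bounds(1) elim by simp
    finally have "(\<Sum>j. \<pi> j t * q j) < e" using elim J by simp
    moreover have "0 \<le> (\<Sum>j. \<pi> j t * q j)" using \<pi>0 q by (intro suminf_nonneg s) auto
    ultimately show ?case by (simp add: q_def)
  qed
qed

end

section \<open>Surface measure of the sphere\<close>

lemma continuous_on_compact_bounded:
  fixes f :: "'b::topological_space \<Rightarrow> real"
  assumes "compact S" "continuous_on S f"
  obtains B where "0 \<le> B" "\<And>z. z \<in> S \<Longrightarrow> \<bar>f z\<bar> \<le> B"
proof -
  have "bounded (f ` S)"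
    by (intro compact_imp_bounded compact_continuous_image assms)
  then obtain B where "\<forall>z\<in>S. norm (f z) \<le> B"
    unfolding bounded_iff by blast
  then show ?thesis by (intro that[of "max B 0"]) (auto simp: max_def)
qed

text \<open>The mean value theorem bounds all difference quotients by \<open>B\<close>, and
  constants are integrable for a finite measure, so dominated convergence applies along every
  sequence tending to \<open>a\<close>.\<close>

lemma has_derivative_parametric_integral:
  fixes f f' :: "real \<Rightarrow> 'b \<Rightarrow> real"
  assumes N: "finite_measure N" and \<delta>: "0 < \<delta>"
    and int: "\<And>x. \<bar>x - a\<bar> < \<delta> \<Longrightarrow> integrable N (f x)"
    and der: "\<And>x z. \<bar>x - a\<bar> < \<delta> \<Longrightarrow> z \<in> space N \<Longrightarrow> ((\<lambda>x. f x z) has_real_derivative f' x z) (at x)"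
    and bound: "\<And>x z. \<bar>x - a\<bar> < \<delta> \<Longrightarrow> z \<in> space N \<Longrightarrow> \<bar>f' x z\<bar> \<le> B"
  shows "((\<lambda>x. \<integral>z. f x z \<partial>N) has_real_derivative (\<integral>z. f' a z \<partial>N)) (at a)"
proof -
  interpret finite_measure N by fact
  let ?U = "ball a \<delta>"
  have U: "x \<in> ?U \<longleftrightarrow> \<bar>x - a\<bar> < \<delta>" for x by (auto simp: dist_real_def)
  have a: "\<bar>a - a\<bar> < \<delta>" using \<delta> by simp
  have at: "at a within ?U = at a" using \<delta> by (intro at_within_open) auto
  define q where "q x z = (f x z - f a z) / (x - a)" for x z
  have lim: "(\<lambda>i. q (X i) z) \<longlonglongrightarrow> f' a z"
    if "\<forall>i. X i \<in> ?U - {a}" "X \<longlonglongrightarrow> a" "z \<in> space N" for X z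
  proof -
    have "((\<lambda>x. q x z) \<longlongrightarrow> f' a z) (at a within ?U)"
      using der[OF a that(3)] unfolding at q_def has_field_derivative_iff .
    then show ?thesis
      using that unfolding tendsto_at_iff_sequentially by (auto simp: o_def)
  qed
  have q_bound: "norm (q x z) \<le> B" if x: "x \<in> ?U - {a}" and z: "z \<in> space N" for x z
  proof -
    have "norm (f x z - f a z) \<le> B * norm (x - a)"
    proof (rule field_differentiable_bound[of ?U])
      show "((\<lambda>x. f x z) has_field_derivative f' u z) (at u within ?U)" if "u \<in> ?U" for u
        using der z that U by (blast intro: has_field_derivative_at_within)
    qed (use x z \<delta> bound U in auto)
    then show ?thesis using x by (simp add: q_def abs_divide divide_le_eq)
  qed
  have q_int: "integrable N (q x)" if "x \<in> ?U - {a}" for x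
    unfolding q_def[abs_def] using that U int a by auto
  \<comment> \<open>One particular sequence tending to \<open>a\<close>; its difference quotients
    exhibit \<open>f' a\<close> as a pointwise limit of measurable functions.\<close>
  define X0 where "X0 i = a + \<delta> / (real i + 2)" for i :: nat
  have X0: "\<forall>i. X0 i \<in> ?U - {a}" using \<delta> by (auto simp: X0_def dist_real_def divide_less_eq field_simps intro: add_pos_nonneg)
  have X0_lim: "X0 \<longlonglongrightarrow> a" unfolding X0_def[abs_def] by real_asymp
  have meas: "f' a \<in> borel_measurable N"
    by (rule borel_measurable_LIMSEQ_real[where u = "\<lambda>i. q (X0 i)"])
       (use lim[OF X0 X0_lim] q_int X0 in auto)
  have "((\<lambda>x. \<integral>z. q x z \<partial>N) \<longlongrightarrow> (\<integral>z. f' a z \<partial>N)) (at a within ?U)"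
    unfolding tendsto_at_iff_sequentially
  proof (intro allI impI)
    fix X assume X: "\<forall>i. X i \<in> ?U - {a}" "X \<longlonglongrightarrow> a"
    show "((\<lambda>x. \<integral>z. q x z \<partial>N) \<circ> X) \<longlonglongrightarrow> (\<integral>z. f' a z \<partial>N)"
      unfolding o_def
      by (rule integral_dominated_convergence[where w = "\<lambda>_. B"])
         (use meas q_int X lim q_bound in \<open>auto intro!: AE_I2\<close>)
  qed
  moreover have "(\<integral>z. q x z \<partial>N) = ((\<integral>z. f x z \<partial>N) - (\<integral>z. f a z \<partial>N)) / (x - a)" if "x \<in> ?U" for x
    unfolding q_def using that U int a by simp
  then have "\<forall>\<^sub>F x in at a within ?U. (\<integral>z. q x z \<partial>N) = ((\<integral>z. f x z \<partial>N) - (\<integral>z. f a z \<partial>N)) / (x - a)"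
    by (auto simp: eventually_at_filter)
  ultimately have "((\<lambda>x. ((\<integral>z. f x z \<partial>N) - (\<integral>z. f a z \<partial>N)) / (x - a)) \<longlongrightarrow> (\<integral>z. f' a z \<partial>N)) (at a within ?U)"
    by (rule Lim_transform_eventually)
  then show "((\<lambda>x. \<integral>z. f x z \<partial>N) has_real_derivative (\<integral>z. f' a z \<partial>N)) (at a)"
    unfolding at has_field_derivative_iff .
qed

lemma emeasure_ball_ne:
  fixes c :: "'b::euclidean_space"
  assumes "0 < r" shows "emeasure lborel (ball c r) \<noteq> 0" "emeasure lborel (ball c r) \<noteq> \<infinity>"
proof -
  show "emeasure lborel (ball c r) \<noteq> 0"
    using content_ball_pos[OF assms, of c] by (metis less_irrefl measure_def enn2real_0)
  show "emeasure lborel (ball c r) \<noteq> \<infinity>"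
    using emeasure_bounded_finite[of "ball c r"] by auto
qed

text \<open>Uniqueness of Haar measure: by Tonelli and translation invariance both
  \<open>\<lambda>(B) \<lambda>(T\<^sup>-\<^sup>1 A)\<close> and \<open>\<lambda>(A) \<lambda>(B)\<close> are the double integral of
  \<open>1\<^sub>B(y) 1\<^sub>A(T x + y)\<close>, where \<open>B\<close> is the unit ball.\<close>
lemma lborel_distr_orthogonal:
  fixes T :: "'b::euclidean_space \<Rightarrow> 'b"
  assumes T: "orthogonal_transformation T"
  shows "distr lborel borel T = lborel"
proof (rule measure_eqI)
  have lin: "linear T" using T by (rule orthogonal_transformation_linear)
  have meas[measurable]: "T \<in> borel_measurable borel"
    using lin by (simp add: borel_measurable_continuous_onI linear_continuous_on linear_conv_bounded_linear)
  have trans: "(\<integral>\<^sup>+x. f (x + c) \<partial>lborel) = (\<integral>\<^sup>+x. f x \<partial>lborel)"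
    if [measurable]: "f \<in> borel_measurable borel" for f and c :: 'b
  proof -
    have "(\<integral>\<^sup>+x. f x \<partial>lborel) = (\<integral>\<^sup>+x. f x \<partial>distr lborel borel ((+) c))"
      by (simp add: lborel_distr_plus)
    also have "\<dots> = (\<integral>\<^sup>+x. f (c + x) \<partial>lborel)" by (simp add: nn_integral_distr)
    finally show ?thesis by (simp add: add.commute)
  qed
  fix A assume "A \<in> sets (distr lborel borel T)"
  then have A[measurable]: "A \<in> sets borel" by simp
  have B[measurable]: "ball 0 1 \<in> sets (borel :: 'b measure)" by simp
  have [measurable]: "(\<lambda>x. T (snd x) + fst x) \<in> borel_measurable (lborel \<Otimes>\<^sub>M lborel)"
    "(\<lambda>x. T (fst x) + snd x) \<in> borel_measurable (lborel \<Otimes>\<^sub>M lborel)"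
    by measurable
  let ?b = "\<lambda>y::'b. indicator (ball 0 1) y :: ennreal" and ?a = "\<lambda>y. indicator A y :: ennreal"
  have "(\<integral>\<^sup>+y. ?b y * (\<integral>\<^sup>+x. ?a (T x) \<partial>lborel) \<partial>lborel) = (\<integral>\<^sup>+y. (\<integral>\<^sup>+x. ?b y * ?a (T x + y) \<partial>lborel) \<partial>lborel)"
  proof (rule nn_integral_cong)
    fix y
    obtain u where u: "y = T u" using orthogonal_transformation_surj[OF T] by (metis surjD)
    have "(\<integral>\<^sup>+x. ?a (T x) \<partial>lborel) = (\<integral>\<^sup>+x. ?a (T (x + u)) \<partial>lborel)"
      by (rule trans[symmetric]) measurable
    then show "?b y * (\<integral>\<^sup>+x. ?a (T x) \<partial>lborel) = (\<integral>\<^sup>+x. ?b y * ?a (T x + y) \<partial>lborel)"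
      using u by (simp add: linear_add[OF lin] nn_integral_cmult)
  qed
  also have "\<dots> = (\<integral>\<^sup>+x. (\<integral>\<^sup>+y. ?b y * ?a (T x + y) \<partial>lborel) \<partial>lborel)"
    by (rule lborel_pair.Fubini'[symmetric]) measurable
  also have "\<dots> = (\<integral>\<^sup>+x. (\<integral>\<^sup>+y. ?b (y - T x) * ?a y \<partial>lborel) \<partial>lborel)"
  proof (rule nn_integral_cong)
    fix x
    have "(\<integral>\<^sup>+y. ?b (y - T x) * ?a y \<partial>lborel) = (\<integral>\<^sup>+y. ?b ((y + T x) - T x) * ?a (y + T x) \<partial>lborel)"
      by (rule trans[symmetric]) measurable
    then show "(\<integral>\<^sup>+y. ?b y * ?a (T x + y) \<partial>lborel) = (\<integral>\<^sup>+y. ?b (y - T x) * ?a y \<partial>lborel)"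
      by (simp add: add.commute)
  qed
  also have "\<dots> = (\<integral>\<^sup>+y. (\<integral>\<^sup>+x. ?b (y - T x) * ?a y \<partial>lborel) \<partial>lborel)"
    by (rule lborel_pair.Fubini') measurable
  also have "\<dots> = (\<integral>\<^sup>+y. ?a y * emeasure lborel (ball 0 1 :: 'b set) \<partial>lborel)"
  proof (rule nn_integral_cong)
    fix y
    obtain u where u: "y = T u" using orthogonal_transformation_surj[OF T] by (metis surjD)
    \<comment> \<open>The unit ball is invariant under \<open>T\<close>, so it can serve as the test
      set whose measure cancels at the end.\<close>
    have "?b (y - T x) = ?b (x - u)" for x
    proof -
      have "norm (y - T x) = norm (x - u)"
        unfolding u linear_diff[OF lin, symmetric] orthogonal_transformation_norm[OF T] by (rule norm_minus_commute)
      then show ?thesis by (simp add: indicator_def)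
    qed
    then have "(\<integral>\<^sup>+x. ?b (y - T x) * ?a y \<partial>lborel) = (\<integral>\<^sup>+x. ?b (x - u) \<partial>lborel) * ?a y"
      by (simp add: nn_integral_multc)
    also have "(\<integral>\<^sup>+x. ?b (x - u) \<partial>lborel) = (\<integral>\<^sup>+x. ?b ((x + u) - u) \<partial>lborel)"
      by (rule trans[symmetric]) measurable
    finally show "(\<integral>\<^sup>+x. ?b (y - T x) * ?a y \<partial>lborel) = ?a y * emeasure lborel (ball 0 1 :: 'b set)"
      by (simp add: mult.commute)
  qed
  also have "\<dots> = emeasure lborel A * emeasure lborel (ball 0 1 :: 'b set)"
    by (simp add: nn_integral_multc)
  finally have "emeasure lborel (ball 0 1 :: 'b set) * (\<integral>\<^sup>+x. ?a (T x) \<partial>lborel) =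
      emeasure lborel (ball 0 1 :: 'b set) * emeasure lborel A"
    by (simp add: nn_integral_multc mult.commute)
  with emeasure_ball_ne[OF zero_less_one, of "0::'b"] have "(\<integral>\<^sup>+x. ?a (T x) \<partial>lborel) = emeasure lborel A"
    by (simp add: ennreal_mult_cancel_left)
  moreover have "(\<integral>\<^sup>+x. ?a (T x) \<partial>lborel) = emeasure (distr lborel borel T) A"
    by (simp add: nn_integral_distr flip: nn_integral_indicator)
  ultimately show "emeasure (distr lborel borel T) A = emeasure lborel A" by simp
qed simp

text \<open>The origin, a null set, is sent to some point of the sphere so that the map takes all
  its values there.\<close>

definition sph_proj :: "real \<Rightarrow> real^'n \<Rightarrow> real^'n" where
  "sph_proj r y = (if y = 0 then r *\<^sub>R axis undefined 1 else (r / norm y) *\<^sub>R y)"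

text \<open>Normalized surface measure as the image of the uniform ball under radial projection;
  this matches the cone formula behind \<open>rp_int\<close>.\<close>

definition sph_measure :: "real \<Rightarrow> (real^'n) measure" where
  "sph_measure r = distr (uniform_measure lborel (ball 0 r)) (restrict_space borel (sphere 0 r)) (sph_proj r)"

lemma sph_proj_in: "0 < r \<Longrightarrow> sph_proj r y \<in> sphere 0 r"
  by (simp add: sph_proj_def norm_axis_1)

lemma sph_proj_measurable[measurable]: "sph_proj r \<in> borel_measurable borel"
  unfolding sph_proj_def[abs_def] by measurable

lemma sph_proj_measurable_sphere:
  "0 < r \<Longrightarrow> sph_proj r \<in> borel \<rightarrow>\<^sub>M restrict_space borel (sphere 0 r)"
  using sph_proj_in by (intro measurable_restrict_space2) auto

lemma space_sph_measure[simp]: "space (sph_measure r) = sphere 0 r"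
  by (simp add: sph_measure_def space_restrict_space)

lemma sets_sph_measure[measurable_cong]: "sets (sph_measure r) = sets (restrict_space borel (sphere 0 r))"
  by (simp add: sph_measure_def)

lemma sph_measurable_continuous:
  "continuous_on (sphere 0 r) f \<Longrightarrow> f \<in> borel_measurable (sph_measure r)"
  using borel_measurable_continuous_on_restrict[of "sphere 0 r" f]
  by (simp add: measurable_cong_sets[OF sets_sph_measure refl])

lemma prob_space_sph_measure:
  assumes "0 < r" shows "prob_space (sph_measure r)"
  unfolding sph_measure_def
proof (rule prob_space.prob_space_distr)
  show "prob_space (uniform_measure lborel (ball (0::real^'a) r))"
    by (rule prob_space_uniform_measure[OF emeasure_ball_ne[OF assms]])
  show "sph_proj r \<in> uniform_measure lborel (ball 0 r) \<rightarrow>\<^sub>M restrict_space borel (sphere 0 r)"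
    using sph_proj_measurable_sphere[OF assms] by (simp cong: measurable_cong_sets)
qed

lemma sph_integral:
  fixes f :: "real^'n \<Rightarrow> real"
  assumes r: "0 < r" and f: "f \<in> borel_measurable (sph_measure r)"
  shows "(\<integral>z. f z \<partial>sph_measure r) =
    (\<integral>y. indicator (ball 0 r) y * f (sph_proj r y) \<partial>lborel) / measure lborel (ball (0::real^'n) r)"
proof -
  let ?c = "measure lborel (ball (0::real^'n) r)"
  have c: "0 < ?c" using r by (rule content_ball_pos)
  have f': "f \<in> borel_measurable (restrict_space borel (sphere 0 r))"
    using f by (simp add: measurable_cong_sets[OF sets_sph_measure refl])
  have fp: "(\<lambda>y. f (sph_proj r y)) \<in> borel_measurable borel"
    using measurable_compose[OF sph_proj_measurable_sphere[OF r] f'] .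
  have U: "uniform_measure lborel (ball (0::real^'n) r) = density lborel (\<lambda>y. ennreal (indicator (ball 0 r) y / ?c))"
    unfolding uniform_measure_def
    using c emeasure_ball_ne[OF r, of "0::real^'n"]
    by (intro density_cong) (auto simp: emeasure_eq_ennreal_measure divide_ennreal indicator_def ennreal_1[symmetric] simp del: ennreal_1)
  have "(\<integral>z. f z \<partial>sph_measure r) = (\<integral>y. f (sph_proj r y) \<partial>uniform_measure lborel (ball 0 r))"
    unfolding sph_measure_def
    by (rule integral_distr[OF _ f']) (use sph_proj_measurable_sphere[OF r] in \<open>simp cong: measurable_cong_sets\<close>)
  also have "\<dots> = (\<integral>y. (indicator (ball 0 r) y / ?c) *\<^sub>R f (sph_proj r y) \<partial>lborel)"
    unfolding U using c fp by (intro integral_density borel_measurable_divide borel_measurable_indicator) auto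
  also have "\<dots> = (\<integral>y. (indicator (ball 0 r) y * f (sph_proj r y)) / ?c \<partial>lborel)"
    by (rule Bochner_Integration.integral_cong) auto
  finally show ?thesis by simp
qed

text \<open>An orthogonal map preserves the ball and, away from the origin, commutes with radial
  projection, so invariance descends from Lebesgue measure.\<close>

lemma sph_integral_orthogonal:
  fixes f :: "real^'n \<Rightarrow> real" and T :: "real^'n \<Rightarrow> real^'n"
  assumes r: "0 < r" and f: "continuous_on (sphere 0 r) f" and T: "orthogonal_transformation T"
  shows "(\<integral>z. f (T z) \<partial>sph_measure r) = (\<integral>z. f z \<partial>sph_measure r)"
proof -
  have lin: "linear T" using T by (rule orthogonal_transformation_linear)
  have Tc: "continuous_on A T" for A
    using lin by (simp add: linear_continuous_on linear_conv_bounded_linear)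
  have meas[measurable]: "T \<in> borel_measurable borel"
    by (intro borel_measurable_continuous_onI Tc)
  have fT: "continuous_on (sphere 0 r) (\<lambda>z. f (T z))"
    by (rule continuous_on_compose2[OF f Tc]) (auto simp: orthogonal_transformation_norm[OF T])
  have f': "f \<in> borel_measurable (restrict_space borel (sphere 0 r))"
    using borel_measurable_continuous_on_restrict[OF f] .
  have fp: "(\<lambda>y. f (sph_proj r y)) \<in> borel_measurable borel"
    using measurable_compose[OF sph_proj_measurable_sphere[OF r] f'] .
  have fTp: "(\<lambda>y. f (T (sph_proj r y))) \<in> borel_measurable borel"
    using measurable_compose[OF sph_proj_measurable_sphere[OF r] borel_measurable_continuous_on_restrict[OF fT]] .
  have norm_T: "norm (T y) = norm y" for y by (rule orthogonal_transformation_norm[OF T])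
  have "(\<integral>y. indicator (ball 0 r) y * f (sph_proj r y) \<partial>lborel) =
      (\<integral>y. indicator (ball 0 r) y * f (sph_proj r y) \<partial>distr lborel borel T)"
    by (simp add: lborel_distr_orthogonal[OF T])
  also have "\<dots> = (\<integral>y. indicator (ball 0 r) (T y) * f (sph_proj r (T y)) \<partial>lborel)"
    by (rule integral_distr) (use fp in \<open>auto intro!: borel_measurable_times borel_measurable_indicator\<close>)
  also have "\<dots> = (\<integral>y. indicator (ball 0 r) y * f (T (sph_proj r y)) \<partial>lborel)"
  proof (rule integral_cong_AE)
    show "(\<lambda>y. indicator (ball 0 r) (T y) * f (sph_proj r (T y))) \<in> borel_measurable lborel"
      using borel_measurable_times[OF borel_measurable_indicator[of "ball 0 r"] fp]
      by (auto intro: measurable_compose[OF meas])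
    show "AE y in lborel. indicator (ball 0 r) (T y) * f (sph_proj r (T y)) =
        indicator (ball 0 r) y * f (T (sph_proj r y))"
      using AE_lborel_singleton[of "0::real^'n"]
    proof eventually_elim
      case (elim y)
      then have "T y \<noteq> 0" using norm_T[of y] by auto
      then show ?case
        using elim by (simp add: sph_proj_def norm_T linear_cmul[OF lin] indicator_def)
    qed
    show "(\<lambda>y. indicator (ball 0 r) y * f (T (sph_proj r y))) \<in> borel_measurable lborel"
      using fTp by (auto intro!: borel_measurable_times borel_measurable_indicator)
  qed
  finally show ?thesis
    unfolding sph_integral[OF r sph_measurable_continuous[OF f]]
      sph_integral[OF r sph_measurable_continuous[OF fT]] by simp
qed

lemma sphere_integrable:
  fixes f :: "real^'n \<Rightarrow> real"
  assumes N: "finite_measure N" "sets N = sets (restrict_space borel (sphere 0 r))"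
    and f: "continuous_on (sphere 0 r) f"
  shows "integrable N f"
proof -
  interpret finite_measure N by fact
  have sp: "space N = sphere 0 r"
    using sets_eq_imp_space_eq[OF N(2)] by (simp add: space_restrict_space)
  obtain B where "\<And>z. z \<in> sphere 0 r \<Longrightarrow> \<bar>f z\<bar> \<le> B"
    using continuous_on_compact_bounded[OF compact_sphere f] by blast
  then show ?thesis
    using borel_measurable_continuous_on_restrict[OF f]
    by (intro integrable_const_bound[where B = B] AE_I2) (auto simp: sp measurable_cong_sets[OF N(2) refl])
qed

lemma sph_integrable:
  fixes f :: "real^'n \<Rightarrow> real"
  assumes "0 < r" "continuous_on (sphere 0 r) f"
  shows "integrable (sph_measure r) f"
  by (rule sphere_integrable[OF prob_space.finite_measure[OF prob_space_sph_measure[OF assms(1)]] sets_sph_measure assms(2)])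

lemma rp_integral:
  fixes f :: "real^'n \<Rightarrow> real"
  assumes r: "0 < r" and f: "f \<in> borel_measurable (sph_measure r)"
    and B: "\<And>z. z \<in> sphere 0 r \<Longrightarrow> \<bar>f z\<bar> \<le> B"
  shows "rp_integrable m r f"
    and "rp_int m r f = (1/2) * ((real m + 1) / r) * measure lborel (ball (0::real^'n) r) * (\<integral>z. f z \<partial>sph_measure r)"
proof -
  let ?g = "\<lambda>y. indicator (ball 0 r) y *\<^sub>R f ((r / norm y) *\<^sub>R y)"
  have f': "f \<in> borel_measurable (restrict_space borel (sphere 0 r))"
    using f by (simp add: measurable_cong_sets[OF sets_sph_measure refl])
  have fp: "(\<lambda>y. f (sph_proj r y)) \<in> borel_measurable borel"
    using measurable_compose[OF sph_proj_measurable_sphere[OF r] f'] .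
  \<comment> \<open>At the origin the integrand of \<open>rp_int\<close> is \<open>f 0\<close>,
    since division by zero gives 0. This is a value off the sphere, hence the case split and the
    bound \<open>max B \<bar>f 0\<bar>\<close> below.\<close>
  have g_eq: "?g y = (if y \<in> {0} then indicator (ball 0 r) y * f 0 else indicator (ball 0 r) y * f (sph_proj r y))" for y
    by (simp add: sph_proj_def)
  have g: "?g \<in> borel_measurable lborel"
    unfolding g_eq
    by (rule measurable_If_set) (use fp in \<open>auto intro!: borel_measurable_times borel_measurable_indicator\<close>)
  have fpm: "(\<lambda>y. indicator (ball 0 r) y * f (sph_proj r y)) \<in> borel_measurable lborel"
    using fp by (auto intro!: borel_measurable_times borel_measurable_indicator)
  have "integrable lborel (\<lambda>y::real^'n. indicator (ball 0 r) y *\<^sub>R max B \<bar>f 0\<bar>)"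
    using emeasure_bounded_finite[of "ball (0::real^'n) r"]
    by (intro integrable_scaleR_left integrable_real_indicator) auto
  then show "rp_integrable m r f"
    unfolding rp_integrable_def set_integrable_def
  proof (rule Bochner_Integration.integrable_bound[OF _ g], intro AE_I2)
    fix y :: "real^'n"
    have "\<bar>f ((r / norm y) *\<^sub>R y)\<bar> \<le> max B \<bar>f 0\<bar>"
      using B[OF sph_proj_in[OF r, of y]] by (cases "y = 0") (auto simp: sph_proj_def)
    then show "norm (?g y) \<le> norm (indicator (ball 0 r) y *\<^sub>R max B \<bar>f 0\<bar>)"
      by (auto simp: indicator_def)
  qed
  have "(LINT y:ball 0 r|lborel. f ((r / norm y) *\<^sub>R y)) = (\<integral>y. indicator (ball 0 r) y * f (sph_proj r y) \<partial>lborel)"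
    unfolding set_lebesgue_integral_def
    by (rule integral_cong_AE[OF g fpm])
       (use AE_lborel_singleton[of "0::real^'n"] in eventually_elim, simp add: sph_proj_def)
  also have "\<dots> = measure lborel (ball (0::real^'n) r) * (\<integral>z. f z \<partial>sph_measure r)"
    using content_ball_pos[OF r, of "0::real^'n"] by (simp add: sph_integral[OF r f])
  finally show "rp_int m r f = (1/2) * ((real m + 1) / r) * measure lborel (ball (0::real^'n) r) * (\<integral>z. f z \<partial>sph_measure r)"
    by (simp add: rp_int_def)
qed

section \<open>Moments of linear functionals on the sphere\<close>

lemma sph_moment_norm:
  fixes x x' :: "real^'n"
  assumes r: "0 < r" and eq: "norm x = norm x'"
  shows "(\<integral>z. (x \<bullet> z) ^ k \<partial>sph_measure r) = (\<integral>z. (x' \<bullet> z) ^ k \<partial>sph_measure r)"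
proof -
  obtain T where T: "orthogonal_transformation T" "T x = x'"
    using orthogonal_transformation_exists[OF eq] .
  have "(\<integral>z. (x' \<bullet> T z) ^ k \<partial>sph_measure r) = (\<integral>z. (x' \<bullet> z) ^ k \<partial>sph_measure r)"
    using r T(1) by (intro sph_integral_orthogonal continuous_intros)
  moreover have "x' \<bullet> T z = x \<bullet> z" for z
    using T by (auto simp: orthogonal_transformation_def)
  ultimately show ?thesis by simp
qed

lemma sph_moment_scale:
  fixes x :: "real^'n"
  assumes r: "0 < r"
  shows "(\<integral>z. (x \<bullet> z) ^ k \<partial>sph_measure r) = norm x ^ k * (\<integral>z. (z $ i) ^ k \<partial>(sph_measure r :: (real^'n) measure))"
proof -
  have "(\<integral>z. (x \<bullet> z) ^ k \<partial>sph_measure r) = (\<integral>z. ((norm x *\<^sub>R axis i 1) \<bullet> z) ^ k \<partial>sph_measure r)"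
    by (rule sph_moment_norm[OF r]) simp
  also have "\<dots> = (\<integral>z. norm x ^ k * (z $ i) ^ k \<partial>sph_measure r)"
    by (simp add: inner_axis' power_mult_distrib)
  finally show ?thesis by simp
qed

text \<open>The free exponent \<open>j\<close> lets the formula be used twice: \<open>j = 0\<close>
  gives the first derivative of a directional moment, \<open>j = 1\<close> the second.\<close>

lemma sph_directional_derivative:
  fixes i l :: "'n::finite"
  assumes r: "0 < r"
  shows "((\<lambda>a. \<integral>z. (z $ i + a * z $ l) ^ k * z $ l ^ j \<partial>(sph_measure r :: (real^'n) measure)) has_real_derivative
    (\<integral>z. real k * (z $ i + a * z $ l) ^ (k - 1) * z $ l ^ Suc j \<partial>(sph_measure r :: (real^'n) measure))) (at a)"
proof (rule has_derivative_parametric_integral)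
  show "finite_measure (sph_measure r :: (real^'n) measure)"
    using prob_space_sph_measure[OF r] by (rule prob_space.finite_measure)
  show "integrable (sph_measure r) (\<lambda>z::real^'n. (z $ i + x * z $ l) ^ k * z $ l ^ j)" for x
    by (intro sph_integrable r continuous_intros)
  show "((\<lambda>x. (z $ i + x * z $ l) ^ k * z $ l ^ j) has_real_derivative
      real k * (z $ i + x * z $ l) ^ (k - 1) * z $ l ^ Suc j) (at x)" for x and z :: "real^'n"
    by (auto intro!: derivative_eq_intros simp: mult_ac)
  show "0 < (1::real)" by simp
  fix x and z :: "real^'n" assume x: "\<bar>x - a\<bar> < 1" and z: "z \<in> space (sph_measure r)"
  have zi: "\<bar>z $ i\<bar> \<le> r" for i using component_le_norm_cart[of z i] z by simp
  have "\<bar>x * z $ l\<bar> \<le> (\<bar>a\<bar> + 1) * r"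
    unfolding abs_mult using x zi r by (intro mult_mono) auto
  then have "\<bar>z $ i + x * z $ l\<bar> \<le> r + (\<bar>a\<bar> + 1) * r"
    using zi[of i] by linarith
  then have "\<bar>(z $ i + x * z $ l) ^ (k - 1)\<bar> \<le> (r + (\<bar>a\<bar> + 1) * r) ^ (k - 1)"
    unfolding power_abs by (intro power_mono) auto
  moreover have "\<bar>z $ l ^ Suc j\<bar> \<le> r ^ Suc j"
    unfolding power_abs using zi by (intro power_mono) auto
  ultimately show "\<bar>real k * (z $ i + x * z $ l) ^ (k - 1) * z $ l ^ Suc j\<bar> \<le>
      real k * (r + (\<bar>a\<bar> + 1) * r) ^ (k - 1) * r ^ Suc j"
    unfolding abs_mult abs_of_nat using r by (intro mult_mono mult_nonneg_nonneg zero_le_power add_nonneg_nonneg) auto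
qed

text \<open>By rotation invariance the moment in direction \<open>e\<^sub>i + a e\<^sub>l\<close> is \<open>(1 + a\<^sup>2)\<^sup>n\<close> times the moment in
  direction \<open>e\<^sub>i\<close>; compare second derivatives at \<open>a = 0\<close>.\<close>
lemma sph_mixed_moment:
  fixes i l :: "'n::finite"
  assumes r: "0 < r" and il: "i \<noteq> l" and n: "0 < n"
  shows "(2 * real n - 1) * (\<integral>z. z $ i ^ (2 * n - 2) * (z $ l)\<^sup>2 \<partial>(sph_measure r :: (real^'n) measure)) =
    (\<integral>z. z $ i ^ (2 * n) \<partial>(sph_measure r :: (real^'n) measure))"
proof -
  let ?N = "sph_measure r :: (real^'n) measure"
  define C where "C = (\<integral>z. z $ i ^ (2 * n) \<partial>?N)"
  \<comment> \<open>The factor \<open>z $ l ^ 0\<close> brings the integrand into the form of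
    \<open>sph_directional_derivative\<close>.\<close>
  have G: "(\<integral>z. (z $ i + a * z $ l) ^ (2 * n) * z $ l ^ 0 \<partial>?N) = (1 + a\<^sup>2) ^ n * C" for a
  proof -
    let ?x = "axis i 1 + a *\<^sub>R axis l 1 :: real^'n"
    have "(norm ?x)\<^sup>2 = 1 + a\<^sup>2"
      unfolding power2_norm_eq_inner using il
      by (simp add: inner_add_left inner_add_right inner_axis_axis power2_eq_square)
    then have "norm ?x ^ (2 * n) = (1 + a\<^sup>2) ^ n" by (simp add: power_mult)
    with sph_moment_scale[OF r, of ?x "2 * n" i] show ?thesis
      by (simp add: C_def inner_add_left inner_axis')
  qed
  have G1: "(\<integral>z. (z $ i + a * z $ l) ^ (2 * n - 1) * z $ l ^ Suc 0 \<partial>?N) = a * (1 + a\<^sup>2) ^ (n - 1) * C" for a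
  proof -
    have "((\<lambda>a. (1 + a\<^sup>2) ^ n * C) has_real_derivative real n * (1 + a\<^sup>2) ^ (n - 1) * (2 * a) * C) (at a)"
      by (auto intro!: derivative_eq_intros)
    moreover have "((\<lambda>a. (1 + a\<^sup>2) ^ n * C) has_real_derivative
        (\<integral>z. real (2 * n) * (z $ i + a * z $ l) ^ (2 * n - 1) * z $ l ^ Suc 0 \<partial>?N)) (at a)"
      using sph_directional_derivative[OF r, where i = i and l = l and k = "2 * n" and j = 0] unfolding G .
    ultimately have "(\<integral>z. real (2 * n) * (z $ i + a * z $ l) ^ (2 * n - 1) * z $ l ^ Suc 0 \<partial>?N) =
        real n * (1 + a\<^sup>2) ^ (n - 1) * (2 * a) * C" by (rule DERIV_unique[rotated])
    then have "real (2 * n) * (\<integral>z. (z $ i + a * z $ l) ^ (2 * n - 1) * z $ l ^ Suc 0 \<partial>?N) =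
        real (2 * n) * (a * (1 + a\<^sup>2) ^ (n - 1) * C)"
      by (simp only: mult.assoc Bochner_Integration.integral_mult_right_zero) (simp add: mult_ac)
    then show ?thesis using n by (simp only: mult_cancel_left) simp
  qed
  have "((\<lambda>a. a * (1 + a\<^sup>2) ^ (n - 1) * C) has_real_derivative C) (at 0)"
    by (auto intro!: derivative_eq_intros)
  moreover have "((\<lambda>a. a * (1 + a\<^sup>2) ^ (n - 1) * C) has_real_derivative
      (\<integral>z. real (2 * n - 1) * (z $ i + 0 * z $ l) ^ (2 * n - 1 - 1) * z $ l ^ Suc (Suc 0) \<partial>?N)) (at 0)"
    using sph_directional_derivative[OF r, where i = i and l = l and k = "2 * n - 1" and j = "Suc 0"] unfolding G1 .
  ultimately have "C = (\<integral>z. real (2 * n - 1) * (z $ i + 0 * z $ l) ^ (2 * n - 1 - 1) * z $ l ^ Suc (Suc 0) \<partial>?N)"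
    by (rule DERIV_unique)
  moreover have "real (2 * n - 1) = 2 * real n - 1" "2 * n - 1 - 1 = 2 * n - 2" using n by auto
  ultimately have "C = (\<integral>z. (2 * real n - 1) * (z $ i ^ (2 * n - 2) * (z $ l)\<^sup>2) \<partial>?N)"
    by (simp add: mult.assoc numeral_2_eq_2)
  then show ?thesis by (simp add: C_def)
qed

text \<open>Summing the mixed moments over the \<open>m\<close> other axes and using that the
  squared coordinates add up to r^2 gives m C_{n+1} = (2n + 1)(r^2 C_n - C_{n+1}), the recursion of
  \<open>sphere_weight\<close>.\<close>

lemma sph_axis_moment:
  fixes i :: "'n::finite"
  assumes r: "0 < r" and card: "CARD('n) = m + 1"
  shows "(\<integral>z. z $ i ^ (2 * n) \<partial>(sph_measure r :: (real^'n) measure)) = r ^ (2 * n) / sphere_weight m n"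
proof (induction n)
  case 0
  then show ?case
    using prob_space.prob_space[OF prob_space_sph_measure[OF r, where 'a = 'n]] by (simp add: sphere_weight_def)
next
  case (Suc n)
  let ?N = "sph_measure r :: (real^'n) measure"
  define C where "C k = (\<integral>z. z $ i ^ (2 * k) \<partial>?N)" for k
  have int: "integrable ?N (\<lambda>z. z $ i ^ (2 * n) * (z $ l)\<^sup>2)" for l
    by (intro sph_integrable r continuous_intros)
  have "real m * C (Suc n) = (\<Sum>l\<in>UNIV - {i}. C (Suc n))"
    using card by simp
  also have "\<dots> = (\<Sum>l\<in>UNIV - {i}. (2 * real (Suc n) - 1) * (\<integral>z. z $ i ^ (2 * n) * (z $ l)\<^sup>2 \<partial>?N))"
    unfolding C_def by (intro sum.cong refl) (use sph_mixed_moment[OF r, of i _ "Suc n"] in auto)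
  also have "\<dots> = (2 * real n + 1) * (\<integral>z. (\<Sum>l\<in>UNIV - {i}. z $ i ^ (2 * n) * (z $ l)\<^sup>2) \<partial>?N)"
    using int by (subst Bochner_Integration.integral_sum) (auto simp: sum_distrib_left add.commute)
  also have "(\<integral>z. (\<Sum>l\<in>UNIV - {i}. z $ i ^ (2 * n) * (z $ l)\<^sup>2) \<partial>?N) =
      (\<integral>z. r\<^sup>2 * z $ i ^ (2 * n) - z $ i ^ (2 * Suc n) \<partial>?N)"
  proof (rule Bochner_Integration.integral_cong[OF refl])
    fix z :: "real^'n" assume "z \<in> space ?N"
    then have "r\<^sup>2 = z \<bullet> z" by (simp add: power2_norm_eq_inner[symmetric])
    also have "\<dots> = (\<Sum>l\<in>UNIV. (z $ l)\<^sup>2)" by (simp add: inner_vec_def power2_eq_square)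
    also have "\<dots> = (z $ i)\<^sup>2 + (\<Sum>l\<in>UNIV - {i}. (z $ l)\<^sup>2)" by (rule sum.remove) auto
    finally have "(\<Sum>l\<in>UNIV - {i}. (z $ l)\<^sup>2) = r\<^sup>2 - (z $ i)\<^sup>2" by simp
    then show "(\<Sum>l\<in>UNIV - {i}. z $ i ^ (2 * n) * (z $ l)\<^sup>2) = r\<^sup>2 * z $ i ^ (2 * n) - z $ i ^ (2 * Suc n)"
      unfolding sum_distrib_left[symmetric]
      by (simp add: right_diff_distrib power2_eq_square)
  qed
  also have "\<dots> = r\<^sup>2 * C n - C (Suc n)"
  proof -
    have "integrable ?N (\<lambda>z. r\<^sup>2 * z $ i ^ (2 * n))" "integrable ?N (\<lambda>z. z $ i ^ (2 * Suc n))"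
      by (intro sph_integrable r continuous_intros)+
    then show ?thesis by (simp add: C_def)
  qed
  finally have "(2 * real n + 1 + real m) * C (Suc n) = (2 * real n + 1) * r\<^sup>2 * C n"
    by (simp add: algebra_simps)
  moreover have "0 < 2 * real n + 1 + real m" by linarith
  ultimately have "C (Suc n) = (2 * real n + 1) * r\<^sup>2 * C n / (2 * real n + 1 + real m)"
    by (simp add: field_simps)
  also have "\<dots> = r ^ (2 * Suc n) / sphere_weight m (Suc n)"
    using Suc by (simp add: C_def sphere_weight_def power2_eq_square)
  finally show ?case by (simp add: C_def)
qed

lemma sph_moment:
  fixes x :: "real^'n"
  assumes "0 < r" "CARD('n) = m + 1"
  shows "(\<integral>z. (x \<bullet> z) ^ (2 * n) \<partial>sph_measure r) = norm x ^ (2 * n) * r ^ (2 * n) / sphere_weight m n"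
  using sph_moment_scale[OF assms(1), of x "2 * n" undefined] sph_axis_moment[OF assms] by simp

section \<open>The heat equation on the sphere\<close>

text \<open>For \<open>\<bar>a\<bar> < r\<close> the line through \<open>x\<close> avoids the
  origin, so its projection stays on the sphere; the derivatives in \<open>heat_sol\<close> see only
  values of \<open>u\<close> there.\<close>

lemma heat_sol_cong:
  fixes u u' :: "real^'n \<Rightarrow> real \<Rightarrow> real"
  assumes r: "0 < r" and u: "heat_sol r u"
    and eq: "\<And>x t. x \<in> sphere 0 r \<Longrightarrow> 0 < t \<Longrightarrow> u x t = u' x t"
  shows "heat_sol r u'"
  unfolding heat_sol_def
proof (intro ballI allI impI)
  fix x :: "real^'n" and t :: real assume x: "x \<in> sphere 0 r" and t: "0 < t"
  let ?P = "\<lambda>i a. (r / norm (x + a *\<^sub>R axis i 1)) *\<^sub>R (x + a *\<^sub>R axis i 1)"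
  obtain dt d2 where 1: "((\<lambda>s. u x s) has_real_derivative dt) (at t)"
    and 2: "\<And>i. has_second_deriv (\<lambda>a. u (?P i a) t) 0 (d2 i)"
    and 3: "dt = (1/2) * (\<Sum>i\<in>UNIV. d2 i)"
    using u x t unfolding heat_sol_def by blast
  have P: "?P i a \<in> sphere 0 r" if "\<bar>a\<bar> < r" for i a
  proof -
    have "x + a *\<^sub>R axis i 1 \<noteq> 0"
    proof
      assume "x + a *\<^sub>R axis i 1 = 0"
      then have "x = - (a *\<^sub>R axis i 1)" by (simp add: eq_neg_iff_add_eq_0)
      then have "norm x = \<bar>a\<bar>" by simp
      then show False using that x by simp
    qed
    then show ?thesis using r by simp
  qed
  have "((\<lambda>s. u' x s) has_real_derivative dt) (at t)"
    by (rule has_field_derivative_transform_within_open[OF 1, of "{0<..}"]) (use t eq x in auto)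
  moreover have "has_second_deriv (\<lambda>a. u' (?P i a) t) 0 (d2 i)" for i
  proof -
    obtain g where g: "\<forall>\<^sub>F b in nhds 0. ((\<lambda>a. u (?P i a) t) has_real_derivative g b) (at b)"
      and gd: "(g has_real_derivative d2 i) (at 0)"
      using 2 unfolding has_second_deriv_def by blast
    have "\<forall>\<^sub>F b::real in nhds 0. \<bar>b\<bar> < r"
      using r by (auto simp: eventually_nhds_metric dist_real_def intro!: exI[of _ r])
    with g have "\<forall>\<^sub>F b in nhds 0. ((\<lambda>a. u' (?P i a) t) has_real_derivative g b) (at b)"
    proof eventually_elim
      case (elim b)
      show ?case
        by (rule has_field_derivative_transform_within_open[OF elim(1), of "ball 0 r"])
           (use elim(2) in \<open>auto intro!: eq P t\<close>)
    qed
    then show ?thesis using gd unfolding has_second_deriv_def by (intro exI[of _ g] conjI)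
  qed
  ultimately show "\<exists>dt d2. ((\<lambda>s. u' x s) has_real_derivative dt) (at t) \<and>
      (\<forall>i. has_second_deriv (\<lambda>a. u' (?P i a) t) 0 (d2 i)) \<and> dt = (1/2) * (\<Sum>i\<in>UNIV. d2 i)"
    using 3 by blast
qed

lemma has_second_deriv_diff:
  assumes "has_second_deriv f a d" "has_second_deriv g a e"
  shows "has_second_deriv (\<lambda>b. f b - g b) a (d - e)"
proof -
  obtain f' g' where
    f: "\<forall>\<^sub>F b in nhds a. (f has_real_derivative f' b) (at b)" "(f' has_real_derivative d) (at a)" and
    g: "\<forall>\<^sub>F b in nhds a. (g has_real_derivative g' b) (at b)" "(g' has_real_derivative e) (at a)"
    using assms unfolding has_second_deriv_def by blast
  have "\<forall>\<^sub>F b in nhds a. ((\<lambda>b. f b - g b) has_real_derivative f' b - g' b) (at b)"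
    using f(1) g(1) by eventually_elim (rule DERIV_diff)
  moreover have "((\<lambda>b. f' b - g' b) has_real_derivative d - e) (at a)"
    using f(2) g(2) by (rule DERIV_diff)
  ultimately show ?thesis unfolding has_second_deriv_def by (intro exI[of _ "\<lambda>b. f' b - g' b"] conjI)
qed

lemma heat_sol_diff:
  fixes u v :: "real^'n \<Rightarrow> real \<Rightarrow> real"
  assumes "heat_sol r u" "heat_sol r v"
  shows "heat_sol r (\<lambda>x t. u x t - v x t)"
  unfolding heat_sol_def
proof (intro ballI allI impI)
  fix x :: "real^'n" and t :: real assume x: "x \<in> sphere 0 r" and t: "0 < t"
  let ?P = "\<lambda>i a. (r / norm (x + a *\<^sub>R axis i 1)) *\<^sub>R (x + a *\<^sub>R axis i 1)"
  obtain dt d2 where 1: "((\<lambda>s. u x s) has_real_derivative dt) (at t)"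
    "\<And>i. has_second_deriv (\<lambda>a. u (?P i a) t) 0 (d2 i)" "dt = (1/2) * (\<Sum>i\<in>UNIV. d2 i)"
    using assms(1) x t unfolding heat_sol_def by blast
  obtain et e2 where 2: "((\<lambda>s. v x s) has_real_derivative et) (at t)"
    "\<And>i. has_second_deriv (\<lambda>a. v (?P i a) t) 0 (e2 i)" "et = (1/2) * (\<Sum>i\<in>UNIV. e2 i)"
    using assms(2) x t unfolding heat_sol_def by blast
  show "\<exists>dt d2. ((\<lambda>s. u x s - v x s) has_real_derivative dt) (at t) \<and>
      (\<forall>i. has_second_deriv (\<lambda>a. u (?P i a) t - v (?P i a) t) 0 (d2 i)) \<and> dt = (1/2) * (\<Sum>i\<in>UNIV. d2 i)"
  proof (intro exI conjI allI)
    show "((\<lambda>s. u x s - v x s) has_real_derivative dt - et) (at t)"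
      using 1(1) 2(1) by (rule DERIV_diff)
    show "has_second_deriv (\<lambda>a. u (?P i a) t - v (?P i a) t) 0 (d2 i - e2 i)" for i
      using 1(2) 2(2) by (rule has_second_deriv_diff)
    show "dt - et = (1/2) * (\<Sum>i\<in>UNIV. d2 i - e2 i)"
      by (simp add: 1(3) 2(3) sum_subtractf diff_divide_distrib)
  qed
qed

lemma heat_sol_shift:
  fixes u :: "real^'n \<Rightarrow> real \<Rightarrow> real"
  assumes "heat_sol r u" "0 \<le> s"
  shows "heat_sol r (\<lambda>x t. u x (t + s))"
  unfolding heat_sol_def
proof (intro ballI allI impI)
  fix x :: "real^'n" and t :: real assume x: "x \<in> sphere 0 r" and t: "0 < t"
  let ?P = "\<lambda>i a. (r / norm (x + a *\<^sub>R axis i 1)) *\<^sub>R (x + a *\<^sub>R axis i 1)"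
  have "0 < t + s" using t assms(2) by simp
  then obtain dt d2 where 1: "((\<lambda>s. u x s) has_real_derivative dt) (at (t + s))"
    "\<And>i. has_second_deriv (\<lambda>a. u (?P i a) (t + s)) 0 (d2 i)" "dt = (1/2) * (\<Sum>i\<in>UNIV. d2 i)"
    using assms(1) x unfolding heat_sol_def by blast
  have "((\<lambda>t. u x (t + s)) has_real_derivative dt) (at t)"
    using 1(1) by (simp add: DERIV_shift)
  then show "\<exists>dt d2. ((\<lambda>t. u x (t + s)) has_real_derivative dt) (at t) \<and>
      (\<forall>i. has_second_deriv (\<lambda>a. u (?P i a) (t + s)) 0 (d2 i)) \<and> dt = (1/2) * (\<Sum>i\<in>UNIV. d2 i)"
    using 1 by blast
qed

text \<open>Were \<open>d\<close> positive, the first derivative, which vanishes at 0, would be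
  positive just to the right of 0, and the mean value theorem would lift \<open>f\<close> above
  \<open>f 0\<close>.\<close>

lemma has_second_deriv_local_max:
  assumes f: "has_second_deriv f 0 d" and r: "0 < r"
    and max: "\<And>b. \<bar>b\<bar> < r \<Longrightarrow> f b \<le> f 0"
  shows "d \<le> 0"
proof (rule ccontr)
  assume "\<not> d \<le> 0"
  then have d: "0 < d" by simp
  obtain g where g: "\<forall>\<^sub>F b in nhds 0. (f has_real_derivative g b) (at b)"
    and gd: "(g has_real_derivative d) (at 0)"
    using f by (auto simp: has_second_deriv_def)
  have "(f has_real_derivative g 0) (at 0)"
    using eventually_nhds_x_imp_x[OF g] .
  then have g0: "g 0 = 0"
    by (rule DERIV_local_max[OF _ r]) (use max in auto)
  obtain \<eta> where \<eta>: "0 < \<eta>" "\<And>b. \<bar>b\<bar> < \<eta> \<Longrightarrow> (f has_real_derivative g b) (at b)"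
    using g by (auto simp: eventually_nhds_metric dist_real_def)
  obtain \<delta> where \<delta>: "0 < \<delta>" "\<And>h. 0 < h \<Longrightarrow> h < \<delta> \<Longrightarrow> 0 < g h"
    using DERIV_pos_inc_right[OF gd d] g0 by auto
  define h where "h = min r (min \<eta> \<delta>) / 2"
  have h: "0 < h" "h < r" "h < \<eta>" "h < \<delta>" using \<eta>(1) \<delta>(1) r by (auto simp: h_def)
  have "\<exists>z>0. z < h \<and> f h - f 0 = (h - 0) * g z"
    using h \<eta>(2) by (intro MVT2) auto
  then obtain z where z: "0 < z" "z < h" "f h - f 0 = h * g z" by auto
  then have "0 < f h - f 0" using \<delta>(2)[of z] h by simp
  then show False using max[of h] h by simp
qed

text \<open>At a maximum of \<open>v - k s\<close> over the sphere and a time interval, the second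
  derivatives along all projected lines are nonpositive, hence so is the time derivative of
  \<open>v\<close>. The penalty then makes \<open>v - k s\<close> strictly larger just before, a
  contradiction unless the maximum is at the initial time.\<close>

lemma sphere_max_principle:
  fixes v :: "real^'n \<Rightarrow> real \<Rightarrow> real"
  assumes r: "0 < r" and heat: "heat_sol r v"
    and cont: "continuous_on (sphere 0 r \<times> {0<..}) (\<lambda>(x, t). v x t)"
    and init: "\<And>e. 0 < e \<Longrightarrow> \<exists>\<delta>>0. \<forall>t. 0 < t \<and> t < \<delta> \<longrightarrow> (\<forall>x\<in>sphere 0 r. v x t \<le> e)"
    and x: "x \<in> sphere 0 r" and t: "0 < t"
  shows "v x t \<le> 0"
proof (rule ccontr)
  assume "\<not> v x t \<le> 0"
  define e where "e = v x t"
  have e: "0 < e" using \<open>\<not> v x t \<le> 0\<close> by (simp add: e_def)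
  obtain \<delta> where \<delta>: "0 < \<delta>" "\<And>s y. 0 < s \<Longrightarrow> s < \<delta> \<Longrightarrow> y \<in> sphere 0 r \<Longrightarrow> v y s \<le> e / 2"
    using init[of "e / 2"] e by auto
  define \<tau> where "\<tau> = min \<delta> t / 2"
  have \<tau>: "0 < \<tau>" "\<tau> < \<delta>" "\<tau> < t" using \<delta>(1) t by (auto simp: \<tau>_def)
  \<comment> \<open>The penalized function equals \<open>3 e / 4\<close> at \<open>(x, t)\<close>
    but is below \<open>e / 2\<close> at time \<open>\<tau>\<close>, so its maximum lies at a later
    time.\<close>
  define k where "k = e / (4 * t)"
  have k: "0 < k" using e t by (simp add: k_def)
  let ?A = "sphere (0::real^'n) r \<times> {\<tau>..t}"
  let ?w = "\<lambda>p. v (fst p) (snd p) - k * snd p"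
  have "continuous_on ?A ?w"
  proof (intro continuous_intros)
    have "?A \<subseteq> sphere 0 r \<times> {0<..}" using \<tau> by auto
    from continuous_on_subset[OF cont this] show "continuous_on ?A (\<lambda>p. v (fst p) (snd p))"
      by (simp add: case_prod_unfold)
  qed
  moreover have "compact ?A" by (intro compact_Times) auto
  moreover have "(x, t) \<in> ?A" using x \<tau> by auto
  ultimately obtain p where p: "p \<in> ?A" "\<And>q. q \<in> ?A \<Longrightarrow> ?w q \<le> ?w p"
    using continuous_attains_sup[of ?A ?w] by blast
  define x0 t0 where "x0 = fst p" "t0 = snd p"
  have x0: "x0 \<in> sphere 0 r" "\<tau> \<le> t0" "t0 \<le> t" using p(1) by (auto simp: x0_t0_def)
  have max: "v y s - k * s \<le> v x0 t0 - k * t0" if "y \<in> sphere 0 r" "\<tau> \<le> s" "s \<le> t" for y s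
    using p(2)[of "(y, s)"] that by (simp add: x0_t0_def)
  have "t0 \<noteq> \<tau>"
  proof
    assume "t0 = \<tau>"
    then have "v x0 t0 \<le> e / 2" using \<delta>(2) \<tau> x0 by auto
    moreover have "k * t = e / 4" using t by (simp add: k_def)
    moreover have "0 < k * t0" using k x0 \<tau> by simp
    ultimately show False using max[OF x, of t] \<tau> e unfolding e_def by linarith
  qed
  then have t0: "\<tau> < t0" "0 < t0" using x0 \<tau> by auto
  obtain dt d2 where dt: "((\<lambda>s. v x0 s) has_real_derivative dt) (at t0)"
    and d2: "\<And>i. has_second_deriv (\<lambda>a. v ((r / norm (x0 + a *\<^sub>R axis i 1)) *\<^sub>R (x0 + a *\<^sub>R axis i 1)) t0) 0 (d2 i)"
    and eq: "dt = (1/2) * (\<Sum>i\<in>UNIV. d2 i)"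
    using heat x0(1) t0(2) unfolding heat_sol_def by blast
  have "d2 i \<le> 0" for i
  proof (rule has_second_deriv_local_max[OF d2 r])
    fix b :: real assume b: "\<bar>b\<bar> < r"
    have "x0 + b *\<^sub>R axis i 1 \<noteq> 0"
    proof
      assume "x0 + b *\<^sub>R axis i 1 = 0"
      then have "x0 = - (b *\<^sub>R axis i 1)" by (simp add: eq_neg_iff_add_eq_0)
      then have "norm x0 = \<bar>b\<bar>" by simp
      then show False using b x0 by simp
    qed
    then have "(r / norm (x0 + b *\<^sub>R axis i 1)) *\<^sub>R (x0 + b *\<^sub>R axis i 1) \<in> sphere 0 r"
      using r by simp
    from max[OF this, of t0] show "v ((r / norm (x0 + b *\<^sub>R axis i 1)) *\<^sub>R (x0 + b *\<^sub>R axis i 1)) t0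
        \<le> v ((r / norm (x0 + 0 *\<^sub>R axis i 1)) *\<^sub>R (x0 + 0 *\<^sub>R axis i 1)) t0"
      using x0 r by simp
  qed
  then have "dt \<le> 0" unfolding eq by (simp add: sum_nonpos)
  have "((\<lambda>s. v x0 s - k * s) has_real_derivative dt - k) (at t0)"
    by (auto intro!: derivative_eq_intros dt)
  from DERIV_neg_dec_left[OF this] \<open>dt \<le> 0\<close> k
  obtain h0 where h0: "0 < h0" "\<And>h. 0 < h \<Longrightarrow> h < h0 \<Longrightarrow> v x0 t0 - k * t0 < v x0 (t0 - h) - k * (t0 - h)"
    by auto
  define h where "h = min h0 (t0 - \<tau>) / 2"
  have "0 < h" "h < h0" "h < t0 - \<tau>" using h0(1) t0 by (auto simp: h_def)
  then show False using h0(2)[of h] max[OF x0(1), of "t0 - h"] x0 by force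
qed

text \<open>Squared norm of \<open>x + a *\<^sub>R axis i 1\<close> when \<open>x\<close> has norm
  \<open>r\<close>, as a polynomial in \<open>a\<close>.\<close>

definition line_norm_sq :: "real \<Rightarrow> real^'n \<Rightarrow> 'n \<Rightarrow> real \<Rightarrow> real" where
  "line_norm_sq r x i a = r\<^sup>2 + 2 * a * x $ i + a\<^sup>2"

text \<open>\<open>line_sq r x z i a\<close> is \<open>(y \<bullet> z / r\<^sup>2)\<^sup>2\<close>, where \<open>y\<close> is the radial projection of \<open>x + a e\<^sub>i\<close>
  to the sphere.\<close>
definition line_sq :: "real \<Rightarrow> real^'n \<Rightarrow> real^'n \<Rightarrow> 'n \<Rightarrow> real \<Rightarrow> real" where
  "line_sq r x z i a = (x \<bullet> z + a * z $ i)\<^sup>2 / (r\<^sup>2 * line_norm_sq r x i a)"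

definition line_sq1 :: "real \<Rightarrow> real^'n \<Rightarrow> real^'n \<Rightarrow> 'n \<Rightarrow> real \<Rightarrow> real" where
  "line_sq1 r x z i a = (2 * z $ i * (x \<bullet> z + a * z $ i) * line_norm_sq r x i a
      - (x \<bullet> z + a * z $ i)\<^sup>2 * (2 * x $ i + 2 * a)) / (r\<^sup>2 * (line_norm_sq r x i a)\<^sup>2)"

definition line_sq2 :: "real \<Rightarrow> real^'n \<Rightarrow> real^'n \<Rightarrow> 'n \<Rightarrow> real \<Rightarrow> real" where
  "line_sq2 r x z i a = ((2 * (z $ i)\<^sup>2 * line_norm_sq r x i a - 2 * (x \<bullet> z + a * z $ i)\<^sup>2) * line_norm_sq r x i a
      - 2 * (2 * z $ i * (x \<bullet> z + a * z $ i) * line_norm_sq r x i a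
      - (x \<bullet> z + a * z $ i)\<^sup>2 * (2 * x $ i + 2 * a)) * (2 * x $ i + 2 * a)) / (r\<^sup>2 * (line_norm_sq r x i a) ^ 3)"

lemma line_norm_sq_eq:
  fixes x :: "real^'n"
  assumes "norm x = r" shows "(norm (x + a *\<^sub>R axis i 1))\<^sup>2 = line_norm_sq r x i a"
proof -
  have "x \<bullet> x = r\<^sup>2" using assms by (simp add: dot_square_norm)
  then show ?thesis
    unfolding power2_norm_eq_inner line_norm_sq_def
    by (simp add: inner_add_left inner_add_right inner_axis inner_axis' inner_axis_axis power2_eq_square distrib_left)
qed

lemma line_norm_sq_pos:
  fixes x :: "real^'n"
  assumes "norm x = r" "\<bar>a\<bar> < r" shows "0 < line_norm_sq r x i a"
proof -
  have "norm x \<le> norm (x + a *\<^sub>R axis i 1) + norm (- (a *\<^sub>R axis i (1::real)) :: real^'n)"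
    using norm_triangle_ineq[of "x + a *\<^sub>R axis i 1" "- (a *\<^sub>R axis i 1)"] by simp
  then have "r \<le> norm (x + a *\<^sub>R axis i 1) + \<bar>a\<bar>" using assms by simp
  then have "0 < norm (x + a *\<^sub>R axis i 1)" using assms by linarith
  then show ?thesis unfolding line_norm_sq_eq[OF assms(1), symmetric] by (rule zero_less_power)
qed

lemma line_sq_eq:
  fixes x :: "real^'n"
  assumes "norm x = r" "\<bar>a\<bar> < r"
  shows "((((r / norm (x + a *\<^sub>R axis i 1)) *\<^sub>R (x + a *\<^sub>R axis i 1)) \<bullet> z) / r\<^sup>2)\<^sup>2 = line_sq r x z i a"
proof -
  have "((((r / norm (x + a *\<^sub>R axis i 1)) *\<^sub>R (x + a *\<^sub>R axis i 1)) \<bullet> z) / r\<^sup>2)\<^sup>2 =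
      (x \<bullet> z + a * z $ i)\<^sup>2 * (r\<^sup>2 / (r\<^sup>2)\<^sup>2) / (norm (x + a *\<^sub>R axis i 1))\<^sup>2"
    by (simp add: power_mult_distrib power_divide inner_add_left inner_axis' mult_ac)
  also have "r\<^sup>2 / (r\<^sup>2)\<^sup>2 = 1 / r\<^sup>2" by (simp add: power2_eq_square)
  finally show ?thesis by (simp add: line_norm_sq_eq[OF assms(1)] line_sq_def)
qed

lemma line_norm_sq_deriv: "(line_norm_sq r x i has_real_derivative 2 * x $ i + 2 * a) (at a)"
  unfolding line_norm_sq_def[abs_def] by (auto intro!: derivative_eq_intros)

lemma line_sq_deriv:
  assumes "r \<noteq> 0" "line_norm_sq r x i a \<noteq> 0"
  shows "(line_sq r x z i has_real_derivative line_sq1 r x z i a) (at a)"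
proof -
  have p: "((\<lambda>a. x \<bullet> z + a * z $ i) has_real_derivative z $ i) (at a)"
    by (auto intro!: derivative_eq_intros)
  show ?thesis
    unfolding line_sq_def[abs_def] line_sq1_def
    by (rule derivative_eq_intros p line_norm_sq_deriv refl)+
       (use assms in \<open>simp_all add: field_simps power2_eq_square\<close>)
qed

lemma line_sq1_deriv:
  assumes "r \<noteq> 0" "line_norm_sq r x i a \<noteq> 0"
  shows "(line_sq1 r x z i has_real_derivative line_sq2 r x z i a) (at a)"
proof -
  define p where "p a = x \<bullet> z + a * z $ i" for a
  define q where "q = line_norm_sq r x i"
  define c where "c a = 2 * x $ i + 2 * a" for a
  define u where "u = z $ i"
  have p: "(p has_real_derivative u) (at a)"
    unfolding p_def[abs_def] u_def by (auto intro!: derivative_eq_intros)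
  have q: "(q has_real_derivative c a) (at a)" unfolding q_def c_def by (rule line_norm_sq_deriv)
  have c: "(c has_real_derivative 2) (at a)"
    unfolding c_def[abs_def] by (auto intro!: derivative_eq_intros)
  have 0: "q a \<noteq> 0" "r \<noteq> 0" using assms by (auto simp: q_def)
  have "((\<lambda>a. (2 * u * p a * q a - (p a)\<^sup>2 * c a) / (r\<^sup>2 * (q a)\<^sup>2)) has_real_derivative
      ((2 * u * u * q a + 2 * u * p a * c a - (2 * p a * u * c a + (p a)\<^sup>2 * 2)) * (r\<^sup>2 * (q a)\<^sup>2)
       - (2 * u * p a * q a - (p a)\<^sup>2 * c a) * (r\<^sup>2 * (2 * q a * c a))) / ((r\<^sup>2 * (q a)\<^sup>2) * (r\<^sup>2 * (q a)\<^sup>2))) (at a)"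
    by (rule derivative_eq_intros p q c refl)+ (use 0 in \<open>simp_all add: algebra_simps\<close>)
  \<comment> \<open>The quotient rule leaves the surplus factor \<open>r\<^sup>2 * q a\<close> in
    numerator and denominator; splitting it off produces the cubic denominator of
    \<open>line_sq2\<close>.\<close>
  moreover have "((2 * u * u * q a + 2 * u * p a * c a - (2 * p a * u * c a + (p a)\<^sup>2 * 2)) * (r\<^sup>2 * (q a)\<^sup>2)
       - (2 * u * p a * q a - (p a)\<^sup>2 * c a) * (r\<^sup>2 * (2 * q a * c a))) / ((r\<^sup>2 * (q a)\<^sup>2) * (r\<^sup>2 * (q a)\<^sup>2))
     = (r\<^sup>2 * q a * ((2 * u\<^sup>2 * q a - 2 * (p a)\<^sup>2) * q a - 2 * (2 * u * p a * q a - (p a)\<^sup>2 * c a) * c a))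
      / (r\<^sup>2 * q a * (r\<^sup>2 * (q a) ^ 3))"
    by (rule arg_cong2[where f = "(/)"]) (simp_all add: algebra_simps power2_eq_square power3_eq_cube)
  also have "\<dots> = ((2 * u\<^sup>2 * q a - 2 * (p a)\<^sup>2) * q a - 2 * (2 * u * p a * q a - (p a)\<^sup>2 * c a) * c a)
      / (r\<^sup>2 * (q a) ^ 3)"
    using 0 by (intro mult_divide_mult_cancel_left) auto
  finally show ?thesis
    unfolding line_sq1_def[abs_def] line_sq2_def p_def q_def c_def u_def by simp
qed

context sphere_heat
begin

lemma sq_le_1:
  fixes x z :: "real^'n"
  assumes "x \<in> sphere 0 r" "z \<in> sphere 0 r"
  shows "0 \<le> (x \<bullet> z / r\<^sup>2)\<^sup>2" "(x \<bullet> z / r\<^sup>2)\<^sup>2 \<le> 1"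
proof -
  have "\<bar>x \<bullet> z\<bar> \<le> r\<^sup>2" using Cauchy_Schwarz_ineq2[of x z] assms by (simp add: power2_eq_square)
  then have "\<bar>x \<bullet> z / r\<^sup>2\<bar> \<le> 1" using r by (simp add: abs_divide)
  then show "(x \<bullet> z / r\<^sup>2)\<^sup>2 \<le> 1" using abs_square_le_1 by blast
qed simp

definition line_zonal1 :: "real \<Rightarrow> real^'n \<Rightarrow> real^'n \<Rightarrow> 'n \<Rightarrow> real \<Rightarrow> real" where
  "line_zonal1 t x z i a = zonal1 m r (line_sq r x z i a) t * line_sq1 r x z i a"

definition line_zonal2 :: "real \<Rightarrow> real^'n \<Rightarrow> real^'n \<Rightarrow> 'n \<Rightarrow> real \<Rightarrow> real" where
  "line_zonal2 t x z i a = zonal2 m r (line_sq r x z i a) t * (line_sq1 r x z i a)\<^sup>2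
     + zonal1 m r (line_sq r x z i a) t * line_sq2 r x z i a"

lemma line_zonal_deriv:
  assumes "0 < t" "norm x = r" "\<bar>a\<bar> < r"
  shows "((\<lambda>a. zonal m r (line_sq r x z i a) t) has_real_derivative line_zonal1 t x z i a) (at a)"
    and "(line_zonal1 t x z i has_real_derivative line_zonal2 t x z i a) (at a)"
proof -
  have l: "(line_sq r x z i has_real_derivative line_sq1 r x z i a) (at a)"
    "(line_sq1 r x z i has_real_derivative line_sq2 r x z i a) (at a)"
    using line_norm_sq_pos[OF assms(2,3), of i] r
    by (intro line_sq_deriv line_sq1_deriv; simp)+
  show "((\<lambda>a. zonal m r (line_sq r x z i a) t) has_real_derivative line_zonal1 t x z i a) (at a)"
    unfolding line_zonal1_def by (rule DERIV_chain2[OF zonal_deriv[OF assms(1)] l(1)])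
  have z1: "((\<lambda>a. zonal1 m r (line_sq r x z i a) t) has_real_derivative
      zonal2 m r (line_sq r x z i a) t * line_sq1 r x z i a) (at a)"
    by (rule DERIV_chain2[OF zonal1_deriv[OF assms(1)] l(1)])
  show "(line_zonal1 t x z i has_real_derivative line_zonal2 t x z i a) (at a)"
    unfolding line_zonal1_def[abs_def] line_zonal2_def
    by (rule derivative_eq_intros z1 l refl)+ (simp add: power2_eq_square)
qed

text \<open>By the chain rule the sum needs only the squared gradient and the Laplacian of
  \<open>v\<close>. They follow from the sums of \<open>(x $ i)\<^sup>2\<close>,
  \<open>(z $ i)\<^sup>2\<close> and \<open>x $ i * z $ i\<close>; \<open>m + 1\<close> enters as
  the number of coordinates.\<close>

lemma line_zonal_laplacian:
  fixes x z :: "real^'n"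
  assumes card: "CARD('n) = m + 1" and x: "x \<in> sphere 0 r" and z: "z \<in> sphere 0 r"
  shows "(\<Sum>i\<in>UNIV. line_zonal2 t x z i 0) = 2 * zonal_dt m r ((x \<bullet> z / r\<^sup>2)\<^sup>2) t"
proof -
  define \<alpha> where "\<alpha> = x \<bullet> z"
  define v where "v = (\<alpha> / r\<^sup>2)\<^sup>2"
  define R where "R = r\<^sup>2"
  have R: "0 < R" using r by (simp add: R_def)
  have v_R: "v = \<alpha>\<^sup>2 / R\<^sup>2" by (simp add: v_def R_def power_divide)
  have sq: "line_sq r x z i 0 = v" for i
    using r by (simp add: line_sq_def line_norm_sq_def v_def \<alpha>_def power_divide power2_eq_square)
  have sxx: "(\<Sum>i\<in>UNIV. (x $ i)\<^sup>2) = R" "(\<Sum>i\<in>UNIV. (z $ i)\<^sup>2) = R" "(\<Sum>i\<in>UNIV. x $ i * z $ i) = \<alpha>"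
  proof -
    have "x \<bullet> x = R" "z \<bullet> z = R" using x z by (simp_all add: dot_square_norm R_def)
    then show "(\<Sum>i\<in>UNIV. (x $ i)\<^sup>2) = R" "(\<Sum>i\<in>UNIV. (z $ i)\<^sup>2) = R" "(\<Sum>i\<in>UNIV. x $ i * z $ i) = \<alpha>"
      by (simp_all add: \<alpha>_def inner_vec_def power2_eq_square)
  qed
  have s1: "line_sq1 r x z i 0 = 2 * \<alpha> / R ^ 3 * (R * z $ i - \<alpha> * x $ i)" for i
    using R by (simp add: line_sq1_def line_norm_sq_def flip: \<alpha>_def R_def)
      (simp add: field_simps power2_eq_square power3_eq_cube)
  have s2: "line_sq2 r x z i 0 = (2 * R\<^sup>2 * (z $ i)\<^sup>2 - 2 * \<alpha>\<^sup>2 * R - 8 * \<alpha> * R * (x $ i * z $ i) + 8 * \<alpha>\<^sup>2 * (x $ i)\<^sup>2) / R ^ 4" for i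
    using R by (simp add: line_sq2_def line_norm_sq_def flip: \<alpha>_def R_def)
      (simp add: field_simps power2_eq_square power3_eq_cube power4_eq_xxxx)
  have S1: "(\<Sum>i\<in>UNIV. (line_sq1 r x z i 0)\<^sup>2) = 4 * v * (1 - v) / R"
  proof -
    have "(line_sq1 r x z i 0)\<^sup>2 = (4 * \<alpha>\<^sup>2 / R ^ 6) * (R\<^sup>2 * (z $ i)\<^sup>2 - 2 * R * \<alpha> * (x $ i * z $ i) + \<alpha>\<^sup>2 * (x $ i)\<^sup>2)" for i
    proof -
      have "(2 * \<alpha> / R ^ 3)\<^sup>2 = 4 * \<alpha>\<^sup>2 / R ^ 6"
        by (simp add: power_divide power_mult_distrib flip: power_mult)
      moreover have "(R * z $ i - \<alpha> * x $ i)\<^sup>2 = R\<^sup>2 * (z $ i)\<^sup>2 - 2 * R * \<alpha> * (x $ i * z $ i) + \<alpha>\<^sup>2 * (x $ i)\<^sup>2"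
        by (simp add: power2_eq_square algebra_simps)
      ultimately show ?thesis unfolding s1 power_mult_distrib by simp
    qed
    then have "(\<Sum>i\<in>UNIV. (line_sq1 r x z i 0)\<^sup>2) = (4 * \<alpha>\<^sup>2 / R ^ 6) *
        (R\<^sup>2 * (\<Sum>i\<in>UNIV. (z $ i)\<^sup>2) - 2 * R * \<alpha> * (\<Sum>i\<in>UNIV. x $ i * z $ i) + \<alpha>\<^sup>2 * (\<Sum>i\<in>UNIV. (x $ i)\<^sup>2))"
      by (simp only: sum_distrib_left[symmetric] sum.distrib sum_subtractf)
    also have "\<dots> = 4 * v * (1 - v) / R"
      unfolding sxx v_R using R by (simp add: field_simps power2_eq_square eval_nat_numeral)
    finally show ?thesis .
  qed
  have S2: "(\<Sum>i\<in>UNIV. line_sq2 r x z i 0) = (2 - 2 * (real m + 1) * v) / R"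
  proof -
    have "(\<Sum>i\<in>UNIV. line_sq2 r x z i 0) = (2 * R\<^sup>2 * (\<Sum>i\<in>UNIV. (z $ i)\<^sup>2) - (\<Sum>i\<in>(UNIV::'n set). 2 * \<alpha>\<^sup>2 * R)
        - 8 * \<alpha> * R * (\<Sum>i\<in>UNIV. x $ i * z $ i) + 8 * \<alpha>\<^sup>2 * (\<Sum>i\<in>UNIV. (x $ i)\<^sup>2)) / R ^ 4"
      unfolding s2 by (simp only: sum_divide_distrib[symmetric] sum_distrib_left[symmetric] sum.distrib sum_subtractf)
    also have "\<dots> = (2 - 2 * (real m + 1) * v) / R"
      unfolding sxx v_R using R card by (simp add: field_simps power2_eq_square eval_nat_numeral)
    finally show ?thesis .
  qed
  have "(\<Sum>i\<in>UNIV. line_zonal2 t x z i 0) = zonal2 m r v t * (\<Sum>i\<in>UNIV. (line_sq1 r x z i 0)\<^sup>2)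
      + zonal1 m r v t * (\<Sum>i\<in>UNIV. line_sq2 r x z i 0)"
    by (simp add: line_zonal2_def sq sum.distrib sum_distrib_left)
  also have "\<dots> = 2 * zonal_dt m r v t"
    unfolding S1 S2 zonal_dt_def R_def[symmetric] using R by (simp add: field_simps)
  finally show ?thesis by (simp add: v_def \<alpha>_def)
qed

text \<open>The measure is left general for two uses: a point mass recovers the kernel as a function
  of its first argument, and \<open>sph_measure\<close> gives the heat flow started from
  \<open>g\<close>.\<close>

definition zonal_avg :: "(real^'n) measure \<Rightarrow> (real^'n \<Rightarrow> real) \<Rightarrow> real^'n \<Rightarrow> real \<Rightarrow> real" where
  "zonal_avg N g x t = (\<integral>z. zonal m r ((x \<bullet> z / r\<^sup>2)\<^sup>2) t * g z \<partial>N)"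

lemma zonal_avg_heat_sol:
  fixes N :: "(real^'n) measure"
  assumes card: "CARD('n) = m + 1"
    and N: "finite_measure N" "sets N = sets (restrict_space borel (sphere 0 r))"
    and g: "continuous_on (sphere 0 r) g"
  shows "heat_sol r (zonal_avg N g)"
  unfolding heat_sol_def
proof (intro ballI allI impI)
  fix x :: "real^'n" and t :: real assume x: "x \<in> sphere 0 r" and t: "0 < t"
  have nx: "norm x = r" using x by simp
  have sp: "space N = sphere 0 r"
    using sets_eq_imp_space_eq[OF N(2)] by (simp add: space_restrict_space)
  have "bounded (g ` sphere 0 r)"
    by (intro compact_imp_bounded compact_continuous_image g compact_sphere)
  then obtain G where G: "\<And>z. z \<in> sphere 0 r \<Longrightarrow> \<bar>g z\<bar> \<le> G"
    unfolding bounded_iff by force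
  define dt where "dt = (\<integral>z. zonal_dt m r ((x \<bullet> z / r\<^sup>2)\<^sup>2) t * g z \<partial>N)"
  define d2 where "d2 i = (\<integral>z. line_zonal2 t x z i 0 * g z \<partial>N)" for i
  have dt: "((\<lambda>s. zonal_avg N g x s) has_real_derivative dt) (at t)"
  proof -
    obtain C where C: "\<And>v s. 0 \<le> v \<Longrightarrow> v \<le> 1 \<Longrightarrow> t / 2 \<le> s \<Longrightarrow> \<bar>zonal_dt m r v s\<bar> \<le> C"
      using zonal_dt_bounded[of "t / 2"] t by auto
    show ?thesis unfolding zonal_avg_def dt_def
    proof (rule has_derivative_parametric_integral[OF N(1), where \<delta> = "t / 2" and B = "C * G"])
      show "0 < t / 2" using t by simp
      fix s assume "\<bar>s - t\<bar> < t / 2"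
      then have s: "0 < s" "t / 2 \<le> s" by linarith+
      show "integrable N (\<lambda>z. zonal m r ((x \<bullet> z / r\<^sup>2)\<^sup>2) s * g z)"
        using r by (intro sphere_integrable[OF N] continuous_on_mult g continuous_on_compose2[OF zonal_cont_v[OF s(1)]] continuous_intros) auto
      fix z assume "z \<in> space N"
      then have z: "z \<in> sphere 0 r" by (simp add: sp)
      show "((\<lambda>s. zonal m r ((x \<bullet> z / r\<^sup>2)\<^sup>2) s * g z) has_real_derivative zonal_dt m r ((x \<bullet> z / r\<^sup>2)\<^sup>2) s * g z) (at s)"
        by (intro DERIV_cmult_right zonal_deriv_t sq_le_1 x z s)
      show "\<bar>zonal_dt m r ((x \<bullet> z / r\<^sup>2)\<^sup>2) s * g z\<bar> \<le> C * G"
        unfolding abs_mult using C[OF sq_le_1[OF x z] s(2)] G[OF z] by (intro mult_mono) auto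
    qed
  qed
  have d2: "has_second_deriv (\<lambda>a. zonal_avg N g ((r / norm (x + a *\<^sub>R axis i 1)) *\<^sub>R (x + a *\<^sub>R axis i 1)) t) 0 (d2 i)"
    and d2_int: "integrable N (\<lambda>z. line_zonal2 t x z i 0 * g z)" for i
  proof -
    \<comment> \<open>On this compact set the projected lines stay clear of the origin, so the
      integrand and its derivatives are continuous and therefore bounded.\<close>
    let ?A = "{- (r / 2)..r / 2} \<times> sphere (0::real^'n) r"
    have q0: "line_norm_sq r x i a \<noteq> 0" if "\<bar>a\<bar> < r" for a
      using line_norm_sq_pos[OF nx that, of i] by simp
    have cq: "continuous_on ?A (\<lambda>p. line_norm_sq r x i (fst p))"
      unfolding line_norm_sq_def by (intro continuous_intros)
    have cg: "continuous_on ?A (\<lambda>p. g (snd p))"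
      by (rule continuous_on_compose2[OF g]) (auto intro: continuous_intros)
    have qA: "line_norm_sq r x i (fst p) \<noteq> 0" if "p \<in> ?A" for p
    proof (rule q0)
      have "- (r / 2) \<le> fst p" "fst p \<le> r / 2" using that by auto
      then show "\<bar>fst p\<bar> < r" using r by linarith
    qed
    have cl: "continuous_on ?A (\<lambda>p. line_sq r x (snd p) i (fst p))"
      "continuous_on ?A (\<lambda>p. line_sq1 r x (snd p) i (fst p))"
      "continuous_on ?A (\<lambda>p. line_sq2 r x (snd p) i (fst p))"
      unfolding line_sq_def line_sq1_def line_sq2_def
      by (intro continuous_intros cq; use qA r in auto)+
    have c0: "continuous_on ?A (\<lambda>p. zonal m r (line_sq r x (snd p) i (fst p)) t * g (snd p))"
      by (intro continuous_intros continuous_on_compose2[OF zonal_cont_v[OF t, of UNIV]] cl cg) auto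
    have c1: "continuous_on ?A (\<lambda>p. line_zonal1 t x (snd p) i (fst p) * g (snd p))"
      unfolding line_zonal1_def
      by (intro continuous_intros continuous_on_compose2[OF zonal1_cont_v[OF t, of UNIV]] cl cg) auto
    have c2: "continuous_on ?A (\<lambda>p. line_zonal2 t x (snd p) i (fst p) * g (snd p))"
      unfolding line_zonal2_def
      by (intro continuous_intros continuous_on_compose2[OF zonal1_cont_v[OF t, of UNIV]]
            continuous_on_compose2[OF zonal2_cont_v[OF t, of UNIV]] cl cg) auto
    have slice: "continuous_on (sphere 0 r) (\<lambda>z. f z a)"
      if "continuous_on ?A (\<lambda>p. f (snd p) (fst p))" "\<bar>a\<bar> \<le> r / 2" for f :: "real^'n \<Rightarrow> real \<Rightarrow> real" and a
    proof -
      have "- (r / 2) \<le> a" "a \<le> r / 2" using that(2) by linarith+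
      then have "(\<lambda>z. (a, z)) ` sphere 0 r \<subseteq> ?A" by auto
      moreover have "continuous_on (sphere 0 r) (\<lambda>z::real^'n. (a, z))" by (intro continuous_intros)
      ultimately show ?thesis using continuous_on_compose2[OF that(1)] by fastforce
    qed
    have bdd: "\<exists>B. \<forall>a z. \<bar>a\<bar> \<le> r / 2 \<longrightarrow> z \<in> sphere 0 r \<longrightarrow> \<bar>f z a\<bar> \<le> B"
      if "continuous_on ?A (\<lambda>p. f (snd p) (fst p))" for f :: "real^'n \<Rightarrow> real \<Rightarrow> real"
    proof -
      have "bounded ((\<lambda>p. f (snd p) (fst p)) ` ?A)"
        by (intro compact_imp_bounded compact_continuous_image that compact_Times) auto
      then obtain B where B: "\<forall>p\<in>?A. norm (f (snd p) (fst p)) \<le> B" unfolding bounded_iff by blast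
      have "\<bar>f z a\<bar> \<le> B" if "\<bar>a\<bar> \<le> r / 2" "z \<in> sphere 0 r" for a z
      proof -
        have "- (r / 2) \<le> a" "a \<le> r / 2" using that(1) by linarith+
        then show ?thesis using B[rule_format, of "(a, z)"] that(2) by auto
      qed
      then show ?thesis by blast
    qed
    obtain B1 where B1: "\<And>a z. \<bar>a\<bar> \<le> r / 2 \<Longrightarrow> z \<in> sphere 0 r \<Longrightarrow> \<bar>line_zonal1 t x z i a * g z\<bar> \<le> B1"
      using bdd[OF c1] by blast
    obtain B2 where B2: "\<And>a z. \<bar>a\<bar> \<le> r / 2 \<Longrightarrow> z \<in> sphere 0 r \<Longrightarrow> \<bar>line_zonal2 t x z i a * g z\<bar> \<le> B2"
      using bdd[OF c2] by blast
    have der1: "((\<lambda>a. \<integral>z. zonal m r (line_sq r x z i a) t * g z \<partial>N) has_real_derivative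
        (\<integral>z. line_zonal1 t x z i b * g z \<partial>N)) (at b)" if b: "\<bar>b\<bar> < r / 2" for b
    proof (rule has_derivative_parametric_integral[OF N(1), where \<delta> = "r / 2 - \<bar>b\<bar>" and B = B1])
      fix a assume "\<bar>a - b\<bar> < r / 2 - \<bar>b\<bar>"
      then have a: "\<bar>a\<bar> \<le> r / 2" "\<bar>a\<bar> < r" by linarith+
      show "integrable N (\<lambda>z. zonal m r (line_sq r x z i a) t * g z)"
        by (intro sphere_integrable[OF N] slice[OF c0 a(1)])
      fix z assume "z \<in> space N"
      then have z: "z \<in> sphere 0 r" by (simp add: sp)
      show "((\<lambda>a. zonal m r (line_sq r x z i a) t * g z) has_real_derivative line_zonal1 t x z i a * g z) (at a)"
        by (intro DERIV_cmult_right line_zonal_deriv t nx a)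
      show "\<bar>line_zonal1 t x z i a * g z\<bar> \<le> B1" by (rule B1[OF a(1) z])
    qed (use b in simp)
    have der2: "((\<lambda>a. \<integral>z. line_zonal1 t x z i a * g z \<partial>N) has_real_derivative d2 i) (at 0)"
      unfolding d2_def
    proof (rule has_derivative_parametric_integral[OF N(1), where \<delta> = "r / 2" and B = B2])
      fix a assume "\<bar>a - 0\<bar> < r / 2"
      then have a: "\<bar>a\<bar> \<le> r / 2" "\<bar>a\<bar> < r" by linarith+
      show "integrable N (\<lambda>z. line_zonal1 t x z i a * g z)"
        by (intro sphere_integrable[OF N] slice[OF c1 a(1)])
      fix z assume "z \<in> space N"
      then have z: "z \<in> sphere 0 r" by (simp add: sp)
      show "((\<lambda>a. line_zonal1 t x z i a * g z) has_real_derivative line_zonal2 t x z i a * g z) (at a)"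
        by (intro DERIV_cmult_right line_zonal_deriv t nx a)
      show "\<bar>line_zonal2 t x z i a * g z\<bar> \<le> B2" by (rule B2[OF a(1) z])
    qed (use r in simp)
    show "integrable N (\<lambda>z. line_zonal2 t x z i 0 * g z)"
      by (intro sphere_integrable[OF N] slice[OF c2]) (use r in simp)
    have avg: "zonal_avg N g ((r / norm (x + a *\<^sub>R axis i 1)) *\<^sub>R (x + a *\<^sub>R axis i 1)) t =
        (\<integral>z. zonal m r (line_sq r x z i a) t * g z \<partial>N)" if "\<bar>a\<bar> < r" for a
      unfolding zonal_avg_def line_sq_eq[OF nx that] ..
    have "((\<lambda>a. zonal_avg N g ((r / norm (x + a *\<^sub>R axis i 1)) *\<^sub>R (x + a *\<^sub>R axis i 1)) t) has_real_derivative
        (\<integral>z. line_zonal1 t x z i b * g z \<partial>N)) (at b)" if b: "\<bar>b\<bar> < r / 2" for b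
    proof (rule has_field_derivative_transform_within_open[OF der1[OF b], where S = "ball 0 (r / 2)"])
      show "b \<in> ball 0 (r / 2)" using b by simp
      show "(\<integral>z. zonal m r (line_sq r x z i a) t * g z \<partial>N) =
          zonal_avg N g ((r / norm (x + a *\<^sub>R axis i 1)) *\<^sub>R (x + a *\<^sub>R axis i 1)) t" if "a \<in> ball 0 (r / 2)" for a
        using that r by (intro avg[symmetric]) auto
    qed simp
    moreover have "\<forall>\<^sub>F b::real in nhds 0. \<bar>b\<bar> < r / 2"
      using r by (auto simp: eventually_nhds_metric dist_real_def intro!: exI[of _ "r / 2"])
    ultimately have "\<forall>\<^sub>F b in nhds 0. ((\<lambda>a. zonal_avg N g ((r / norm (x + a *\<^sub>R axis i 1)) *\<^sub>R (x + a *\<^sub>R axis i 1)) t) has_real_derivative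
        (\<integral>z. line_zonal1 t x z i b * g z \<partial>N)) (at b)"
      by (auto elim: eventually_mono)
    with der2 show "has_second_deriv (\<lambda>a. zonal_avg N g ((r / norm (x + a *\<^sub>R axis i 1)) *\<^sub>R (x + a *\<^sub>R axis i 1)) t) 0 (d2 i)"
      unfolding has_second_deriv_def
      by (intro exI[of _ "\<lambda>b. \<integral>z. line_zonal1 t x z i b * g z \<partial>N"] conjI)
  qed
  have "(\<Sum>i\<in>UNIV. d2 i) = (\<integral>z. (\<Sum>i\<in>UNIV. line_zonal2 t x z i 0 * g z) \<partial>N)"
    unfolding d2_def by (rule Bochner_Integration.integral_sum[symmetric]) (rule d2_int)
  also have "\<dots> = (\<integral>z. 2 * (zonal_dt m r ((x \<bullet> z / r\<^sup>2)\<^sup>2) t * g z) \<partial>N)"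
    by (rule Bochner_Integration.integral_cong[OF refl])
       (simp add: sp line_zonal_laplacian[OF card x] flip: sum_distrib_right)
  also have "\<dots> = 2 * dt" by (simp add: dt_def)
  finally have "dt = (1/2) * (\<Sum>i\<in>UNIV. d2 i)" by simp
  with dt d2 show "\<exists>dt d2. ((\<lambda>s. zonal_avg N g x s) has_real_derivative dt) (at t) \<and>
      (\<forall>i. has_second_deriv (\<lambda>a. zonal_avg N g ((r / norm (x + a *\<^sub>R axis i 1)) *\<^sub>R (x + a *\<^sub>R axis i 1)) t) 0 (d2 i)) \<and>
      dt = (1/2) * (\<Sum>i\<in>UNIV. d2 i)" by blast
qed

end

section \<open>The heat kernel of projective space\<close>

text \<open>The \<open>itself\<close> argument names the ambient space, on which the value
  depends.\<close>

definition rp_volume :: "nat \<Rightarrow> real \<Rightarrow> 'n::finite itself \<Rightarrow> real" where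
  "rp_volume m r _ = rp_int m r (\<lambda>_::real^'n. 1)"

text \<open>Dividing by the volume passes from normalized measure to \<open>rp_int\<close>. The
  value 0 elsewhere is the one prescribed by \<open>min_heat_kernel\<close>, which makes the
  description in \<open>heat_kernel\<close> single out one function.\<close>

definition rp_heat_kernel :: "nat \<Rightarrow> real \<Rightarrow> real^'n \<Rightarrow> real^'n \<Rightarrow> real \<Rightarrow> real" where
  "rp_heat_kernel m r x y t =
    (if x \<in> sphere 0 r \<and> y \<in> sphere 0 r \<and> 0 < t
     then zonal m r ((x \<bullet> y / r\<^sup>2)\<^sup>2) t / rp_volume m r TYPE('n) else 0)"

lemma pair_measurable_continuous:
  fixes f :: "(real^'n) \<times> (real^'n) \<Rightarrow> real"
  assumes f: "continuous_on (sphere 0 r \<times> sphere 0 r) f"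
  shows "f \<in> borel_measurable (sph_measure r \<Otimes>\<^sub>M sph_measure r)"
proof -
  let ?N = "sph_measure r :: (real^'n) measure" and ?S = "sphere (0::real^'n) r"
  have id: "(\<lambda>x. x) \<in> ?N \<rightarrow>\<^sub>M borel"
    unfolding measurable_cong_sets[OF sets_sph_measure refl] by (rule measurable_restrict_space1) simp
  have fst: "fst \<in> ?N \<Otimes>\<^sub>M ?N \<rightarrow>\<^sub>M borel" and snd: "snd \<in> ?N \<Otimes>\<^sub>M ?N \<rightarrow>\<^sub>M borel"
    by (rule measurable_compose[OF measurable_fst id], rule measurable_compose[OF measurable_snd id])
  have "(\<lambda>p. (fst p, snd p)) \<in> ?N \<Otimes>\<^sub>M ?N \<rightarrow>\<^sub>M borel \<Otimes>\<^sub>M borel"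
    using fst snd by (rule measurable_Pair)
  then have id2: "(\<lambda>p. p) \<in> ?N \<Otimes>\<^sub>M ?N \<rightarrow>\<^sub>M borel" by (simp add: borel_prod)
  have "(\<lambda>p. indicator (?S \<times> ?S) p *\<^sub>R f p) \<in> borel_measurable borel"
    using f by (intro borel_measurable_continuous_on_indicator) (simp add: borel_closed closed_Times)
  from measurable_compose[OF id2 this] show ?thesis
    by (rule measurable_cong[THEN iffD1, rotated]) (auto simp: space_pair_measure)
qed

context sphere_heat
begin

lemma rp_volume_pos: "0 < rp_volume m r TYPE('n::finite)"
proof -
  have P: "prob_space (sph_measure r :: (real^'n) measure)" by (rule prob_space_sph_measure[OF r])
  show ?thesis
    unfolding rp_volume_def
    by (subst rp_integral(2)[OF r, where B = 1])
       (use content_ball_pos[OF r, of "0::real^'n"] r prob_space.prob_space[OF P] in auto)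
qed

lemma rp_int_eq:
  fixes f :: "real^'n \<Rightarrow> real"
  assumes "continuous_on (sphere 0 r) f"
  shows "rp_integrable m r f" "rp_int m r f = rp_volume m r TYPE('n) * (\<integral>z. f z \<partial>sph_measure r)"
proof -
  have P: "prob_space (sph_measure r :: (real^'n) measure)" by (rule prob_space_sph_measure[OF r])
  obtain B where B: "\<And>z. z \<in> sphere 0 r \<Longrightarrow> \<bar>f z\<bar> \<le> B"
    using continuous_on_compact_bounded[OF compact_sphere assms] by blast
  note * = rp_integral[OF r sph_measurable_continuous[OF assms] B]
  show "rp_integrable m r f" by (rule *)
  have "rp_volume m r TYPE('n) = (1/2) * ((real m + 1) / r) * measure lborel (ball (0::real^'n) r)"
    unfolding rp_volume_def
    by (subst rp_integral(2)[OF r, where B = 1]) (use prob_space.prob_space[OF P] in auto)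
  then show "rp_int m r f = rp_volume m r TYPE('n) * (\<integral>z. f z \<partial>sph_measure r)"
    using *(2) by simp
qed

section \<open>Unit mass and concentration of the kernel\<close>

lemma zonal_kernel_cont:
  fixes x :: "real^'n"
  shows "0 < t \<Longrightarrow> continuous_on A (\<lambda>z. zonal m r ((x \<bullet> z / r\<^sup>2)\<^sup>2) t)"
  using r by (intro continuous_on_compose2[OF zonal_cont_v[of t UNIV]] continuous_intros) auto

text \<open>The spherical mean of \<open>v ^ n\<close> is \<open>1 / w n\<close>, so integrating the
  series termwise cancels the weights. The case \<open>k = 0\<close> yields the total mass and
  \<open>k = 1\<close> the concentration.\<close>

lemma zonal_integral_power:
  fixes x :: "real^'n"
  assumes card: "CARD('n) = m + 1" and x: "x \<in> sphere 0 r" and t: "0 < t"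
  shows "(\<lambda>j. \<pi> j t * (w j / w (j + k))) sums
    (\<integral>z. zonal m r ((x \<bullet> z / r\<^sup>2)\<^sup>2) t * ((x \<bullet> z / r\<^sup>2)\<^sup>2) ^ k \<partial>sph_measure r)"
proof -
  let ?v = "\<lambda>z. (x \<bullet> z / r\<^sup>2)\<^sup>2"
  have mom: "(\<integral>z. ?v z ^ n \<partial>sph_measure r) = 1 / w n" for n
  proof -
    have "?v z ^ n = (x \<bullet> z) ^ (2 * n) / (r ^ (2 * n) * r ^ (2 * n))" for z
    proof -
      have "?v z ^ n = (x \<bullet> z) ^ (2 * n) / (r\<^sup>2) ^ (2 * n)"
        by (simp only: power_mult[of _ 2 n] power_divide)
      also have "(r\<^sup>2) ^ (2 * n) = r ^ (2 * n) * r ^ (2 * n)"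
        by (simp only: power2_eq_square power_mult_distrib)
      finally show ?thesis .
    qed
    then have "(\<integral>z. ?v z ^ n \<partial>sph_measure r) = (\<integral>z. (x \<bullet> z) ^ (2 * n) \<partial>sph_measure r) / (r ^ (2 * n) * r ^ (2 * n))"
      by simp
    also have "\<dots> = 1 / w n"
      unfolding sph_moment[OF r card] using x r by simp
    finally show ?thesis .
  qed
  define f where "f j z = c t j * ?v z ^ (j + k)" for j z
  have int_f: "(\<integral>z. f j z \<partial>sph_measure r) = \<pi> j t * (w j / w (j + k))" for j
    unfolding f_def by (simp add: mom zonal_coeff_def)
  have f0: "0 \<le> f j z" for j z unfolding f_def using c_nonneg[of t j] t by simp
  have w_mono: "w j \<le> w (j + k)" for j
  proof (induction k)
    case (Suc k)
    have "w (j + k) * 1 \<le> w (j + k) * ((2 * real (j + k) + 1 + real m) / (2 * real (j + k) + 1))"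
      by (intro mult_left_mono less_imp_le[OF w_pos]) (simp add: field_simps)
    with Suc show ?case by (simp only: add_Suc_right w_Suc)
  qed simp
  have le: "\<pi> j t * (w j / w (j + k)) \<le> \<pi> j t" for j
    using \<pi>_nonneg[of t j] t w_pos w_mono[of j] by (intro mult_left_le) auto
  have "(\<lambda>j. \<integral>z. f j z \<partial>sph_measure r) sums (\<integral>z. (\<Sum>j. f j z) \<partial>sph_measure r)"
  proof (rule sums_integral)
    show "integrable (sph_measure r) (f j)" for j
      unfolding f_def[abs_def] using r by (intro sph_integrable continuous_intros) auto
    show "AE z in sph_measure r. summable (\<lambda>j. norm (f j z))"
    proof (intro AE_I2)
      fix z
      have "summable (\<lambda>j. (c t j * ?v z ^ j) * ?v z ^ k)"
        by (intro summable_mult2 summable_c t)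
      then show "summable (\<lambda>j. norm (f j z))"
        using f0 by (simp add: f_def power_add mult.assoc)
    qed
    show "summable (\<lambda>j. \<integral>z. norm (f j z) \<partial>sph_measure r)"
      using f0 int_f le \<pi>_nonneg[of t] t w_pos[THEN less_imp_le]
      by (intro summable_comparison_test'[OF sums_summable[OF \<pi>_sums[OF t]]]) auto
  qed
  moreover have "(\<Sum>j. f j z) = zonal m r (?v z) t * ?v z ^ k" for z
    unfolding f_def zonal_def power_add mult.assoc[symmetric]
    by (rule suminf_mult2[symmetric]) (rule summable_c[OF t])
  ultimately show ?thesis by (simp add: int_f)
qed

lemma zonal_mass:
  fixes x :: "real^'n"
  assumes "CARD('n) = m + 1" "x \<in> sphere 0 r" "0 < t"
  shows "(\<integral>z. zonal m r ((x \<bullet> z / r\<^sup>2)\<^sup>2) t \<partial>sph_measure r) = 1"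
proof -
  have "w j \<noteq> 0" for j using w_pos[of j] by simp
  then have "(\<lambda>j. \<pi> j t) sums (\<integral>z. zonal m r ((x \<bullet> z / r\<^sup>2)\<^sup>2) t \<partial>sph_measure r)"
    using zonal_integral_power[OF assms, of 0] by simp
  then show ?thesis using \<pi>_sums[OF assms(3)] by (rule sums_unique2)
qed

lemma zonal_concentration:
  fixes x :: "real^'n"
  assumes "CARD('n) = m + 1" "x \<in> sphere 0 r" "0 < t"
  shows "(\<integral>z. zonal m r ((x \<bullet> z / r\<^sup>2)\<^sup>2) t * (1 - (x \<bullet> z / r\<^sup>2)\<^sup>2) \<partial>sph_measure r) =
    (\<Sum>j. \<pi> j t * (real m / (2 * real j + 1 + real m)))"
proof -
  let ?z = "\<lambda>z. zonal m r ((x \<bullet> z / r\<^sup>2)\<^sup>2) t" and ?v = "\<lambda>z. (x \<bullet> z / r\<^sup>2)\<^sup>2"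
  have w_ratio: "w j / w (j + 1) = (2 * real j + 1) / (2 * real j + 1 + real m)" for j
    using w_pos[of j] by (simp add: w_Suc)
  have one: "1 - (2 * real j + 1) / (2 * real j + 1 + real m) = real m / (2 * real j + 1 + real m)" for j
  proof -
    have "2 * real j + 1 + real m \<noteq> 0" by linarith
    then show ?thesis by (simp add: field_simps)
  qed
  have "(\<lambda>j. \<pi> j t - \<pi> j t * (w j / w (j + 1))) sums (1 - (\<integral>z. ?z z * ?v z ^ 1 \<partial>sph_measure r))"
    by (intro sums_diff \<pi>_sums zonal_integral_power assms)
  moreover have "\<pi> j t - \<pi> j t * (w j / w (j + 1)) = \<pi> j t * (real m / (2 * real j + 1 + real m))" for j
    unfolding w_ratio one[symmetric] by (simp add: right_diff_distrib)
  moreover have "1 - (\<integral>z. ?z z * ?v z ^ 1 \<partial>sph_measure r) = (\<integral>z. ?z z \<partial>sph_measure r) - (\<integral>z. ?z z * ?v z \<partial>sph_measure r)"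
    by (simp add: zonal_mass[OF assms])
  moreover have "\<dots> = (\<integral>z. ?z z * (1 - ?v z) \<partial>sph_measure r)"
    unfolding right_diff_distrib mult_1_right
    using r assms(3)
    by (intro Bochner_Integration.integral_diff[symmetric] sph_integrable zonal_kernel_cont continuous_intros) auto
  ultimately have "(\<lambda>j. \<pi> j t * (real m / (2 * real j + 1 + real m))) sums (\<integral>z. ?z z * (1 - ?v z) \<partial>sph_measure r)"
    by (simp only:)
  then show ?thesis by (rule sums_unique)
qed

lemma sq_eq_1_iff:
  fixes x z :: "real^'n"
  assumes "x \<in> sphere 0 r" "z \<in> sphere 0 r" "(x \<bullet> z / r\<^sup>2)\<^sup>2 = 1"
  shows "z = x \<or> z = - x"
proof -
  have xx: "x \<bullet> x = r\<^sup>2" "z \<bullet> z = r\<^sup>2" using assms by (simp_all add: dot_square_norm)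
  have "x \<bullet> z / r\<^sup>2 = 1 \<or> x \<bullet> z / r\<^sup>2 = -1" using assms(3) by (simp add: power2_eq_1_iff)
  then have "x \<bullet> z = r\<^sup>2 \<or> x \<bullet> z = - r\<^sup>2" using r by (auto simp: field_simps)
  then have "(z - x) \<bullet> (z - x) = 0 \<or> (z + x) \<bullet> (z + x) = 0"
    using xx by (auto simp: inner_diff_left inner_diff_right inner_add_left inner_add_right inner_commute)
  then show ?thesis by (auto simp: eq_neg_iff_add_eq_0)
qed

text \<open>\<open>1 - v\<close> vanishes only for \<open>z = x\<close> and \<open>z = - x\<close>,
  where an even function takes the value \<open>g x\<close>. On the compact set of pairs with a
  deviation of at least \<open>e\<close> it is thus bounded below by some positive \<open>k\<close>,
  and there \<open>2 * B / k\<close> times it exceeds any possible deviation.\<close>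

lemma even_modulus:
  fixes g :: "real^'n \<Rightarrow> real"
  assumes g: "continuous_on (sphere 0 r) g" and even: "\<And>z. z \<in> sphere 0 r \<Longrightarrow> g (- z) = g z" and e: "0 < e"
  obtains C where "0 \<le> C"
    "\<And>x z. x \<in> sphere 0 r \<Longrightarrow> z \<in> sphere 0 r \<Longrightarrow> \<bar>g z - g x\<bar> \<le> e + C * (1 - (x \<bullet> z / r\<^sup>2)\<^sup>2)"
proof -
  let ?SS = "sphere (0::real^'n) r \<times> sphere 0 r"
  obtain B where B: "0 \<le> B" "\<And>z. z \<in> sphere 0 r \<Longrightarrow> \<bar>g z\<bar> \<le> B"
    using continuous_on_compact_bounded[OF compact_sphere g] by blast
  define D where "D p = \<bar>g (snd p) - g (fst p)\<bar>" for p
  define u where "u p = 1 - ((fst p \<bullet> snd p) / r\<^sup>2)\<^sup>2" for p :: "(real^'n) \<times> (real^'n)"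
  have cD: "continuous_on ?SS D"
    unfolding D_def[abs_def]
    by (intro continuous_intros continuous_on_compose2[OF g]) auto
  define A where "A = {p \<in> ?SS. e \<le> D p}"
  have "compact A"
  proof -
    have "A = ?SS \<inter> D -` {e..}" by (auto simp: A_def)
    moreover have "closed (?SS \<inter> D -` {e..})"
      by (intro continuous_closed_preimage cD closed_Times) auto
    ultimately show ?thesis
      by (metis compact_Int_closed compact_Times compact_sphere inf.left_idem)
  qed
  have u: "continuous_on A u" unfolding u_def[abs_def] using r by (intro continuous_intros) auto
  have main: "D p \<le> e + 2 * B / k * u p" if k: "0 < k" "\<And>q. q \<in> A \<Longrightarrow> k \<le> u q" and p: "p \<in> ?SS" for k p
  proof (cases "p \<in> A")
    case True
    have "D p \<le> 2 * B" using B(2)[of "fst p"] B(2)[of "snd p"] p unfolding D_def by (auto simp: mem_Times_iff)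
    also have "\<dots> = 2 * B / k * k" using k by simp
    also have "\<dots> \<le> 2 * B / k * u p" using k True B(1) by (intro mult_left_mono) auto
    finally show ?thesis using e by simp
  next
    case False
    have "0 \<le> u p" using sq_le_1[of "fst p" "snd p"] p by (auto simp: u_def mem_Times_iff)
    then have "0 \<le> 2 * B / k * u p" using B(1) k(1) by simp
    then show ?thesis using False p by (auto simp: A_def)
  qed
  have "\<exists>k>0. \<forall>q\<in>A. k \<le> u q"
  proof (cases "A = {}")
    case True
    then show ?thesis by (auto intro: exI[of _ 1])
  next
    case False
    obtain q0 where q0: "q0 \<in> A" "\<forall>q\<in>A. u q0 \<le> u q"
      using continuous_attains_inf[OF \<open>compact A\<close> False u] by blast
    have s: "fst q0 \<in> sphere 0 r" "snd q0 \<in> sphere 0 r" and D0: "e \<le> D q0"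
      using q0(1) by (auto simp: A_def mem_Times_iff)
    have "u q0 \<noteq> 0"
    proof
      assume "u q0 = 0"
      then have "snd q0 = fst q0 \<or> snd q0 = - fst q0"
        by (intro sq_eq_1_iff s) (simp add: u_def)
      then show False using D0 e even[OF s(1)] by (auto simp: D_def)
    qed
    moreover have "0 \<le> u q0" using sq_le_1[OF s] by (simp add: u_def)
    ultimately show ?thesis using q0(2) by (intro exI[of _ "u q0"]) auto
  qed
  then obtain k where k: "0 < k" "\<And>q. q \<in> A \<Longrightarrow> k \<le> u q" by blast
  show ?thesis
  proof (rule that[of "2 * B / k"])
    show "0 \<le> 2 * B / k" using B(1) k(1) by simp
    show "\<bar>g z - g x\<bar> \<le> e + 2 * B / k * (1 - (x \<bullet> z / r\<^sup>2)\<^sup>2)"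
      if "x \<in> sphere 0 r" "z \<in> sphere 0 r" for x z
      using main[OF k, of "(x, z)"] that by (simp add: D_def u_def)
  qed
qed

text \<open>Integrate \<open>even_modulus\<close> against the kernel: the unit mass contributes
  \<open>e / 2\<close>, and the kernel mean of \<open>1 - v\<close> is small. Neither depends on
  \<open>x\<close>, so convergence is uniform, as the maximum principle requires.\<close>

lemma zonal_avg_initial:
  fixes g :: "real^'n \<Rightarrow> real"
  assumes card: "CARD('n) = m + 1"
    and g: "continuous_on (sphere 0 r) g" and even: "\<And>z. z \<in> sphere 0 r \<Longrightarrow> g (- z) = g z" and e: "0 < e"
  shows "\<exists>\<delta>>0. \<forall>t. 0 < t \<and> t < \<delta> \<longrightarrow> (\<forall>x\<in>sphere 0 r. \<bar>zonal_avg (sph_measure r) g x t - g x\<bar> \<le> e)"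
proof -
  obtain C where C: "0 \<le> C"
    "\<And>x z. x \<in> sphere 0 r \<Longrightarrow> z \<in> sphere 0 r \<Longrightarrow> \<bar>g z - g x\<bar> \<le> e / 2 + C * (1 - (x \<bullet> z / r\<^sup>2)\<^sup>2)"
    using even_modulus[OF g even, of "e / 2"] e by (metis half_gt_zero)
  let ?E = "\<lambda>t. \<Sum>j. \<pi> j t * (real m / (2 * real j + 1 + real m))"
  have "((\<lambda>t. C * ?E t) \<longlongrightarrow> C * 0) (at_right 0)"
    by (intro tendsto_intros small_time_concentration)
  then have "\<forall>\<^sub>F t in at_right 0. C * ?E t < e / 2"
    using e by (intro order_tendstoD(2)) auto
  then obtain \<delta> where \<delta>: "0 < \<delta>" "\<And>t. 0 < t \<Longrightarrow> t < \<delta> \<Longrightarrow> C * ?E t < e / 2"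
    unfolding eventually_at_right_field by auto
  have "\<bar>zonal_avg (sph_measure r) g x t - g x\<bar> \<le> e" if t: "0 < t" "t < \<delta>" and x: "x \<in> sphere 0 r" for t x
  proof -
    let ?N = "sph_measure r :: (real^'n) measure"
    let ?z = "\<lambda>z. zonal m r ((x \<bullet> z / r\<^sup>2)\<^sup>2) t" and ?v = "\<lambda>z. (x \<bullet> z / r\<^sup>2)\<^sup>2"
    note cont = zonal_kernel_cont[OF t(1)] g
    have i: "integrable ?N (\<lambda>z. ?z z * g z)" "integrable ?N (\<lambda>z. ?z z * g x)" "integrable ?N ?z"
      "integrable ?N (\<lambda>z. ?z z * (1 - ?v z))" "integrable ?N (\<lambda>z. ?z z * (g z - g x))"
      using r by (intro sph_integrable continuous_intros cont; simp)+
    have "zonal_avg ?N g x t - g x = (\<integral>z. ?z z * (g z - g x) \<partial>?N)"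
      using i zonal_mass[OF card x t(1)] by (simp add: zonal_avg_def right_diff_distrib)
    also have "\<bar>\<dots>\<bar> \<le> (\<integral>z. \<bar>?z z * (g z - g x)\<bar> \<partial>?N)"
      by (rule integral_abs_bound)
    also have "\<dots> \<le> (\<integral>z. e / 2 * ?z z + C * (?z z * (1 - ?v z)) \<partial>?N)"
    proof (rule integral_mono)
      fix z assume "z \<in> space ?N"
      then have z: "z \<in> sphere 0 r" by simp
      have "0 < ?z z" using zonal_pos t(1) by simp
      then have "\<bar>?z z * (g z - g x)\<bar> \<le> ?z z * (e / 2 + C * (1 - ?v z))"
        unfolding abs_mult using C(2)[OF x z] by (intro mult_mono) auto
      then show "\<bar>?z z * (g z - g x)\<bar> \<le> e / 2 * ?z z + C * (?z z * (1 - ?v z))"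
        by (simp add: algebra_simps)
    qed (use i in auto)
    also have "\<dots> = e / 2 + C * ?E t"
      using i zonal_mass[OF card x t(1)] zonal_concentration[OF card x t(1)] by simp
    also have "\<dots> \<le> e" using \<delta>(2)[OF t] by simp
    finally show ?thesis .
  qed
  with \<delta>(1) show ?thesis by blast
qed

lemma zonal_kernel_cont3:
  "continuous_on (sphere 0 r \<times> sphere 0 r \<times> {0<..}) (\<lambda>(x, y, t). zonal m r (((x::real^'n) \<bullet> y / r\<^sup>2)\<^sup>2) t)"
proof -
  have "continuous_on (sphere 0 r \<times> sphere 0 r \<times> {0<..})
      (\<lambda>p. (\<lambda>(v, t). zonal m r v t) (((fst p::real^'n) \<bullet> fst (snd p) / r\<^sup>2)\<^sup>2, snd (snd p)))"
  proof (rule continuous_on_compose2[OF zonal_cont])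
    show "continuous_on (sphere 0 r \<times> sphere 0 r \<times> {0<..})
        (\<lambda>p. (((fst p::real^'n) \<bullet> fst (snd p) / r\<^sup>2)\<^sup>2, snd (snd p)))"
      using r by (intro continuous_intros) auto
    show "(\<lambda>p. (((fst p::real^'n) \<bullet> fst (snd p) / r\<^sup>2)\<^sup>2, snd (snd p))) ` (sphere 0 r \<times> sphere 0 r \<times> {0::real<..}) \<subseteq> {0..1} \<times> {0<..}"
    proof -
      have "((fst p \<bullet> fst (snd p) / r\<^sup>2)\<^sup>2, snd (snd p)) \<in> {0..1} \<times> {0<..}"
        if "p \<in> sphere 0 r \<times> sphere 0 r \<times> {0<..}" for p :: "(real^'n) \<times> (real^'n) \<times> real"
        using that sq_le_1[of "fst p" "fst (snd p)"]
        by (simp only: mem_Times_iff atLeastAtMost_iff fst_conv snd_conv)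
      then show ?thesis by blast
    qed
  qed
  then show ?thesis by (simp add: case_prod_unfold)
qed

lemma zonal_avg_cont:
  fixes g :: "real^'n \<Rightarrow> real"
  assumes g: "continuous_on (sphere 0 r) g"
  shows "continuous_on (sphere 0 r \<times> {0<..}) (\<lambda>(x, t). zonal_avg (sph_measure r) g x t)"
  unfolding continuous_on_sequentially
proof (intro allI ballI impI)
  fix X and p :: "(real^'n) \<times> real"
  assume p: "p \<in> sphere 0 r \<times> {0<..}" and "(\<forall>n. X n \<in> sphere 0 r \<times> {0<..}) \<and> X \<longlonglongrightarrow> p"
  then have X: "\<And>n. X n \<in> sphere 0 r \<times> {0<..}" "X \<longlonglongrightarrow> p" by auto
  let ?N = "sph_measure r :: (real^'n) measure"
  interpret N: prob_space ?N by (rule prob_space_sph_measure[OF r])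
  have lim1: "(\<lambda>n. fst (X n)) \<longlonglongrightarrow> fst p" and lim2: "(\<lambda>n. snd (X n)) \<longlonglongrightarrow> snd p"
    using X(2) by (auto intro: tendsto_intros)
  obtain B where B: "0 \<le> B" "\<And>z. z \<in> sphere 0 r \<Longrightarrow> \<bar>g z\<bar> \<le> B"
    using continuous_on_compact_bounded[OF compact_sphere g] by blast
  \<comment> \<open>The kernel is bounded uniformly only for times away from 0; a sequence of
    positive times with a positive limit stays away from 0.\<close>
  have "\<exists>\<tau>>0. \<forall>n. \<tau> \<le> snd (X n)"
  proof -
    have "\<forall>\<^sub>F n in sequentially. snd p / 2 < snd (X n)"
      using lim2 p by (intro order_tendstoD(1)) auto
    then obtain K where K: "\<And>n. K \<le> n \<Longrightarrow> snd p / 2 < snd (X n)" by (auto simp: eventually_sequentially)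
    define \<tau> where "\<tau> = Min (insert (snd p / 2) ((\<lambda>n. snd (X n)) ` {..<K}))"
    have "0 < \<tau>" unfolding \<tau>_def using p X(1) by (subst Min_gr_iff) (auto simp: mem_Times_iff)
    moreover have "\<tau> \<le> snd (X n)" for n
    proof (cases "n < K")
      case True
      then show ?thesis unfolding \<tau>_def by (intro Min_le) auto
    next
      case False
      then have "snd p / 2 < snd (X n)" using K by simp
      moreover have "\<tau> \<le> snd p / 2" unfolding \<tau>_def by (intro Min_le) auto
      ultimately show ?thesis by simp
    qed
    ultimately show ?thesis by blast
  qed
  then obtain \<tau> where \<tau>: "0 < \<tau>" "\<And>n. \<tau> \<le> snd (X n)" by blast
  obtain C where C: "\<And>v t. 0 \<le> v \<Longrightarrow> v \<le> 1 \<Longrightarrow> \<tau> \<le> t \<Longrightarrow> \<bar>zonal m r v t\<bar> \<le> C"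
    using zonal_bounded[OF \<tau>(1)] by blast
  have Xs: "fst (X n) \<in> sphere 0 r" "0 < snd (X n)" for n using X(1)[of n] by (auto simp: mem_Times_iff)
  have ps: "fst p \<in> sphere 0 r" "0 < snd p" using p by (auto simp: mem_Times_iff)
  have "(\<lambda>n. zonal_avg ?N g (fst (X n)) (snd (X n))) \<longlonglongrightarrow> zonal_avg ?N g (fst p) (snd p)"
    unfolding zonal_avg_def
  proof (rule integral_dominated_convergence[where w = "\<lambda>_. C * B"])
    show "(\<lambda>z. zonal m r ((fst p \<bullet> z / r\<^sup>2)\<^sup>2) (snd p) * g z) \<in> borel_measurable ?N"
      by (intro sph_measurable_continuous continuous_on_mult zonal_kernel_cont g ps)
    show "(\<lambda>z. zonal m r ((fst (X n) \<bullet> z / r\<^sup>2)\<^sup>2) (snd (X n)) * g z) \<in> borel_measurable ?N" for n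
      by (intro sph_measurable_continuous continuous_on_mult zonal_kernel_cont g Xs)
    show "AE z in ?N. (\<lambda>n. zonal m r ((fst (X n) \<bullet> z / r\<^sup>2)\<^sup>2) (snd (X n)) * g z) \<longlonglongrightarrow>
        zonal m r ((fst p \<bullet> z / r\<^sup>2)\<^sup>2) (snd p) * g z"
    proof (intro AE_I2 tendsto_mult_right)
      fix z assume "z \<in> space ?N"
      then have z: "z \<in> sphere 0 r" by simp
      have "(\<lambda>n. (\<lambda>(x, y, t). zonal m r (((x::real^'n) \<bullet> y / r\<^sup>2)\<^sup>2) t) (fst (X n), z, snd (X n))) \<longlonglongrightarrow>
          (\<lambda>(x, y, t). zonal m r (((x::real^'n) \<bullet> y / r\<^sup>2)\<^sup>2) t) (fst p, z, snd p)"
        by (rule continuous_on_tendsto_compose[OF zonal_kernel_cont3])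
           (use z Xs ps lim1 lim2 in \<open>auto intro!: tendsto_intros\<close>)
      then show "(\<lambda>n. zonal m r ((fst (X n) \<bullet> z / r\<^sup>2)\<^sup>2) (snd (X n))) \<longlonglongrightarrow> zonal m r ((fst p \<bullet> z / r\<^sup>2)\<^sup>2) (snd p)"
        by simp
    qed
    show "AE z in ?N. norm (zonal m r ((fst (X n) \<bullet> z / r\<^sup>2)\<^sup>2) (snd (X n)) * g z) \<le> C * B" for n
    proof (intro AE_I2)
      fix z assume "z \<in> space ?N"
      then have z: "z \<in> sphere 0 r" by simp
      have c: "\<bar>zonal m r ((fst (X n) \<bullet> z / r\<^sup>2)\<^sup>2) (snd (X n))\<bar> \<le> C"
        by (rule C[OF sq_le_1[OF Xs(1) z] \<tau>(2)])
      then have "0 \<le> C" by (rule order_trans[OF abs_ge_zero])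
      with c show "norm (zonal m r ((fst (X n) \<bullet> z / r\<^sup>2)\<^sup>2) (snd (X n)) * g z) \<le> C * B"
        unfolding real_norm_def abs_mult
        using B(2)[OF z] by (intro mult_mono) auto
    qed
  qed simp
  then show "((\<lambda>(x, t). zonal_avg ?N g x t) \<circ> X) \<longlonglongrightarrow> (\<lambda>(x, t). zonal_avg ?N g x t) p"
    by (simp add: o_def case_prod_unfold)
qed

lemma rp_heat_kernel_int:
  fixes x :: "real^'n"
  assumes "x \<in> sphere 0 r" "0 < t" "continuous_on (sphere 0 r) f"
  shows "rp_integrable m r (\<lambda>y. rp_heat_kernel m r x y t * f y)"
    and "rp_int m r (\<lambda>y. rp_heat_kernel m r x y t * f y) = zonal_avg (sph_measure r) f x t"
proof -
  let ?V = "rp_volume m r TYPE('n)"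
  have V: "0 < ?V" by (rule rp_volume_pos)
  have eq: "rp_heat_kernel m r x y t = zonal m r ((x \<bullet> y / r\<^sup>2)\<^sup>2) t / ?V" if "y \<in> sphere 0 r" for y
    using assms that by (simp add: rp_heat_kernel_def)
  have "continuous_on (sphere 0 r) (\<lambda>y. zonal m r ((x \<bullet> y / r\<^sup>2)\<^sup>2) t / ?V * f y)"
    using V assms by (intro continuous_intros zonal_kernel_cont) auto
  then have cont: "continuous_on (sphere 0 r) (\<lambda>y. rp_heat_kernel m r x y t * f y)"
    by (rule continuous_on_eq) (simp add: eq)
  show "rp_integrable m r (\<lambda>y. rp_heat_kernel m r x y t * f y)" by (rule rp_int_eq[OF cont])
  have "(\<integral>y. rp_heat_kernel m r x y t * f y \<partial>sph_measure r) =
      (\<integral>y. (zonal m r ((x \<bullet> y / r\<^sup>2)\<^sup>2) t * f y) / ?V \<partial>sph_measure r)"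
    by (rule Bochner_Integration.integral_cong) (auto simp: eq)
  then show "rp_int m r (\<lambda>y. rp_heat_kernel m r x y t * f y) = zonal_avg (sph_measure r) f x t"
    unfolding rp_int_eq(2)[OF cont] zonal_avg_def using V by simp
qed

lemma rp_heat_kernel_fund:
  assumes card: "CARD('n) = m + 1"
  shows "heat_fund m r (rp_heat_kernel m r :: real^'n \<Rightarrow> real^'n \<Rightarrow> real \<Rightarrow> real)"
proof -
  let ?V = "rp_volume m r TYPE('n)" and ?K = "rp_heat_kernel m r :: real^'n \<Rightarrow> real^'n \<Rightarrow> real \<Rightarrow> real"
  let ?S = "sphere (0::real^'n) r" and ?N = "sph_measure r :: (real^'n) measure"
  have V: "0 < ?V" by (rule rp_volume_pos)
  have 1: "0 \<le> ?K x y t \<and> ?K (- x) y t = ?K x y t \<and> ?K x (- y) t = ?K x y t"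
    if "x \<in> ?S" "y \<in> ?S" "0 < t" for x y t
    using that V zonal_pos[of "(x \<bullet> y / r\<^sup>2)\<^sup>2" t] by (simp add: rp_heat_kernel_def less_imp_le)
  have "continuous_on (?S \<times> ?S \<times> {0<..}) (\<lambda>p. (\<lambda>(x, y, t). zonal m r ((x \<bullet> y / r\<^sup>2)\<^sup>2) t) p / ?V)"
    using V by (intro continuous_on_divide zonal_kernel_cont3 continuous_intros) auto
  then have 2: "continuous_on (?S \<times> ?S \<times> {0<..}) (\<lambda>(x, y, t). ?K x y t)"
    by (rule continuous_on_eq) (auto simp: rp_heat_kernel_def)
  have 3: "heat_sol r (\<lambda>x t. ?K x y t)" if y: "y \<in> ?S" for y
  proof (rule heat_sol_cong[OF r])
    \<comment> \<open>Averaging a constant against the point mass at \<open>y\<close> reproduces the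
      kernel, so \<open>zonal_avg_heat_sol\<close> applies.\<close>
    let ?R = "return (restrict_space borel ?S) y"
    have sp: "y \<in> space (restrict_space borel ?S)" using y by (simp add: space_restrict_space)
    show "heat_sol r (zonal_avg ?R (\<lambda>_. 1 / ?V))"
      by (intro zonal_avg_heat_sol card) (use prob_space_return[OF sp] in \<open>auto intro: prob_space.finite_measure\<close>)
    show "zonal_avg ?R (\<lambda>_. 1 / ?V) x t = ?K x y t" if "x \<in> ?S" "0 < t" for x t
    proof -
      have "(\<lambda>z. zonal m r ((x \<bullet> z / r\<^sup>2)\<^sup>2) t * (1 / ?V)) \<in> borel_measurable (restrict_space borel ?S)"
        using V by (intro borel_measurable_continuous_on_restrict continuous_intros zonal_kernel_cont that) auto
      then show ?thesis
        unfolding zonal_avg_def by (subst integral_return[OF sp]) (use that y in \<open>auto simp: rp_heat_kernel_def\<close>)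
    qed
  qed
  have 4: "rp_integrable m r (\<lambda>y. ?K x y t) \<and> rp_int m r (\<lambda>y. ?K x y t) = 1" if "x \<in> ?S" "0 < t" for x t
  proof -
    have c1: "continuous_on ?S (\<lambda>_. 1 :: real)" by (intro continuous_intros)
    have "zonal_avg ?N (\<lambda>_. 1) x t = 1"
      using zonal_mass[OF card that] by (simp add: zonal_avg_def)
    then show ?thesis
      using rp_heat_kernel_int[OF that c1] by simp
  qed
  have 5: "((\<lambda>t. rp_int m r (\<lambda>y. ?K x y t * f y)) \<longlongrightarrow> f x) (at_right 0)"
    if f: "continuous_on ?S f" "\<And>y. f (- y) = f y" and x: "x \<in> ?S" for f x
  proof (rule tendstoI)
    fix e :: real assume e: "0 < e"
    obtain \<delta> where \<delta>: "0 < \<delta>" "\<And>t. 0 < t \<Longrightarrow> t < \<delta> \<Longrightarrow> \<bar>zonal_avg ?N f x t - f x\<bar> \<le> e / 2"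
      using zonal_avg_initial[OF card f, of "e / 2"] e x by auto
    show "\<forall>\<^sub>F t in at_right 0. dist (rp_int m r (\<lambda>y. ?K x y t * f y)) (f x) < e"
      unfolding eventually_at_right_field
    proof (intro exI[of _ \<delta>] conjI \<delta>(1) allI impI)
      fix t assume "0 < t" "t < \<delta>"
      then show "dist (rp_int m r (\<lambda>y. ?K x y t * f y)) (f x) < e"
        using \<delta>(2)[of t] e rp_heat_kernel_int(2)[OF x _ f(1), of t] by (simp add: dist_real_def)
    qed
  qed
  show ?thesis
    unfolding heat_fund_def using 1 2 3 4 5 by blast
qed

section \<open>Uniqueness of fundamental solutions\<close>

lemma heat_fund_slices:
  fixes q :: "real^'n \<Rightarrow> real^'n \<Rightarrow> real \<Rightarrow> real"
  assumes "heat_fund m r q"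
  shows "y \<in> sphere 0 r \<Longrightarrow> 0 < s \<Longrightarrow> continuous_on (sphere 0 r) (\<lambda>x. q x y s)"
    and "x \<in> sphere 0 r \<Longrightarrow> 0 < s \<Longrightarrow> continuous_on (sphere 0 r) (\<lambda>y. q x y s)"
    and "0 < s \<Longrightarrow> continuous_on (sphere 0 r \<times> sphere 0 r) (\<lambda>(x, y). q x y s)"
    and "y \<in> sphere 0 r \<Longrightarrow> continuous_on (sphere 0 r \<times> {0<..}) (\<lambda>(x, t). q x y t)"
    and "x \<in> sphere 0 r \<Longrightarrow> continuous_on (sphere 0 r \<times> {0<..}) (\<lambda>(y, t). q x y t)"
proof -
  have c: "continuous_on (sphere 0 r \<times> sphere 0 r \<times> {0<..}) (\<lambda>p. q (fst p) (fst (snd p)) (snd (snd p)))"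
    using assms unfolding heat_fund_def by (simp add: case_prod_unfold)
  note I = continuous_on_Pair continuous_on_id continuous_on_const continuous_on_fst continuous_on_snd
  show "continuous_on (sphere 0 r) (\<lambda>x. q x y s)" if "y \<in> sphere 0 r" "0 < s"
  proof -
    have "(\<lambda>x. (x, y, s)) ` sphere 0 r \<subseteq> sphere 0 r \<times> sphere 0 r \<times> {0<..}" using that by blast
    from continuous_on_compose2[OF c _ this] show ?thesis by (simp add: I)
  qed
  show "continuous_on (sphere 0 r) (\<lambda>y. q x y s)" if "x \<in> sphere 0 r" "0 < s"
  proof -
    have "(\<lambda>y. (x, y, s)) ` sphere 0 r \<subseteq> sphere 0 r \<times> sphere 0 r \<times> {0<..}" using that by blast
    from continuous_on_compose2[OF c _ this] show ?thesis by (simp add: I)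
  qed
  show "continuous_on (sphere 0 r \<times> sphere 0 r) (\<lambda>(x, y). q x y s)" if "0 < s"
  proof -
    have "(\<lambda>p. (fst p, snd p, s)) ` (sphere 0 r \<times> sphere 0 r) \<subseteq> sphere 0 r \<times> sphere 0 r \<times> {0<..}"
      using that by force
    from continuous_on_compose2[OF c _ this] show ?thesis by (simp add: I case_prod_unfold)
  qed
  show "continuous_on (sphere 0 r \<times> {0<..}) (\<lambda>(x, t). q x y t)" if "y \<in> sphere 0 r"
  proof -
    have "(\<lambda>p. (fst p, y, snd p)) ` (sphere 0 r \<times> {0<..}) \<subseteq> sphere 0 r \<times> sphere 0 r \<times> {0<..}"
      using that by force
    from continuous_on_compose2[OF c _ this] show ?thesis by (simp add: I case_prod_unfold)
  qed
  show "continuous_on (sphere 0 r \<times> {0<..}) (\<lambda>(y, t). q x y t)" if "x \<in> sphere 0 r"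
  proof -
    have "(\<lambda>p. (x, fst p, snd p)) ` (sphere 0 r \<times> {0<..}) \<subseteq> sphere 0 r \<times> sphere 0 r \<times> {0<..}"
      using that by force
    from continuous_on_compose2[OF c _ this] show ?thesis by (simp add: I case_prod_unfold)
  qed
qed

text \<open>Both sides solve the heat equation in \<open>(x, t)\<close> with the continuous initial
  value \<open>q z y s\<close>; the shift by \<open>s\<close> keeps \<open>q\<close> away from its
  singularity at time 0. The maximum principle is applied to the difference with either
  sign.\<close>

lemma heat_fund_semigroup:
  fixes q :: "real^'n \<Rightarrow> real^'n \<Rightarrow> real \<Rightarrow> real"
  assumes card: "CARD('n) = m + 1" and q: "heat_fund m r q"
    and x: "x \<in> sphere 0 r" and y: "y \<in> sphere 0 r" and t: "0 < t" and s: "0 < s"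
  shows "q x y (t + s) = zonal_avg (sph_measure r) (\<lambda>z. q z y s) x t"
proof -
  let ?S = "sphere (0::real^'n) r" and ?N = "sph_measure r :: (real^'n) measure"
  define g where "g z = q z y s" for z
  have g: "continuous_on ?S g" unfolding g_def by (rule heat_fund_slices(1)[OF q y s])
  have even: "g (- z) = g z" if "z \<in> ?S" for z
    using q that y s unfolding heat_fund_def g_def by blast
  define A where "A = zonal_avg ?N g"
  define Q where "Q x t = q x y (t + s)" for x t
  have hA: "heat_sol r A"
    unfolding A_def
    by (intro zonal_avg_heat_sol card g prob_space.finite_measure[OF prob_space_sph_measure[OF r]] sets_sph_measure)
  have "heat_sol r (\<lambda>x t. q x y t)" using q y unfolding heat_fund_def by blast
  then have hQ: "heat_sol r Q" unfolding Q_def using s by (intro heat_sol_shift) auto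
  have cA: "continuous_on (?S \<times> {0<..}) (\<lambda>(x, t). A x t)"
    unfolding A_def by (rule zonal_avg_cont[OF g])
  have cq: "continuous_on (?S \<times> {0<..}) (\<lambda>p. q (fst p) y (snd p))"
    using heat_fund_slices(4)[OF q y] by (simp add: case_prod_unfold)
  have cQ: "continuous_on (?S \<times> {0<..}) (\<lambda>(x, t). Q x t)"
  proof -
    have "(\<lambda>p. (fst p, snd p + s)) ` (?S \<times> {0<..}) \<subseteq> ?S \<times> {0<..}" using s by force
    moreover have "continuous_on (?S \<times> {0<..}) (\<lambda>p. (fst p, snd p + s))" by (intro continuous_intros)
    ultimately have "continuous_on (?S \<times> {0<..}) (\<lambda>p. q (fst (fst p, snd p + s)) y (snd (fst p, snd p + s)))"
      by (intro continuous_on_compose2[OF cq])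
    then show ?thesis by (simp add: case_prod_unfold Q_def)
  qed
  have init: "\<exists>\<delta>>0. \<forall>t. 0 < t \<and> t < \<delta> \<longrightarrow> (\<forall>x\<in>?S. \<bar>Q x t - A x t\<bar> \<le> e)" if e: "0 < e" for e
  proof -
    obtain \<delta> where \<delta>: "0 < \<delta>" "\<And>t x. 0 < t \<Longrightarrow> t < \<delta> \<Longrightarrow> x \<in> ?S \<Longrightarrow> \<bar>A x t - g x\<bar> \<le> e / 2"
      using zonal_avg_initial[OF card g even, of "e / 2"] e unfolding A_def by auto
    \<comment> \<open>Makes the initial convergence of the shifted solution uniform in
      \<open>x\<close>.\<close>
    have "uniformly_continuous_on (?S \<times> {s..s + 1}) (\<lambda>p. q (fst p) y (snd p))"
      using s by (intro compact_uniformly_continuous compact_Times continuous_on_subset[OF cq]) auto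
    then obtain \<eta> where \<eta>: "0 < \<eta>" "\<And>p p'. p \<in> ?S \<times> {s..s + 1} \<Longrightarrow> p' \<in> ?S \<times> {s..s + 1} \<Longrightarrow> dist p' p < \<eta>
        \<Longrightarrow> dist (q (fst p') y (snd p')) (q (fst p) y (snd p)) < e / 2"
      unfolding uniformly_continuous_on_def using half_gt_zero[OF e] by metis
    have "\<bar>Q x t - A x t\<bar> \<le> e" if t: "0 < t" "t < min \<delta> (min \<eta> 1)" and x: "x \<in> ?S" for x t
    proof -
      have "dist (x, t + s) (x, s) < \<eta>" using t by (simp add: dist_Pair_Pair dist_real_def)
      then have "dist (q x y (t + s)) (q x y s) < e / 2"
        using \<eta>(2)[of "(x, s)" "(x, t + s)"] x t s by auto
      then have "\<bar>Q x t - g x\<bar> \<le> e / 2" by (simp add: Q_def g_def dist_real_def)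
      moreover have "\<bar>A x t - g x\<bar> \<le> e / 2" using \<delta>(2) t x by auto
      ultimately show ?thesis by linarith
    qed
    then show ?thesis using \<delta>(1) \<eta>(1) by (intro exI[of _ "min \<delta> (min \<eta> 1)"]) auto
  qed
  have "Q x t - A x t \<le> 0"
  proof (rule sphere_max_principle[OF r heat_sol_diff[OF hQ hA] _ _ x t])
    show "continuous_on (?S \<times> {0<..}) (\<lambda>(x, t). Q x t - A x t)"
      using continuous_on_diff[OF cQ cA] by (simp add: case_prod_unfold)
    show "\<exists>\<delta>>0. \<forall>t. 0 < t \<and> t < \<delta> \<longrightarrow> (\<forall>x\<in>?S. Q x t - A x t \<le> e)" if "0 < e" for e
      using init[OF that] by (meson abs_le_iff)
  qed
  moreover have "A x t - Q x t \<le> 0"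
  proof (rule sphere_max_principle[OF r heat_sol_diff[OF hA hQ] _ _ x t])
    show "continuous_on (?S \<times> {0<..}) (\<lambda>(x, t). A x t - Q x t)"
      using continuous_on_diff[OF cA cQ] by (simp add: case_prod_unfold)
    show "\<exists>\<delta>>0. \<forall>t. 0 < t \<and> t < \<delta> \<longrightarrow> (\<forall>x\<in>?S. A x t - Q x t \<le> e)" if "0 < e" for e
      using init[OF that] by (metis abs_le_iff minus_diff_eq)
  qed
  ultimately have "Q x t = A x t" by simp
  then show ?thesis by (simp add: Q_def A_def g_def[abs_def])
qed

text \<open>Pair the semigroup identity with \<open>f\<close> in the variable \<open>y\<close> and
  let \<open>s\<close> tend to 0. The averages of \<open>f\<close> against \<open>q\<close> converge
  pointwise by definition of \<open>heat_fund\<close> and are bounded by the bound of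
  \<open>f\<close>, since \<open>q\<close> is nonnegative of mass one; dominated convergence does
  the rest.\<close>

lemma heat_fund_average:
  fixes q :: "real^'n \<Rightarrow> real^'n \<Rightarrow> real \<Rightarrow> real"
  assumes card: "CARD('n) = m + 1" and q: "heat_fund m r q"
    and f: "continuous_on (sphere 0 r) f" "\<And>y. f (- y) = f y"
    and x: "x \<in> sphere 0 r" and t: "0 < t"
  shows "rp_volume m r TYPE('n) * (\<integral>y. q x y t * f y \<partial>sph_measure r) = zonal_avg (sph_measure r) f x t"
proof -
  let ?S = "sphere (0::real^'n) r" and ?N = "sph_measure r :: (real^'n) measure"
  let ?V = "rp_volume m r TYPE('n)" and ?Z = "\<lambda>z. zonal m r ((x \<bullet> z / r\<^sup>2)\<^sup>2) t"
  have V: "0 < ?V" by (rule rp_volume_pos)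
  interpret N: prob_space ?N by (rule prob_space_sph_measure[OF r])
  interpret NN: pair_prob_space ?N ?N ..
  define Q where "Q z s = ?V * (\<integral>y. q z y s * f y \<partial>?N)" for z s
  obtain F where F: "0 \<le> F" "\<And>z. z \<in> ?S \<Longrightarrow> \<bar>f z\<bar> \<le> F"
    using continuous_on_compact_bounded[OF compact_sphere f(1)] by blast
  have qf: "continuous_on ?S (\<lambda>y. q z y s * f y)" if "z \<in> ?S" "0 < s" for z s
    by (intro continuous_on_mult f heat_fund_slices(2)[OF q] that)
  have Q_rp: "Q z s = rp_int m r (\<lambda>y. q z y s * f y)" if "z \<in> ?S" "0 < s" for z s
    unfolding Q_def by (rule rp_int_eq(2)[OF qf[OF that], symmetric])
  have Q_bound: "\<bar>Q z s\<bar> \<le> F" if z: "z \<in> ?S" and s: "0 < s" for z s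
  proof -
    note cz = heat_fund_slices(2)[OF q z s]
    have q0: "0 \<le> q z y s" if "y \<in> ?S" for y using q z s that unfolding heat_fund_def by blast
    have "rp_int m r (\<lambda>y. q z y s) = 1" using q z s unfolding heat_fund_def by blast
    then have one: "?V * (\<integral>y. q z y s \<partial>?N) = 1" using rp_int_eq(2)[OF cz] by simp
    have "\<bar>\<integral>y. q z y s * f y \<partial>?N\<bar> \<le> (\<integral>y. \<bar>q z y s * f y\<bar> \<partial>?N)" by (rule integral_abs_bound)
    also have "\<dots> \<le> (\<integral>y. q z y s * F \<partial>?N)"
    proof (rule integral_mono)
      show "integrable ?N (\<lambda>y. \<bar>q z y s * f y\<bar>)"
        by (rule sph_integrable[OF r continuous_on_rabs[OF qf[OF z s]]])
      show "integrable ?N (\<lambda>y. q z y s * F)"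
        by (rule sph_integrable[OF r continuous_on_mult_right[OF cz]])
      fix y assume "y \<in> space ?N"
      then have "y \<in> ?S" by simp
      then show "\<bar>q z y s * f y\<bar> \<le> q z y s * F"
        using q0 F(2) by (simp add: abs_mult mult_left_mono)
    qed
    finally have "?V * \<bar>\<integral>y. q z y s * f y \<partial>?N\<bar> \<le> ?V * ((\<integral>y. q z y s \<partial>?N) * F)"
      using V by simp
    also have "\<dots> = F" using one by (simp add: mult.assoc[symmetric])
    finally show ?thesis using V by (simp add: Q_def abs_mult)
  qed
  have meas2: "(\<lambda>(z, y). q z y s * f y) \<in> borel_measurable (?N \<Otimes>\<^sub>M ?N)" if s: "0 < s" for s
  proof -
    have "continuous_on (?S \<times> ?S) (\<lambda>p. (\<lambda>(x, y). q x y s) p * f (snd p))"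
      by (intro continuous_on_mult heat_fund_slices(3)[OF q s] continuous_on_compose2[OF f(1)] continuous_intros) auto
    from pair_measurable_continuous[OF this] show ?thesis by (simp add: case_prod_unfold)
  qed
  have Q_meas: "(\<lambda>z. Q z s) \<in> borel_measurable ?N" if s: "0 < s" for s
    unfolding Q_def
    by (intro borel_measurable_times borel_measurable_const N.borel_measurable_lebesgue_integral meas2 s)
  have semi: "Q x (t + s) = (\<integral>z. ?Z z * Q z s \<partial>?N)" if s: "0 < s" for s
  proof -
    have Zc: "continuous_on ?S ?Z" by (rule zonal_kernel_cont[OF t])
    have cont: "continuous_on (?S \<times> ?S) (\<lambda>p. ?Z (snd p) * q (snd p) (fst p) s * f (fst p))"
    proof (intro continuous_on_mult)
      show "continuous_on (?S \<times> ?S) (\<lambda>p. ?Z (snd p))" by (rule continuous_on_compose2[OF Zc]) (auto intro: continuous_intros)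
      show "continuous_on (?S \<times> ?S) (\<lambda>p. f (fst p))" by (rule continuous_on_compose2[OF f(1)]) (auto intro: continuous_intros)
      have c: "continuous_on (?S \<times> ?S) (\<lambda>p. q (fst p) (snd p) s)"
        using heat_fund_slices(3)[OF q s] by (simp add: case_prod_unfold)
      show "continuous_on (?S \<times> ?S) (\<lambda>p. q (snd p) (fst p) s)"
      proof -
        have "(\<lambda>p. (snd p, fst p)) ` (?S \<times> ?S) \<subseteq> ?S \<times> ?S" by force
        moreover have "continuous_on (?S \<times> ?S) (\<lambda>p. (snd p, fst p))" by (intro continuous_intros)
        ultimately show ?thesis using continuous_on_compose2[OF c] by fastforce
      qed
    qed
    obtain B where B: "0 \<le> B" "\<And>p. p \<in> ?S \<times> ?S \<Longrightarrow> \<bar>?Z (snd p) * q (snd p) (fst p) s * f (fst p)\<bar> \<le> B"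
      using continuous_on_compact_bounded[OF compact_Times[OF compact_sphere compact_sphere] cont] by blast
    have int: "integrable (?N \<Otimes>\<^sub>M ?N) (\<lambda>(y, z). ?Z z * q z y s * f y)"
      unfolding case_prod_unfold
      by (rule NN.P.integrable_const_bound[where B = B, OF AE_I2 pair_measurable_continuous[OF cont]])
         (use B(2) in \<open>simp add: space_pair_measure\<close>)
    have "Q x (t + s) = ?V * (\<integral>y. zonal_avg ?N (\<lambda>z. q z y s) x t * f y \<partial>?N)"
      unfolding Q_def
      by (intro arg_cong[where f = "\<lambda>u. ?V * u"] Bochner_Integration.integral_cong refl)
         (simp add: heat_fund_semigroup[OF card q x _ t s])
    also have "\<dots> = ?V * (\<integral>y. (\<integral>z. ?Z z * q z y s * f y \<partial>?N) \<partial>?N)"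
      by (simp add: zonal_avg_def)
    also have "\<dots> = ?V * (\<integral>z. (\<integral>y. ?Z z * q z y s * f y \<partial>?N) \<partial>?N)"
      by (simp only: NN.Fubini_integral[OF int])
    also have "\<dots> = ?V * (\<integral>z. ?Z z * (\<integral>y. q z y s * f y \<partial>?N) \<partial>?N)"
      by (simp only: mult.assoc Bochner_Integration.integral_mult_right_zero)
    also have "\<dots> = (\<integral>z. ?V * (?Z z * (\<integral>y. q z y s * f y \<partial>?N)) \<partial>?N)"
      by (simp only: Bochner_Integration.integral_mult_right_zero)
    also have "\<dots> = (\<integral>z. ?Z z * Q z s \<partial>?N)"
      by (rule Bochner_Integration.integral_cong) (simp_all add: Q_def)
    finally show ?thesis .
  qed
  define \<sigma> where "\<sigma> n = 1 / (real n + 1)" for n :: nat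
  have \<sigma>: "0 < \<sigma> n" "\<sigma> n \<le> 1" for n by (auto simp: \<sigma>_def)
  have \<sigma>_lim: "\<sigma> \<longlonglongrightarrow> 0" unfolding \<sigma>_def[abs_def] by real_asymp
  have "\<sigma> n \<in> {0<..} \<and> \<sigma> n \<noteq> 0" for n using \<sigma>(1)[of n] by simp
  then have "filterlim \<sigma> (at_right 0) sequentially"
    unfolding filterlim_at using \<sigma>_lim by (intro conjI always_eventually allI) auto
  have lim1: "(\<lambda>n. Q x (t + \<sigma> n)) \<longlonglongrightarrow> Q x t"
  proof -
    have cq: "continuous_on (?S \<times> {0<..}) (\<lambda>p. q x (fst p) (snd p))"
      using heat_fund_slices(5)[OF q x] by (simp add: case_prod_unfold)
    have c1: "continuous_on (?S \<times> {t..t + 1}) (\<lambda>p. q x (fst p) (snd p))"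
      using t by (intro continuous_on_subset[OF cq]) auto
    obtain B where B: "0 \<le> B" "\<And>p. p \<in> ?S \<times> {t..t + 1} \<Longrightarrow> \<bar>q x (fst p) (snd p)\<bar> \<le> B"
      using continuous_on_compact_bounded[OF compact_Times[OF compact_sphere compact_Icc] c1] by blast
    have t\<sigma>: "0 < t + \<sigma> n" for n using t \<sigma>(1)[of n] by simp
    have "(\<lambda>n. \<integral>y. q x y (t + \<sigma> n) * f y \<partial>?N) \<longlonglongrightarrow> (\<integral>y. q x y t * f y \<partial>?N)"
    proof (rule integral_dominated_convergence[where w = "\<lambda>_. B * F"])
      show "(\<lambda>y. q x y t * f y) \<in> borel_measurable ?N" by (rule sph_measurable_continuous[OF qf[OF x t]])
      show "(\<lambda>y. q x y (t + \<sigma> n) * f y) \<in> borel_measurable ?N" for n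
        by (rule sph_measurable_continuous[OF qf[OF x t\<sigma>]])
      show "AE y in ?N. (\<lambda>n. q x y (t + \<sigma> n) * f y) \<longlonglongrightarrow> q x y t * f y"
      proof (intro AE_I2 tendsto_mult_right)
        fix y assume "y \<in> space ?N"
        then have y: "y \<in> ?S" by simp
        have "(\<lambda>n. (y, t + \<sigma> n)) \<longlonglongrightarrow> (y, t + 0)" by (intro tendsto_intros \<sigma>_lim)
        from continuous_on_tendsto_compose[OF cq this]
        show "(\<lambda>n. q x y (t + \<sigma> n)) \<longlonglongrightarrow> q x y t" using y t t\<sigma> by simp
      qed
      show "AE y in ?N. norm (q x y (t + \<sigma> n) * f y) \<le> B * F" for n
      proof (intro AE_I2)
        fix y assume "y \<in> space ?N"
        then have y: "y \<in> ?S" by simp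
        have "\<bar>q x y (t + \<sigma> n)\<bar> \<le> B" using B(2)[of "(y, t + \<sigma> n)"] y \<sigma>[of n] by simp
        then show "norm (q x y (t + \<sigma> n) * f y) \<le> B * F"
          unfolding real_norm_def abs_mult using F(2)[OF y] by (intro mult_mono) auto
      qed
    qed simp
    then show ?thesis unfolding Q_def by (rule tendsto_mult_left)
  qed
  have lim2: "(\<lambda>n. \<integral>z. ?Z z * Q z (\<sigma> n) \<partial>?N) \<longlonglongrightarrow> (\<integral>z. ?Z z * f z \<partial>?N)"
  proof -
    obtain C where C: "0 \<le> C" "\<And>z. z \<in> ?S \<Longrightarrow> \<bar>?Z z\<bar> \<le> C"
      using continuous_on_compact_bounded[OF compact_sphere zonal_kernel_cont[OF t]] by blast
    show ?thesis
    proof (rule integral_dominated_convergence[where w = "\<lambda>_. C * F"])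
      show "(\<lambda>z. ?Z z * f z) \<in> borel_measurable ?N"
        by (intro sph_measurable_continuous continuous_on_mult zonal_kernel_cont t f)
      show "(\<lambda>z. ?Z z * Q z (\<sigma> n)) \<in> borel_measurable ?N" for n
        by (intro borel_measurable_times Q_meas \<sigma> sph_measurable_continuous zonal_kernel_cont t)
      show "AE z in ?N. (\<lambda>n. ?Z z * Q z (\<sigma> n)) \<longlonglongrightarrow> ?Z z * f z"
      proof (intro AE_I2 tendsto_mult_left)
        fix z assume "z \<in> space ?N"
        then have z: "z \<in> ?S" by simp
        have "((\<lambda>s. rp_int m r (\<lambda>y. q z y s * f y)) \<longlongrightarrow> f z) (at_right 0)"
          using q f z unfolding heat_fund_def by blast
        from filterlim_compose[OF this \<open>filterlim \<sigma> (at_right 0) sequentially\<close>]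
        show "(\<lambda>n. Q z (\<sigma> n)) \<longlonglongrightarrow> f z" using Q_rp[OF z \<sigma>(1)] by simp
      qed
      show "AE z in ?N. norm (?Z z * Q z (\<sigma> n)) \<le> C * F" for n
        unfolding real_norm_def abs_mult
        by (intro AE_I2 mult_mono C Q_bound \<sigma>) (auto simp: C)
    qed simp
  qed
  have "(\<lambda>n. Q x (t + \<sigma> n)) \<longlonglongrightarrow> (\<integral>z. ?Z z * f z \<partial>?N)"
    using lim2 by (simp add: semi \<sigma>)
  from LIMSEQ_unique[OF lim1 this] show ?thesis by (simp add: Q_def zonal_avg_def)
qed

text \<open>\<open>q\<close> and the explicit kernel have equal integrals against every even
  continuous function. Testing with their own difference shows that its square has mean 0.\<close>

lemma heat_fund_unique:
  fixes q :: "real^'n \<Rightarrow> real^'n \<Rightarrow> real \<Rightarrow> real"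
  assumes card: "CARD('n) = m + 1" and q: "heat_fund m r q"
    and x: "x \<in> sphere 0 r" and y: "y \<in> sphere 0 r" and t: "0 < t"
  shows "q x y t = rp_heat_kernel m r x y t"
proof -
  let ?S = "sphere (0::real^'n) r" and ?N = "sph_measure r :: (real^'n) measure"
  let ?V = "rp_volume m r TYPE('n)" and ?Z = "\<lambda>z. zonal m r ((x \<bullet> z / r\<^sup>2)\<^sup>2) t"
  have V: "0 < ?V" by (rule rp_volume_pos)
  \<comment> \<open>Extended by 0 so that evenness holds on the whole space, as the test functions
    in \<open>heat_fund\<close> require.\<close>
  define f where "f z = (if z \<in> ?S then ?V * q x z t - ?Z z else 0)" for z
  have qc: "continuous_on ?S (\<lambda>z. q x z t)" by (rule heat_fund_slices(2)[OF q x t])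
  have Zc: "continuous_on ?S ?Z" by (rule zonal_kernel_cont[OF t])
  have "continuous_on ?S (\<lambda>z. ?V * q x z t - ?Z z)" by (intro continuous_intros qc Zc)
  then have f: "continuous_on ?S f" by (rule continuous_on_eq) (simp add: f_def)
  have even: "f (- z) = f z" for z
    using q x t unfolding heat_fund_def f_def by auto
  have i: "integrable ?N (\<lambda>z. q x z t * f z)" "integrable ?N (\<lambda>z. ?Z z * f z)"
    by (intro sph_integrable r continuous_on_mult qc Zc f)+
  have "(\<integral>z. (f z)\<^sup>2 \<partial>?N) = (\<integral>z. ?V * (q x z t * f z) - ?Z z * f z \<partial>?N)"
    by (rule Bochner_Integration.integral_cong) (auto simp: f_def power2_eq_square left_diff_distrib mult.assoc)
  also have "\<dots> = 0"
    using i heat_fund_average[OF card q f even x t] by (simp add: zonal_avg_def)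
  finally have zero: "(\<integral>z. (f z)\<^sup>2 \<partial>?N) = 0" .
  have f2: "continuous_on ?S (\<lambda>z. (f z)\<^sup>2)" by (intro continuous_intros f)
  \<comment> \<open>From mean zero to the value at \<open>y\<close>: the heat flow of the square is
    at most a constant times its mean, hence at most 0, yet it approaches
    \<open>(f y)\<^sup>2\<close> as time tends to 0.\<close>
  have "(f y)\<^sup>2 \<le> e" if e: "0 < e" for e
  proof -
    obtain \<delta> where \<delta>: "0 < \<delta>" "\<And>s. 0 < s \<Longrightarrow> s < \<delta> \<Longrightarrow> \<bar>zonal_avg ?N (\<lambda>z. (f z)\<^sup>2) y s - (f y)\<^sup>2\<bar> \<le> e"
      using zonal_avg_initial[OF card f2 _ e] even y by auto
    define s where "s = \<delta> / 2"
    have s: "0 < s" "s < \<delta>" using \<delta>(1) by (auto simp: s_def)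
    have yc: "continuous_on ?S (\<lambda>z. zonal m r ((y \<bullet> z / r\<^sup>2)\<^sup>2) s)" by (rule zonal_kernel_cont[OF s(1)])
    obtain C where C: "\<And>z. z \<in> ?S \<Longrightarrow> \<bar>zonal m r ((y \<bullet> z / r\<^sup>2)\<^sup>2) s\<bar> \<le> C"
      using continuous_on_compact_bounded[OF compact_sphere yc] by blast
    have "zonal_avg ?N (\<lambda>z. (f z)\<^sup>2) y s \<le> (\<integral>z. C * (f z)\<^sup>2 \<partial>?N)"
      unfolding zonal_avg_def
    proof (rule integral_mono)
      show "integrable ?N (\<lambda>z. zonal m r ((y \<bullet> z / r\<^sup>2)\<^sup>2) s * (f z)\<^sup>2)" "integrable ?N (\<lambda>z. C * (f z)\<^sup>2)"
        by (intro sph_integrable r continuous_on_mult yc f2 continuous_on_const)+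
      show "zonal m r ((y \<bullet> z / r\<^sup>2)\<^sup>2) s * (f z)\<^sup>2 \<le> C * (f z)\<^sup>2" if "z \<in> space ?N" for z
        using C[of z] that by (intro mult_right_mono) auto
    qed
    also have "\<dots> = 0" using zero by simp
    finally show ?thesis using \<delta>(2)[OF s] by linarith
  qed
  then have "(f y)\<^sup>2 \<le> 0" by (rule field_le_epsilon[of _ 0, simplified])
  then have "f y = 0" by simp
  then show ?thesis using x y t V by (simp add: f_def rp_heat_kernel_def field_simps)
qed

text \<open>All fundamental solutions agree on the domain, so the explicit kernel is minimal among
  them, and the prescribed value 0 settles all other arguments.\<close>

lemma heat_kernel_eq:
  assumes card: "CARD('n) = m + 1"
  shows "heat_kernel m r = (rp_heat_kernel m r :: real^'n \<Rightarrow> real^'n \<Rightarrow> real \<Rightarrow> real)"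
  unfolding heat_kernel_def
proof (rule the_equality)
  show "min_heat_kernel m r (rp_heat_kernel m r :: real^'n \<Rightarrow> real^'n \<Rightarrow> real \<Rightarrow> real)"
    unfolding min_heat_kernel_def
  proof (intro conjI allI impI ballI rp_heat_kernel_fund card)
    show "rp_heat_kernel m r x y t \<le> q x y t"
      if "heat_fund m r q" "x \<in> sphere 0 r" "y \<in> sphere 0 r" "0 < t" for q and x y :: "real^'n" and t
      using heat_fund_unique[OF card that] by simp
  qed (simp only: rp_heat_kernel_def if_False)
  fix p :: "real^'n \<Rightarrow> real^'n \<Rightarrow> real \<Rightarrow> real" assume p: "min_heat_kernel m r p"
  show "p = rp_heat_kernel m r"
  proof (intro ext)
    fix x y t
    show "p x y t = rp_heat_kernel m r x y t"
    proof (cases "x \<in> sphere 0 r \<and> y \<in> sphere 0 r \<and> t > 0")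
      case True
      then show ?thesis using p heat_fund_unique[OF card] unfolding min_heat_kernel_def by blast
    next
      case False
      then have "p x y t = 0" using p unfolding min_heat_kernel_def by blast
      with False show ?thesis by (simp only: rp_heat_kernel_def if_False)
    qed
  qed
qed

end

section \<open>The embedding and quadratic forms\<close>

definition ldot :: "real list \<Rightarrow> real list \<Rightarrow> real" where
  "ldot u v = (\<Sum>k<length u. u ! k * v ! k)"

lemma ldot_append:
  assumes "length a = length c"
  shows "ldot (a @ b) (c @ d) = ldot a c + ldot b d"
proof -
  have split: "(\<Sum>k<i + j. f k) = (\<Sum>k<i. f k) + (\<Sum>k<j. f (i + k))" for i j and f :: "nat \<Rightarrow> real"
    by (induction j) simp_all
  have "ldot (a @ b) (c @ d) = (\<Sum>k<length a + length b. (a @ b) ! k * (c @ d) ! k)"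
    by (simp add: ldot_def)
  also have "\<dots> = (\<Sum>k<length a. (a @ b) ! k * (c @ d) ! k) +
      (\<Sum>k<length b. (a @ b) ! (length a + k) * (c @ d) ! (length a + k))"
    by (rule split)
  finally show ?thesis using assms by (simp add: ldot_def nth_append)
qed

lemma length_F: "length (F m xs ys) = m * (m + 3) div 2"
proof (induction m xs ys rule: F.induct)
  case (3 k xs ys)
  have "length (F (Suc (Suc k)) xs ys) = Suc k * (Suc k + 3) div 2 + (k + 3)"
    using 3 by (simp add: Let_def)
  also have "\<dots> = (Suc k * (Suc k + 3) + 2 * (k + 3)) div 2" by simp
  also have "Suc k * (Suc k + 3) + 2 * (k + 3) = Suc (Suc k) * (Suc (Suc k) + 3)"
    by (simp add: algebra_simps)
  finally show ?case .
qed auto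

text \<open>\<open>F\<close> lists coordinates of the trace-free part of xx^T. The right side is
  twice the Frobenius product of the trace-free parts of xx^T and yy^T.\<close>

lemma F_inner:
  assumes "k + 2 \<le> length xs" "k + 2 \<le> length ys"
  shows "ldot (F (Suc k) xs xs) (F (Suc k) ys ys) =
    2 * (\<Sum>i<k+2. xs ! i * ys ! i)\<^sup>2
      - 2 / (real k + 2) * (\<Sum>i<k+2. (xs ! i)\<^sup>2) * (\<Sum>i<k+2. (ys ! i)\<^sup>2)"
  using assms
proof (induction k arbitrary: xs ys)
  case 0
  show ?case
    by (simp add: ldot_def numeral_2_eq_2 power2_eq_square algebra_simps)
next
  case (Suc k)
  define n where "n = k + 2"
  define x y where "x = take n xs" "y = take n ys"
  define a b where "a = xs ! n" "b = ys ! n"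
  define \<tau> where "\<tau> = sqrt (2 / ((real n) * (real n + 1)))"
  have len: "length x = n" "length y = n" using Suc.prems by (auto simp: x_y_def n_def)
  have nth: "x ! i = xs ! i" "y ! i = ys ! i" if "i < n" for i using that by (auto simp: x_y_def)
  define p where "p = (\<Sum>i<n. xs ! i * ys ! i)"
  define s where "s = (\<Sum>i<n. (xs ! i)\<^sup>2)"
  define u where "u = (\<Sum>i<n. (ys ! i)\<^sup>2)"
  have sums: "(\<Sum>i<n. x ! i * y ! i) = p" "(\<Sum>i<n. (x ! i)\<^sup>2) = s" "(\<Sum>i<n. (y ! i)\<^sup>2) = u"
    "(\<Sum>i<n. x ! i * x ! i) = s" "(\<Sum>i<n. y ! i * y ! i) = u"
    unfolding p_def s_def u_def by (intro sum.cong refl; simp add: nth power2_eq_square)+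
  have IH: "ldot (F (Suc k) x x) (F (Suc k) y y) = 2 * p\<^sup>2 - 2 / real n * s * u"
    using Suc.IH[of x y] len sums by (simp add: n_def add.commute)
  have Fx: "F (Suc (Suc k)) xs xs = F (Suc k) x x @ map (\<lambda>i. a * x ! i + a * x ! i) [0..<n] @ [\<tau> * (s - real n * a * a)]"
    using sums(4) by (simp add: Let_def x_y_def a_b_def n_def \<tau>_def add.commute)
  have Fy: "F (Suc (Suc k)) ys ys = F (Suc k) y y @ map (\<lambda>i. b * y ! i + b * y ! i) [0..<n] @ [\<tau> * (u - real n * b * b)]"
    using sums(5) by (simp add: Let_def x_y_def a_b_def n_def \<tau>_def add.commute)
  have mid: "ldot (map (\<lambda>i. a * x ! i + a * x ! i) [0..<n]) (map (\<lambda>i. b * y ! i + b * y ! i) [0..<n]) = 4 * a * b * p"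
  proof -
    have "ldot (map (\<lambda>i. a * x ! i + a * x ! i) [0..<n]) (map (\<lambda>i. b * y ! i + b * y ! i) [0..<n]) =
        (\<Sum>i<n. (a * x ! i + a * x ! i) * (b * y ! i + b * y ! i))"
      by (simp add: ldot_def)
    also have "\<dots> = (\<Sum>i<n. 4 * a * b * (x ! i * y ! i))"
      by (intro sum.cong refl) (simp add: algebra_simps)
    also have "\<dots> = 4 * a * b * p"
      unfolding sum_distrib_left[symmetric] sums(1) ..
    finally show ?thesis .
  qed
  have n0: "0 < real n" by (simp add: n_def)
  \<comment> \<open>With this value the coefficient of \<open>s * u\<close> becomes -2/n + 2/(n(n +
    1)) = -2/(n + 1), so the formula reproduces itself one dimension higher.\<close>
  have \<tau>2: "\<tau> * \<tau> = 2 / (real n * (real n + 1))"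
    unfolding \<tau>_def using n0 by simp
  have "ldot (F (Suc (Suc k)) xs xs) (F (Suc (Suc k)) ys ys) =
      (2 * p\<^sup>2 - 2 / real n * s * u) + 4 * a * b * p + (\<tau> * \<tau>) * ((s - real n * a * a) * (u - real n * b * b))"
    unfolding Fx Fy
    by (simp only: ldot_append length_F length_map IH mid) (simp add: ldot_def algebra_simps)
  also have "\<dots> = 2 * (p + a * b)\<^sup>2 - 2 / (real n + 1) * (s + a\<^sup>2) * (u + b\<^sup>2)"
    unfolding \<tau>2 using n0 by (simp add: divide_simps) (simp add: algebra_simps power2_eq_square)
  also have "\<dots> = 2 * (\<Sum>i<Suc k+2. xs ! i * ys ! i)\<^sup>2
      - 2 / (real (Suc k) + 2) * (\<Sum>i<Suc k+2. (xs ! i)\<^sup>2) * (\<Sum>i<Suc k+2. (ys ! i)\<^sup>2)"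
    by (simp add: p_def s_def u_def a_b_def n_def add.commute)
  finally show ?case .
qed

lemma length_coords: "length (coords (x :: real^'n::{finite,linorder})) = CARD('n)"
  by (simp add: coords_def)

lemma coords_inner:
  fixes x y :: "real^'n::{finite,linorder}"
  shows "(\<Sum>i<CARD('n). coords x ! i * coords y ! i) = x \<bullet> y"
proof -
  let ?L = "sorted_list_of_set (UNIV :: 'n set)"
  have "(\<Sum>i<CARD('n). coords x ! i * coords y ! i) = (\<Sum>i<length ?L. x $ (?L ! i) * y $ (?L ! i))"
    by (intro sum.cong) (simp_all add: coords_def)
  also have "\<dots> = sum_list (map (\<lambda>j. x $ j * y $ j) ?L)"
    by (simp add: sum_list_sum_nth lessThan_atLeast0)
  also have "\<dots> = (\<Sum>j\<in>set ?L. x $ j * y $ j)"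
    by (rule sum_list_distinct_conv_sum_set) simp
  finally show ?thesis by (simp add: inner_vec_def)
qed

lemma ldot_scale: "ldot (map ((*) c) u) (map ((*) c) v) = c\<^sup>2 * ldot u v" if "length u = length v"
  using that by (simp add: ldot_def sum_distrib_left power2_eq_square algebra_simps)

lemma length_phi_vec: "length (phi_vec m x) = m * (m + 3) div 2"
  by (simp add: phi_vec_def length_F)

lemma phi_vec_inner:
  fixes x y :: "real^'n::{finite,linorder}"
  assumes m: "1 \<le> m" and card: "CARD('n) = m + 1"
    and x: "norm x = r_m m" and y: "norm y = r_m m"
  shows "ldot (phi_vec m x) (phi_vec m y) = real m / (4 * (real m + 1)) * (x \<bullet> y)\<^sup>2 - 1 / real m"
proof -
  obtain k where k: "m = Suc k" using m by (cases m) auto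
  let ?c = "(1/2) * sqrt (real m / (2 * (real m + 1)))"
  have c2: "?c\<^sup>2 = real m / (8 * (real m + 1))" by (simp add: power_mult_distrib power_divide)
  have r2: "(r_m m)\<^sup>2 = 2 * (real m + 1) / real m" by (simp add: r_m_def)
  have xx: "x \<bullet> x = 2 * (real m + 1) / real m" "y \<bullet> y = 2 * (real m + 1) / real m"
    using x y r2 by (simp_all add: dot_square_norm)
  have card': "CARD('n) = k + 2" using card k by simp
  have "ldot (phi_vec m x) (phi_vec m y) = ?c\<^sup>2 * ldot (F (Suc k) (coords x) (coords x)) (F (Suc k) (coords y) (coords y))"
    unfolding phi_vec_def k by (rule ldot_scale) (simp add: length_F)
  also have "ldot (F (Suc k) (coords x) (coords x)) (F (Suc k) (coords y) (coords y)) =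
      2 * (x \<bullet> y)\<^sup>2 - 2 / (real k + 2) * (x \<bullet> x) * (y \<bullet> y)"
    using coords_inner[of x y] coords_inner[of x x] coords_inner[of y y]
    by (subst F_inner) (simp_all add: length_coords card' power2_eq_square)
  also have "\<dots> = 2 * (x \<bullet> y)\<^sup>2 - 8 * (real m + 1) / (real m)\<^sup>2"
    unfolding xx using k by (simp add: divide_simps) (simp add: algebra_simps power2_eq_square)
  also have "?c\<^sup>2 * \<dots> = real m / (4 * (real m + 1)) * (x \<bullet> y)\<^sup>2 - 1 / real m"
    unfolding c2 using m by (simp add: divide_simps) (simp add: algebra_simps power2_eq_square)
  finally show ?thesis .
qed

lemma phi_vec_unit:
  fixes x :: "real^'n::{finite,linorder}"
  assumes "1 \<le> m" "CARD('n) = m + 1" "norm x = r_m m"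
  shows "ldot (phi_vec m x) (phi_vec m x) = 1"
proof -
  have xx: "x \<bullet> x = 2 * (real m + 1) / real m"
    using assms(3) by (simp add: dot_square_norm r_m_def)
  show ?thesis
    unfolding phi_vec_inner[OF assms assms(3)] xx using assms(1)
    by (simp add: power_divide divide_simps) (simp add: algebra_simps power2_eq_square)
qed

lemma lnorm_ldiff:
  assumes "length u = length v"
  shows "(lnorm (ldiff u v))\<^sup>2 = ldot u u + ldot v v - 2 * ldot u v"
proof -
  have "(lnorm (ldiff u v))\<^sup>2 = (\<Sum>k<length u. (u ! k - v ! k)\<^sup>2)"
    unfolding lnorm_def ldiff_def using assms by (simp add: sum_nonneg)
  also have "\<dots> = (\<Sum>k<length u. u ! k * u ! k + v ! k * v ! k - 2 * (u ! k * v ! k))"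
    by (intro sum.cong refl) (simp add: power2_eq_square algebra_simps)
  finally show ?thesis
    using assms by (simp add: ldot_def sum.distrib sum_subtractf sum_distrib_left)
qed

section \<open>Representatives and maximizers of quadratic forms\<close>

lemma rp_rep:
  fixes P :: "(real^'n) set"
  assumes "P \<in> rp r"
  shows "norm (rep P) = r" "P = {rep P, - rep P}"
proof -
  obtain x where x: "P = {x, - x}" "norm x = r" using assms by (auto simp: rp_def)
  have "rep P \<in> P" unfolding rep_def using x(1) by (metis insertI1 someI)
  then show "norm (rep P) = r" "P = {rep P, - rep P}" using x by auto
qed

text \<open>The form \<open>Q v = \<mu> * (v \<bullet> v) - v \<bullet> (A *v v)\<close> is
  nonnegative and vanishes at \<open>y\<close>. A step from \<open>y\<close> against
  \<open>g = \<mu> *\<^sub>R y - A *v y\<close> changes it to first order by a negative multiple of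
  \<open>g \<bullet> g\<close>, so \<open>g\<close> must be 0.\<close>

lemma maximizer_eigenvector:
  fixes A :: "real^'n^'n"
  assumes sym: "\<And>u v. u \<bullet> (A *v v) = (A *v u) \<bullet> v" and r: "0 < r" and y: "norm y = r"
    and max: "\<And>z. norm z = r \<Longrightarrow> z \<bullet> (A *v z) \<le> y \<bullet> (A *v y)"
  defines "\<mu> \<equiv> y \<bullet> (A *v y) / r\<^sup>2"
  shows "A *v y = \<mu> *\<^sub>R y" and "v \<bullet> (A *v v) \<le> \<mu> * (v \<bullet> v)"
proof -
  have ray: "v \<bullet> (A *v v) \<le> \<mu> * (v \<bullet> v)" for v
  proof (cases "v = 0")
    case False
    then have nv: "0 < norm v" by simp
    let ?z = "(r / norm v) *\<^sub>R v"
    have "norm ?z = r" using nv r by simp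
    then have "?z \<bullet> (A *v ?z) \<le> y \<bullet> (A *v y)" by (rule max)
    then have "(r / norm v)\<^sup>2 * (v \<bullet> (A *v v)) \<le> \<mu> * r\<^sup>2"
      using r by (simp add: matrix_vector_mult_scaleR power2_eq_square \<mu>_def)
    then have "v \<bullet> (A *v v) \<le> \<mu> * (norm v)\<^sup>2"
      using nv r by (simp add: power_divide field_simps)
    then show ?thesis by (simp add: dot_square_norm)
  qed simp
  then show "v \<bullet> (A *v v) \<le> \<mu> * (v \<bullet> v)" .
  define g where "g = \<mu> *\<^sub>R y - A *v y"
  define Q where "Q v = \<mu> * (v \<bullet> v) - v \<bullet> (A *v v)" for v
  have Q0: "0 \<le> Q v" for v using ray by (simp add: Q_def)
  have yy: "y \<bullet> y = r\<^sup>2" using y by (simp add: dot_square_norm)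
  have Qy: "Q y = 0" using r by (simp add: Q_def \<mu>_def yy)
  have expand: "Q (y - a *\<^sub>R g) = a\<^sup>2 * Q g - 2 * a * (g \<bullet> g)" for a
  proof -
    have sg: "(A *v g) \<bullet> y = (A *v y) \<bullet> g" using sym[of y g] by (simp add: inner_commute)
    have "Q (y - a *\<^sub>R g) = Q y - 2 * a * (\<mu> * (y \<bullet> g) - (A *v y) \<bullet> g) + a\<^sup>2 * Q g"
      unfolding Q_def
      by (simp add: matrix_vector_mult_diff_distrib matrix_vector_mult_scaleR inner_diff_left inner_diff_right
          sym sg inner_commute[of g y] inner_commute[of g "A *v y"] power2_eq_square algebra_simps)
    also have "\<mu> * (y \<bullet> g) - (A *v y) \<bullet> g = g \<bullet> g"
      by (simp add: g_def inner_diff_left)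
    finally show ?thesis using Qy by simp
  qed
  have "g \<bullet> g = 0"
  proof (rule ccontr)
    assume "g \<bullet> g \<noteq> 0"
    then have gg: "0 < g \<bullet> g" by (simp add: order_less_le)
    \<comment> \<open>Small enough for \<open>a * Q g \<le> g \<bullet> g\<close>; the summand 1
      keeps the denominator positive.\<close>
    define a where "a = (g \<bullet> g) / (Q g + 1)"
    have a: "0 < a" using gg Q0[of g] by (simp add: a_def)
    have "a * Q g \<le> g \<bullet> g"
    proof -
      have "a * (Q g + 1) = g \<bullet> g" using Q0[of g] by (simp add: a_def)
      then show ?thesis using a by (simp add: distrib_left)
    qed
    then have "a * (a * Q g) \<le> a * (g \<bullet> g)" using a by simp
    moreover have "0 < a * (g \<bullet> g)" using a gg by simp
    moreover have "0 \<le> a * (a * Q g) - 2 * (a * (g \<bullet> g))"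
      using Q0[of "y - a *\<^sub>R g"] unfolding expand by (simp add: power2_eq_square mult.assoc)
    ultimately show False by linarith
  qed
  then show "A *v y = \<mu> *\<^sub>R y" by (simp add: g_def)
qed

text \<open>The Rayleigh quotient of a maximizer is an eigenvalue and dominates all others, so both
  maximizers lie in the top eigenspace. That is a line, and equal norms leave only a sign.\<close>

lemma simple_top_eigenvalue_maximizer:
  fixes A :: "real^'n^'n"
  assumes sym: "\<And>u v. u \<bullet> (A *v v) = (A *v u) \<bullet> v" and r: "0 < r"
    and simple: "top_eigenvalue_simple A"
    and y: "norm y = r" "\<And>z. norm z = r \<Longrightarrow> z \<bullet> (A *v z) \<le> y \<bullet> (A *v y)"
    and z: "norm z = r" "\<And>w. norm w = r \<Longrightarrow> w \<bullet> (A *v w) \<le> z \<bullet> (A *v z)"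
  shows "z = y \<or> z = - y"
proof -
  obtain lam where lam: "is_eigenvalue A lam" "\<And>\<mu>. is_eigenvalue A \<mu> \<Longrightarrow> \<mu> \<le> lam"
    and dim: "dim {v. A *v v = lam *\<^sub>R v} = 1"
    using simple unfolding top_eigenvalue_simple_def by blast
  let ?W = "{v. A *v v = lam *\<^sub>R v}"
  have eig: "x \<in> ?W" if x: "norm x = r" "\<And>z. norm z = r \<Longrightarrow> z \<bullet> (A *v z) \<le> x \<bullet> (A *v x)" for x
  proof -
    define \<mu> where "\<mu> = x \<bullet> (A *v x) / r\<^sup>2"
    note e = maximizer_eigenvector[OF sym r x, folded \<mu>_def]
    have "x \<noteq> 0" using x(1) r by auto
    then have "is_eigenvalue A \<mu>" using e(1) by (auto simp: is_eigenvalue_def)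
    then have "\<mu> \<le> lam" by (rule lam(2))
    obtain v where v: "v \<noteq> 0" "A *v v = lam *\<^sub>R v" using lam(1) by (auto simp: is_eigenvalue_def)
    have "lam * (v \<bullet> v) \<le> \<mu> * (v \<bullet> v)" using e(2)[of v] v(2) by simp
    then have "lam \<le> \<mu>" using v(1) by simp
    with \<open>\<mu> \<le> lam\<close> e(1) show ?thesis by simp
  qed
  have sub: "subspace ?W"
    by (auto simp: subspace_def matrix_vector_right_distrib matrix_vector_mult_scaleR scaleR_add_right)
  have "y \<noteq> 0" using y(1) r by auto
  then have "dim {y} = 1" by (simp add: dim_singleton)
  have "span {y} = ?W"
  proof (rule subspace_dim_equal)
    show "subspace (span {y})" by (rule subspace_span)
    show "span {y} \<subseteq> ?W" using eig[OF y] sub by (intro span_minimal) auto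
    show "dim (span {y}) \<ge> dim ?W" using dim \<open>dim {y} = 1\<close> by simp
  qed (rule sub)
  then have "z \<in> span {y}" using eig[OF z] by simp
  then obtain c where c: "z = c *\<^sub>R y" by (auto simp: span_singleton)
  then have "\<bar>c\<bar> = 1" using y(1) z(1) r by simp
  then show ?thesis using c by (auto simp: abs_if split: if_splits)
qed

section \<open>Diffusion means\<close>

locale rp_random_point = sphere_heat m r + prob_space M
  for m :: nat and r :: real and M :: "'a measure" +
  fixes X :: "'a \<Rightarrow> real^'n"
  assumes card: "CARD('n) = m + 1"
    and X_meas: "X \<in> borel_measurable M"
    and X_norm: "\<omega> \<in> space M \<Longrightarrow> norm (X \<omega>) = r"
begin

definition quad :: "real^'n \<Rightarrow> real" where
  "quad y = y \<bullet> (second_moment M X *v y)"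

text \<open>The objective of \<open>diffusion_mean\<close> with its sign reversed and the constant
  from the volume removed: minimizers become maximizers of \<open>mean_log\<close>.\<close>

definition mean_log :: "real \<Rightarrow> real^'n \<Rightarrow> real" where
  "mean_log t y = (\<integral>\<omega>. ln (zonal m r ((X \<omega> \<bullet> y / r\<^sup>2)\<^sup>2) t) \<partial>M)"

lemma X_sphere: "\<omega> \<in> space M \<Longrightarrow> X \<omega> \<in> sphere 0 r"
  using X_norm by simp

lemma second_moment_bilinear:
  "y \<bullet> (second_moment M X *v z) = (\<integral>\<omega>. (X \<omega> \<bullet> y) * (X \<omega> \<bullet> z) \<partial>M)"
proof -
  have [measurable]: "(\<lambda>\<omega>. X \<omega> $ i) \<in> borel_measurable M" for i
    using X_meas by (rule measurable_compose) (intro borel_measurable_continuous_onI continuous_intros)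
  have int: "integrable M (\<lambda>\<omega>. X \<omega> $ i * X \<omega> $ j)" for i j
  proof (rule integrable_const_bound[where B = "r * r", OF AE_I2])
    fix \<omega> assume "\<omega> \<in> space M"
    then have "\<bar>X \<omega> $ i\<bar> \<le> r" for i using component_le_norm_cart[of "X \<omega>" i] X_norm by simp
    then show "norm (X \<omega> $ i * X \<omega> $ j) \<le> r * r"
      unfolding real_norm_def abs_mult using r by (intro mult_mono) auto
  qed measurable
  have "(\<integral>\<omega>. (X \<omega> \<bullet> y) * (X \<omega> \<bullet> z) \<partial>M) = (\<integral>\<omega>. (\<Sum>i\<in>UNIV. \<Sum>j\<in>UNIV. y $ i * z $ j * (X \<omega> $ i * X \<omega> $ j)) \<partial>M)"
    by (rule Bochner_Integration.integral_cong) (simp_all add: inner_vec_def sum_product mult_ac)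
  also have "\<dots> = (\<Sum>i\<in>UNIV. \<Sum>j\<in>UNIV. y $ i * z $ j * (\<integral>\<omega>. X \<omega> $ i * X \<omega> $ j \<partial>M))"
    using int by (simp add: Bochner_Integration.integral_sum)
  also have "\<dots> = y \<bullet> (second_moment M X *v z)"
    by (simp add: inner_vec_def matrix_vector_mult_def second_moment_def sum_distrib_left mult_ac)
  finally show ?thesis by simp
qed

lemma second_moment_sym: "y \<bullet> (second_moment M X *v z) = (second_moment M X *v y) \<bullet> z"
  using second_moment_bilinear[of y z] second_moment_bilinear[of z y]
  by (simp add: mult.commute inner_commute[of "second_moment M X *v y"])

lemma quad_eq: "quad y = (\<integral>\<omega>. (X \<omega> \<bullet> y)\<^sup>2 \<partial>M)"
  unfolding quad_def second_moment_bilinear by (simp add: power2_eq_square)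

lemma quad_minus: "quad (- y) = quad y"
  by (simp add: quad_eq)

lemma quad_cont: "continuous_on A quad"
  unfolding quad_def
  by (intro continuous_intros linear_continuous_on) (simp add: linear_conv_bounded_linear[symmetric])

lemma inner_meas: "(\<lambda>\<omega>. X \<omega> \<bullet> y) \<in> borel_measurable M"
  using X_meas by (intro borel_measurable_inner) auto

lemma inner_sq_integrable: "integrable M (\<lambda>\<omega>. (X \<omega> \<bullet> y)\<^sup>2)"
proof (rule integrable_const_bound[where B = "(r * norm y)\<^sup>2", OF AE_I2])
  fix \<omega> assume "\<omega> \<in> space M"
  then have "\<bar>X \<omega> \<bullet> y\<bar> \<le> r * norm y" using Cauchy_Schwarz_ineq2[of "X \<omega>" y] X_norm by simp
  then show "norm ((X \<omega> \<bullet> y)\<^sup>2) \<le> (r * norm y)\<^sup>2"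
    using power_mono[of "\<bar>X \<omega> \<bullet> y\<bar>" "r * norm y" 2] by simp
qed (use inner_meas in measurable)

lemma log_zonal_cont: "0 < t \<Longrightarrow> continuous_on {0..} (\<lambda>v. ln (zonal m r v t))"
  using zonal_pos by (intro continuous_on_ln zonal_cont_v) (auto simp: less_imp_neq[symmetric])

lemma log_zonal_meas:
  assumes t: "0 < t" shows "(\<lambda>\<omega>. ln (zonal m r ((X \<omega> \<bullet> y / r\<^sup>2)\<^sup>2) t)) \<in> borel_measurable M"
proof -
  have "continuous_on UNIV (\<lambda>u. ln (zonal m r ((u / r\<^sup>2)\<^sup>2) t))"
    using r by (intro continuous_on_compose2[OF log_zonal_cont[OF t]] continuous_intros) auto
  then show ?thesis
    by (intro measurable_compose[OF inner_meas] borel_measurable_continuous_onI)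
qed

lemma log_zonal_bounded:
  assumes t: "0 < t"
  obtains B where "\<And>v. 0 \<le> v \<Longrightarrow> v \<le> 1 \<Longrightarrow> \<bar>ln (zonal m r v t)\<bar> \<le> B"
  using continuous_on_compact_bounded[of "{0..1::real}", OF compact_Icc continuous_on_subset[OF log_zonal_cont[OF t]]]
  by (metis atLeastAtMost_iff atLeast_iff subsetI)

lemma log_zonal_integrable:
  assumes t: "0 < t" and y: "y \<in> sphere 0 r"
  shows "integrable M (\<lambda>\<omega>. ln (zonal m r ((X \<omega> \<bullet> y / r\<^sup>2)\<^sup>2) t))"
proof -
  obtain B where B: "\<And>v. 0 \<le> v \<Longrightarrow> v \<le> 1 \<Longrightarrow> \<bar>ln (zonal m r v t)\<bar> \<le> B"
    using log_zonal_bounded[OF t] by blast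
  show ?thesis
    by (rule integrable_const_bound[where B = B, OF AE_I2 log_zonal_meas[OF t]])
       (use B[OF sq_le_1[OF X_sphere y]] in simp)
qed

lemma mean_log_cont:
  assumes t: "0 < t" shows "continuous_on (sphere 0 r) (mean_log t)"
  unfolding continuous_on_sequentially
proof (intro allI ballI impI)
  fix Y :: "nat \<Rightarrow> real^'n" and y :: "real^'n"
  assume y: "y \<in> sphere 0 r" and "(\<forall>n. Y n \<in> sphere 0 r) \<and> Y \<longlonglongrightarrow> y"
  then have Y: "\<And>n. Y n \<in> sphere 0 r" "Y \<longlonglongrightarrow> y" by auto
  obtain B where B: "\<And>v. 0 \<le> v \<Longrightarrow> v \<le> 1 \<Longrightarrow> \<bar>ln (zonal m r v t)\<bar> \<le> B"
    using log_zonal_bounded[OF t] by blast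
  have "(\<lambda>n. mean_log t (Y n)) \<longlonglongrightarrow> mean_log t y"
    unfolding mean_log_def
  proof (rule integral_dominated_convergence[where w = "\<lambda>_. B"])
    show "AE \<omega> in M. (\<lambda>n. ln (zonal m r ((X \<omega> \<bullet> Y n / r\<^sup>2)\<^sup>2) t)) \<longlonglongrightarrow> ln (zonal m r ((X \<omega> \<bullet> y / r\<^sup>2)\<^sup>2) t)"
    proof (rule AE_I2)
      fix \<omega>
      have "(\<lambda>n. (X \<omega> \<bullet> Y n / r\<^sup>2)\<^sup>2) \<longlonglongrightarrow> (X \<omega> \<bullet> y / r\<^sup>2)\<^sup>2"
        using r by (intro tendsto_intros Y) auto
      then show "(\<lambda>n. ln (zonal m r ((X \<omega> \<bullet> Y n / r\<^sup>2)\<^sup>2) t)) \<longlonglongrightarrow> ln (zonal m r ((X \<omega> \<bullet> y / r\<^sup>2)\<^sup>2) t)"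
        by (rule continuous_on_tendsto_compose[OF log_zonal_cont[OF t]]) auto
    qed
    show "AE \<omega> in M. norm (ln (zonal m r ((X \<omega> \<bullet> Y n / r\<^sup>2)\<^sup>2) t)) \<le> B" for n
      using B[OF sq_le_1[OF X_sphere Y(1)]] by (intro AE_I2) simp
  qed (use log_zonal_meas[OF t] in auto)
  then show "(mean_log t \<circ> Y) \<longlonglongrightarrow> mean_log t y" by (simp add: o_def)
qed

lemma mean_log_minus: "mean_log t (- y) = mean_log t y"
  by (simp add: mean_log_def)

lemma rp_rep_sphere: "P \<in> rp r \<Longrightarrow> rep P \<in> sphere 0 r" for P :: "(real^'n) set"
  using rp_rep(1)[of P r] by simp

lemma sphere_rp:
  fixes y :: "real^'n"
  assumes "y \<in> sphere 0 r"
  shows "{y, - y} \<in> rp r" "rep {y, - y} = y \<or> rep {y, - y} = - y"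
proof -
  show "{y, - y} \<in> rp r" using assms by (auto simp: rp_def)
  have "rep {y, - y} \<in> {y, - y}" unfolding rep_def by (rule someI[of _ y]) simp
  then show "rep {y, - y} = y \<or> rep {y, - y} = - y" by auto
qed

lemma rp_rep_quantifier:
  fixes f :: "real^'n \<Rightarrow> real"
  assumes "\<And>y. f (- y) = f y"
  shows "(\<forall>Q\<in>rp r. f (rep Q) \<le> K) \<longleftrightarrow> (\<forall>y\<in>sphere 0 r. f y \<le> K)"
proof
  show "\<forall>y\<in>sphere 0 r. f y \<le> K" if "\<forall>Q\<in>rp r. f (rep Q) \<le> K"
  proof
    fix y :: "real^'n" assume "y \<in> sphere 0 r"
    from sphere_rp[OF this] that assms show "f y \<le> K" by metis
  qed
qed (use rp_rep_sphere in blast)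

lemma diffusion_mean_eq:
  assumes t: "0 < t"
  shows "diffusion_mean m r M X t = {P \<in> rp r. \<forall>Q\<in>rp r. mean_log t (rep Q) \<le> mean_log t (rep P)}"
proof -
  let ?V = "rp_volume m r TYPE('n)"
  have V: "0 < ?V" by (rule rp_volume_pos)
  have eq: "(\<integral>\<omega>. - ln (heat_kernel m r (X \<omega>) (rep P) t) \<partial>M) = ln ?V - mean_log t (rep P)" if "P \<in> rp r" for P
  proof -
    have y: "rep P \<in> sphere 0 r" by (rule rp_rep_sphere[OF that])
    have "(\<integral>\<omega>. - ln (heat_kernel m r (X \<omega>) (rep P) t) \<partial>M) =
        (\<integral>\<omega>. ln ?V - ln (zonal m r ((X \<omega> \<bullet> rep P / r\<^sup>2)\<^sup>2) t) \<partial>M)"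
    proof (rule Bochner_Integration.integral_cong[OF refl])
      fix \<omega> assume "\<omega> \<in> space M"
      then have "heat_kernel m r (X \<omega>) (rep P) t = zonal m r ((X \<omega> \<bullet> rep P / r\<^sup>2)\<^sup>2) t / ?V"
        unfolding heat_kernel_eq[OF card] rp_heat_kernel_def using X_sphere y t by (simp only: if_True simp_thms)
      then show "- ln (heat_kernel m r (X \<omega>) (rep P) t) = ln ?V - ln (zonal m r ((X \<omega> \<bullet> rep P / r\<^sup>2)\<^sup>2) t)"
        using V zonal_pos[of "(X \<omega> \<bullet> rep P / r\<^sup>2)\<^sup>2" t] t by (simp add: ln_div)
    qed
    also have "\<dots> = ln ?V - mean_log t (rep P)"
      unfolding mean_log_def using log_zonal_integrable[OF t y] by (simp add: prob_space)
    finally show ?thesis .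
  qed
  show ?thesis
    unfolding diffusion_mean_def using eq by auto
qed

text \<open>Supplies the points that \<open>kur_Li\<close> demands in every set of the
  sequence.\<close>

lemma diffusion_mean_nonempty:
  assumes t: "0 < t" shows "diffusion_mean m r M X t \<noteq> {}"
proof -
  have "sphere (0::real^'n) r \<noteq> {}" using r by simp
  then obtain y where y: "y \<in> sphere 0 r" "\<forall>z\<in>sphere 0 r. mean_log t z \<le> mean_log t y"
    using continuous_attains_sup[OF compact_sphere _ mean_log_cont[OF t]] by blast
  have "mean_log t (rep {y, - y}) = mean_log t y"
    using sphere_rp(2)[OF y(1)] mean_log_minus by metis
  then have "{y, - y} \<in> diffusion_mean m r M X t"
    unfolding diffusion_mean_eq[OF t] using sphere_rp(1)[OF y(1)] y(2) rp_rep_sphere by auto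
  then show ?thesis by blast
qed

text \<open>Divided by \<open>\<epsilon> t\<close>, the objective \<open>mean_log t\<close> is
  within \<open>\<delta>\<close> of \<open>k * quad y - 1\<close>, uniformly on the sphere, so a
  maximizer of one almost maximizes the other.\<close>

lemma diffusion_mean_almost_maximal:
  assumes \<eta>: "0 < \<eta>"
  shows "\<forall>\<^sub>F t in at_top. \<forall>P\<in>diffusion_mean m r M X t. \<forall>Q\<in>rp r. quad (rep Q) \<le> quad (rep P) + \<eta>"
proof -
  define k where "k = (real m + 1) / r ^ 4"
  have k: "0 < k" using r by (simp add: k_def)
  \<comment> \<open>The approximation error enters twice, at \<open>P\<close> and at
    \<open>Q\<close>, and is then divided by \<open>k\<close>.\<close>
  define \<delta> where "\<delta> = k * \<eta> / 2"
  have \<delta>: "0 < \<delta>" using k \<eta> by (simp add: \<delta>_def)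
  obtain \<epsilon> where \<epsilon>: "\<And>\<delta>. 0 < \<delta> \<Longrightarrow> \<forall>\<^sub>F t in at_top. 0 < \<epsilon> t \<and>
     (\<forall>v\<in>{0..1}. \<bar>ln (zonal m r v t) - \<epsilon> t * ((real m + 1) * v - 1)\<bar> \<le> \<delta> * \<epsilon> t)"
    using zonal_long_time by blast
  have "\<forall>\<^sub>F t::real in at_top. 0 < t" by (rule eventually_gt_at_top)
  with \<epsilon>[OF \<delta>] show ?thesis
  proof eventually_elim
    case (elim t)
    have t: "0 < t" and e: "0 < \<epsilon> t" using elim by auto
    have approx: "\<bar>mean_log t y - \<epsilon> t * (k * quad y - 1)\<bar> \<le> \<delta> * \<epsilon> t" if y: "y \<in> sphere 0 r" for y
    proof -
      let ?v = "\<lambda>\<omega>. (X \<omega> \<bullet> y / r\<^sup>2)\<^sup>2"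
      have v: "?v \<omega> = (X \<omega> \<bullet> y)\<^sup>2 / r ^ 4" for \<omega> by (simp add: power_divide)
      have i1: "integrable M (\<lambda>\<omega>. ln (zonal m r (?v \<omega>) t))" by (rule log_zonal_integrable[OF t y])
      have i2: "integrable M (\<lambda>\<omega>. \<epsilon> t * ((real m + 1) * ?v \<omega> - 1))"
        unfolding v using inner_sq_integrable by auto
      have "(\<integral>\<omega>. \<epsilon> t * ((real m + 1) * ?v \<omega> - 1) \<partial>M) = \<epsilon> t * (k * quad y - 1)"
        unfolding v k_def quad_eq using inner_sq_integrable by (simp add: prob_space)
      then have "\<bar>mean_log t y - \<epsilon> t * (k * quad y - 1)\<bar> =
          \<bar>\<integral>\<omega>. ln (zonal m r (?v \<omega>) t) - \<epsilon> t * ((real m + 1) * ?v \<omega> - 1) \<partial>M\<bar>"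
        unfolding mean_log_def by (simp only: Bochner_Integration.integral_diff[OF i1 i2])
      also have "\<dots> \<le> (\<integral>\<omega>. \<bar>ln (zonal m r (?v \<omega>) t) - \<epsilon> t * ((real m + 1) * ?v \<omega> - 1)\<bar> \<partial>M)"
        by (rule integral_abs_bound)
      also have "\<dots> \<le> (\<integral>\<omega>. \<delta> * \<epsilon> t \<partial>M)"
      proof (rule integral_mono)
        fix \<omega> assume "\<omega> \<in> space M"
        then have "?v \<omega> \<in> {0..1}" using sq_le_1[OF X_sphere y] by simp
        then show "\<bar>ln (zonal m r (?v \<omega>) t) - \<epsilon> t * ((real m + 1) * ?v \<omega> - 1)\<bar> \<le> \<delta> * \<epsilon> t"
          using elim by blast
      qed (use i1 i2 in auto)
      finally show ?thesis by (simp add: prob_space)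
    qed
    show ?case
    proof (intro ballI)
      fix P and Q :: "(real^'n) set" assume "P \<in> diffusion_mean m r M X t" and Q: "Q \<in> rp r"
      then have P: "P \<in> rp r" "mean_log t (rep Q) \<le> mean_log t (rep P)"
        by (auto simp: diffusion_mean_eq[OF t])
      note a = approx[OF rp_rep_sphere[OF P(1)]] approx[OF rp_rep_sphere[OF Q]]
      have "\<epsilon> t * (k * quad (rep Q) - 1) - \<delta> * \<epsilon> t \<le> \<epsilon> t * (k * quad (rep P) - 1) + \<delta> * \<epsilon> t"
        using a P(2) unfolding abs_le_iff by linarith
      then have "\<epsilon> t * (k * quad (rep Q)) \<le> \<epsilon> t * (k * quad (rep P) + 2 * \<delta>)"
        by (simp add: algebra_simps)
      then have "k * quad (rep Q) \<le> k * quad (rep P) + 2 * \<delta>" using e by simp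
      also have "\<dots> = k * (quad (rep P) + \<eta>)" by (simp add: \<delta>_def distrib_left)
      finally show "quad (rep Q) \<le> quad (rep P) + \<eta>" using k by simp
    qed
  qed
qed

section \<open>Kuratowski limits of the diffusion means\<close>

definition quad_argmax :: "(real^'n) set set" where
  "quad_argmax = {P \<in> rp r. \<forall>Q\<in>rp r. quad (rep Q) \<le> quad (rep P)}"

lemma quad_tendsto:
  fixes P :: "(real^'n) set"
  assumes P: "P \<in> rp r" and xs: "\<And>j. xs j \<in> rp r" and lim: "(\<lambda>j. d_res r (xs j) P) \<longlonglongrightarrow> 0"
  shows "(\<lambda>j. quad (rep (xs j))) \<longlonglongrightarrow> quad (rep P)"
proof -
  let ?p = "rep P" and ?y = "\<lambda>j. rep (xs j)"
  have p: "norm ?p = r" "?p \<bullet> ?p = r\<^sup>2" using rp_rep(1)[OF P] by (simp_all add: dot_square_norm)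
  have y: "norm (?y j) = r" "?y j \<bullet> ?y j = r\<^sup>2" for j using rp_rep(1)[OF xs[of j]] by (simp_all add: dot_square_norm)
  have le1: "(?y j \<bullet> ?p / r\<^sup>2)\<^sup>2 \<le> 1" for j
    by (rule sq_le_1(2)) (use p y in auto)
  have "(\<lambda>j. 1 - (d_res r (xs j) P)\<^sup>2) \<longlonglongrightarrow> 1 - 0\<^sup>2" by (intro tendsto_intros lim)
  then have "(\<lambda>j. (?y j \<bullet> ?p / r\<^sup>2)\<^sup>2) \<longlonglongrightarrow> 1" using le1 by (simp add: d_res_def)
  then have "(\<lambda>j. sqrt ((?y j \<bullet> ?p / r\<^sup>2)\<^sup>2)) \<longlonglongrightarrow> sqrt 1" by (rule tendsto_real_sqrt)
  then have lim1: "(\<lambda>j. \<bar>?y j \<bullet> ?p\<bar> / r\<^sup>2) \<longlonglongrightarrow> 1" using r by (simp add: abs_divide)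
  \<comment> \<open>Residual convergence fixes representatives only up to sign. With the sign chosen
    to make the inner product with \<open>?p\<close> nonnegative they converge in the Euclidean
    norm, and \<open>quad\<close> is even.\<close>
  define z where "z j = (if 0 \<le> ?y j \<bullet> ?p then ?y j else - ?y j)" for j
  have "dist (z j) ?p = sqrt (2 * r\<^sup>2 * (1 - \<bar>?y j \<bullet> ?p\<bar> / r\<^sup>2))" for j
  proof -
    have "(z j - ?p) \<bullet> (z j - ?p) = 2 * r\<^sup>2 - 2 * \<bar>?y j \<bullet> ?p\<bar>"
      using p(2) y(2)[of j]
      by (simp add: z_def inner_diff_left inner_diff_right inner_commute[of ?p "?y j"])
    also have "\<dots> = 2 * r\<^sup>2 * (1 - \<bar>?y j \<bullet> ?p\<bar> / r\<^sup>2)" using r by (simp add: right_diff_distrib)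
    finally show ?thesis by (simp add: dist_norm norm_eq_sqrt_inner)
  qed
  moreover have "(\<lambda>j. sqrt (2 * r\<^sup>2 * (1 - \<bar>?y j \<bullet> ?p\<bar> / r\<^sup>2))) \<longlonglongrightarrow> sqrt (2 * r\<^sup>2 * (1 - 1))"
    by (intro tendsto_intros lim1)
  ultimately have "(\<lambda>j. dist (z j) ?p) \<longlonglongrightarrow> 0" by simp
  then have "z \<longlonglongrightarrow> ?p" by (rule tendsto_dist_iff[THEN iffD2])
  then have "(\<lambda>j. quad (z j)) \<longlonglongrightarrow> quad ?p"
    by (rule continuous_on_tendsto_compose[OF quad_cont[of UNIV]]) auto
  moreover have "quad (z j) = quad (?y j)" for j by (simp add: z_def quad_minus)
  ultimately show ?thesis by simp
qed

lemma diffusion_mean_rp: "diffusion_mean m r M X t \<subseteq> rp r"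
  by (auto simp: diffusion_mean_def)

lemma kur_Ls_subset:
  assumes t: "admissible_times t"
  shows "kur_Ls (rp r) (d_res r) (\<lambda>k. diffusion_mean m r M X (t k)) \<subseteq> quad_argmax"
proof
  fix P assume "P \<in> kur_Ls (rp r) (d_res r) (\<lambda>k. diffusion_mean m r M X (t k))"
  then obtain s xs where P: "P \<in> rp r" and s: "strict_mono s"
    and xs: "\<And>j. xs j \<in> diffusion_mean m r M X (t (s j))" and lim: "(\<lambda>j. d_res r (xs j) P) \<longlonglongrightarrow> 0"
    unfolding kur_Ls_def by auto
  have xs_rp: "xs j \<in> rp r" for j using xs diffusion_mean_rp by blast
  have ts: "filterlim (\<lambda>j. t (s j)) at_top sequentially"
    using t filterlim_subseq[OF s] unfolding admissible_times_def
    by (blast intro: filterlim_compose)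
  have "quad (rep Q) \<le> quad (rep P)" if Q: "Q \<in> rp r" for Q
  proof (rule field_le_epsilon)
    fix \<eta> :: real assume "0 < \<eta>"
    from diffusion_mean_almost_maximal[OF this] ts
    have "\<forall>\<^sub>F j in sequentially. \<forall>P\<in>diffusion_mean m r M X (t (s j)). \<forall>Q\<in>rp r. quad (rep Q) \<le> quad (rep P) + \<eta>"
      by (rule eventually_compose_filterlim)
    then have "\<forall>\<^sub>F j in sequentially. quad (rep Q) \<le> quad (rep (xs j)) + \<eta>"
      by eventually_elim (use xs Q in blast)
    moreover have "(\<lambda>j. quad (rep (xs j)) + \<eta>) \<longlonglongrightarrow> quad (rep P) + \<eta>"
      by (intro tendsto_intros quad_tendsto P xs_rp lim)
    ultimately show "quad (rep Q) \<le> quad (rep P) + \<eta>"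
      by (intro tendsto_lowerbound[where F = sequentially]) auto
  qed
  then show "P \<in> quad_argmax" using P by (simp add: quad_argmax_def)
qed

lemma E_lower_subset_E_upper: "E_lower m r M X \<subseteq> E_upper m r M X"
proof -
  have "kur_Li (rp r) (d_res r) A \<subseteq> kur_Ls (rp r) (d_res r) A" for A :: "nat \<Rightarrow> (real^'n) set set"
  proof
    fix P assume "P \<in> kur_Li (rp r) (d_res r) A"
    then obtain xs where "P \<in> rp r" "\<And>k. xs k \<in> A k" "(\<lambda>k. d_res r (xs k) P) \<longlonglongrightarrow> 0"
      unfolding kur_Li_def by auto
    then show "P \<in> kur_Ls (rp r) (d_res r) A"
      unfolding kur_Ls_def by (auto intro!: exI[of _ "\<lambda>k. k"] exI[of _ xs] simp: strict_mono_def)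
  qed
  then show ?thesis unfolding E_lower_def E_upper_def by blast
qed

lemma E_upper_subset: "E_upper m r M X \<subseteq> quad_argmax"
proof -
  \<comment> \<open>The intersection in \<open>E_upper\<close> is bounded by any one of its members,
    so a single admissible sequence is exhibited.\<close>
  have "admissible_times (\<lambda>k. real k + 1)"
    unfolding admissible_times_def by (auto simp: incseq_def) real_asymp
  then show ?thesis using kur_Ls_subset unfolding E_upper_def by blast
qed

lemma maximizer_unique:
  assumes simple: "top_eigenvalue_simple (second_moment M X)" and P: "P \<in> quad_argmax"
    and y: "y \<in> sphere 0 r" "quad (rep P) \<le> quad y"
  shows "y = rep P \<or> y = - rep P"
proof -
  have P': "P \<in> rp r" "\<forall>z\<in>sphere 0 r. quad z \<le> quad (rep P)"
    using P rp_rep_quantifier[of quad "quad (rep P)"] quad_minus by (auto simp: quad_argmax_def)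
  show ?thesis
    by (rule simple_top_eigenvalue_maximizer[OF second_moment_sym r simple])
       (use P' y rp_rep(1)[OF P'(1)] in \<open>auto simp: quad_def[symmetric] intro: order_trans\<close>)
qed

lemma quad_argmax_unique:
  assumes simple: "top_eigenvalue_simple (second_moment M X)" and P: "P \<in> quad_argmax"
  shows "quad_argmax = {P}"
proof -
  have "Q = P" if Q: "Q \<in> quad_argmax" for Q
  proof -
    have "Q \<in> rp r" "P \<in> rp r" "quad (rep P) \<le> quad (rep Q)"
      using P Q by (auto simp: quad_argmax_def)
    then have "rep Q = rep P \<or> rep Q = - rep P"
      by (intro maximizer_unique[OF simple P] rp_rep_sphere)
    then show ?thesis
      using rp_rep(2)[OF \<open>Q \<in> rp r\<close>] rp_rep(2)[OF \<open>P \<in> rp r\<close>] by (metis insert_commute minus_minus)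
  qed
  then show ?thesis using P by blast
qed

text \<open>Any choice of diffusion means converges to \<open>P\<close>. By uniqueness and
  compactness, \<open>quad\<close> stays below its maximum by a fixed amount outside each residual
  neighbourhood of \<open>P\<close>, and almost maximal points cannot lie there.\<close>

lemma maximizer_in_kur_Li:
  assumes simple: "top_eigenvalue_simple (second_moment M X)" and P: "P \<in> quad_argmax"
    and t: "admissible_times t"
  shows "P \<in> kur_Li (rp r) (d_res r) (\<lambda>k. diffusion_mean m r M X (t k))"
proof -
  have P_rp: "P \<in> rp r" using P by (simp add: quad_argmax_def)
  have "\<exists>Q. Q \<in> diffusion_mean m r M X (t k)" for k
    using diffusion_mean_nonempty[of "t k"] t unfolding admissible_times_def by blast
  then obtain xs where xs: "\<And>k. xs k \<in> diffusion_mean m r M X (t k)" by metis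
  have xs_rp: "xs k \<in> rp r" for k using xs diffusion_mean_rp by blast
  \<comment> \<open>Residual distance to \<open>P\<close> as a function of a representative, to work
    on the compact sphere.\<close>
  define D where "D y = sqrt (1 - (y \<bullet> rep P / r\<^sup>2)\<^sup>2)" for y
  have D_cont: "continuous_on A D" for A unfolding D_def[abs_def] using r by (intro continuous_intros) auto
  have "(\<lambda>k. d_res r (xs k) P) \<longlonglongrightarrow> 0"
  proof (rule tendstoI)
    fix e :: real assume e: "0 < e"
    define B where "B = sphere 0 r \<inter> D -` {e..}"
    have "compact B"
    proof -
      have "closed B" unfolding B_def by (intro continuous_closed_preimage D_cont) auto
      then have "compact (sphere 0 r \<inter> B)" by (intro compact_Int_closed compact_sphere)
      moreover have "sphere 0 r \<inter> B = B" by (auto simp: B_def)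
      ultimately show ?thesis by simp
    qed
    have gap: "quad y < quad (rep P)" if "y \<in> B" for y
    proof (rule ccontr)
      assume "\<not> quad y < quad (rep P)"
      then have "y = rep P \<or> y = - rep P"
        using that by (intro maximizer_unique[OF simple P]) (auto simp: B_def)
      moreover have "rep P \<bullet> rep P = r\<^sup>2" using rp_rep(1)[OF P_rp] by (simp add: dot_square_norm)
      ultimately have "D y = 0" using r by (auto simp: D_def)
      then show False using that e by (simp add: B_def)
    qed
    have "\<exists>\<eta>>0. \<forall>y\<in>B. quad y + \<eta> < quad (rep P)"
    proof (cases "B = {}")
      case True
      then show ?thesis by (auto intro: exI[of _ 1])
    next
      case False
      obtain y0 where y0: "y0 \<in> B" "\<forall>y\<in>B. quad y \<le> quad y0"
        using continuous_attains_sup[OF \<open>compact B\<close> False quad_cont] by blast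
      define \<eta> where "\<eta> = (quad (rep P) - quad y0) / 2"
      have "0 < \<eta>" using gap[OF y0(1)] by (simp add: \<eta>_def)
      moreover have "quad y + \<eta> < quad (rep P)" if "y \<in> B" for y
      proof -
        have "quad y0 + 2 * \<eta> = quad (rep P)" by (simp add: \<eta>_def field_simps)
        moreover have "quad y \<le> quad y0" using y0(2) that by blast
        ultimately show ?thesis using \<open>0 < \<eta>\<close> by linarith
      qed
      ultimately show ?thesis by blast
    qed
    then obtain \<eta> where \<eta>: "0 < \<eta>" "\<And>y. y \<in> B \<Longrightarrow> quad y + \<eta> < quad (rep P)" by blast
    have "filterlim t at_top sequentially" using t by (simp add: admissible_times_def)
    with diffusion_mean_almost_maximal[OF \<eta>(1)]
    have "\<forall>\<^sub>F k in sequentially. \<forall>P\<in>diffusion_mean m r M X (t k). \<forall>Q\<in>rp r. quad (rep Q) \<le> quad (rep P) + \<eta>"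
      by (rule eventually_compose_filterlim)
    then show "\<forall>\<^sub>F k in sequentially. dist (d_res r (xs k) P) 0 < e"
    proof eventually_elim
      case (elim k)
      then have "quad (rep P) \<le> quad (rep (xs k)) + \<eta>" using xs P_rp by blast
      then have "rep (xs k) \<notin> B" using \<eta>(2)[of "rep (xs k)"] by force
      then have "D (rep (xs k)) < e" using rp_rep_sphere[OF xs_rp[of k]] by (simp add: B_def)
      moreover have "0 \<le> D (rep (xs k))"
        unfolding D_def using sq_le_1(2)[OF rp_rep_sphere[OF xs_rp[of k]] rp_rep_sphere[OF P_rp]] by simp
      ultimately show ?case by (simp add: d_res_def D_def)
    qed
  qed
  then show ?thesis using P_rp xs unfolding kur_Li_def by blast
qed

lemma E_eq_quad_argmax:
  assumes simple: "top_eigenvalue_simple (second_moment M X)"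
  shows "E_lower m r M X = quad_argmax" "E_upper m r M X = quad_argmax"
proof -
  have "quad_argmax \<subseteq> E_lower m r M X"
    unfolding E_lower_def using maximizer_in_kur_Li[OF simple] by blast
  then show "E_lower m r M X = quad_argmax" "E_upper m r M X = quad_argmax"
    using E_lower_subset_E_upper E_upper_subset by auto
qed

end

section \<open>Extrinsic means\<close>

lemma r_m_pos: "1 \<le> m \<Longrightarrow> 0 < r_m m"
  by (simp add: r_m_def)

lemma expected_sq_dist:
  fixes X :: "'a \<Rightarrow> real^'n::{finite,linorder}"
  assumes "rp_random_point m (r_m m) M X" and y: "norm y = r_m m"
  shows "(\<integral>\<omega>. (lnorm (ldiff (phi_vec m (X \<omega>)) (phi_vec m y)))\<^sup>2 \<partial>M) =
    2 + 2 / real m - real m / (2 * (real m + 1)) * rp_random_point.quad M X y"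
proof -
  interpret rp_random_point m "r_m m" M X by fact
  have "(\<integral>\<omega>. (lnorm (ldiff (phi_vec m (X \<omega>)) (phi_vec m y)))\<^sup>2 \<partial>M) =
      (\<integral>\<omega>. 2 + 2 / real m - real m / (2 * (real m + 1)) * (X \<omega> \<bullet> y)\<^sup>2 \<partial>M)"
  proof (rule Bochner_Integration.integral_cong[OF refl])
    fix \<omega> assume "\<omega> \<in> space M"
    note n = X_norm[OF this]
    show "(lnorm (ldiff (phi_vec m (X \<omega>)) (phi_vec m y)))\<^sup>2 = 2 + 2 / real m - real m / (2 * (real m + 1)) * (X \<omega> \<bullet> y)\<^sup>2"
    proof -
      have "(lnorm (ldiff (phi_vec m (X \<omega>)) (phi_vec m y)))\<^sup>2 = 1 + 1 - 2 * (real m / (4 * (real m + 1)) * (X \<omega> \<bullet> y)\<^sup>2 - 1 / real m)"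
        by (subst lnorm_ldiff)
           (simp_all only: length_phi_vec phi_vec_unit[OF m card n] phi_vec_unit[OF m card y] phi_vec_inner[OF m card n y])
      also have "\<dots> = 2 + 2 / real m - 2 * (real m / (4 * (real m + 1))) * (X \<omega> \<bullet> y)\<^sup>2"
        by (simp add: right_diff_distrib)
      also have "2 * (real m / (4 * (real m + 1))) = real m / (2 * (real m + 1))" by (simp add: divide_simps)
      finally show ?thesis .
    qed
  qed
  then show ?thesis
    unfolding quad_eq using inner_sq_integrable by (simp add: prob_space)
qed

lemma extrinsic_argmin_set_eq:
  fixes X :: "'a \<Rightarrow> real^'n::{finite,linorder}"
  assumes "rp_random_point m (r_m m) M X"
  shows "extrinsic_argmin_set m M X = rp_random_point.quad_argmax (r_m m) M X"
proof -
  interpret rp_random_point m "r_m m" M X by fact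
  have E: "(\<integral>\<omega>. (lnorm (ldiff (phi_vec m (X \<omega>)) (phi m P)))\<^sup>2 \<partial>M) =
      2 + 2 / real m - real m / (2 * (real m + 1)) * quad (rep P)" if "P \<in> rp (r_m m)" for P
    unfolding phi_def by (rule expected_sq_dist[OF assms rp_rep(1)[OF that]])
  define k where "k = real m / (2 * (real m + 1))"
  have k: "0 < k" using m by (simp add: k_def)
  let ?I = "\<lambda>z. \<integral>\<omega>. (lnorm (ldiff (phi_vec m (X \<omega>)) z))\<^sup>2 \<partial>M"
  have "?I (phi m P) \<le> ?I (phi m Q) \<longleftrightarrow> quad (rep Q) \<le> quad (rep P)"
    if "P \<in> rp (r_m m)" "Q \<in> rp (r_m m)" for P Q
    unfolding E[OF that(1)] E[OF that(2)] k_def[symmetric] using k by simp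
  moreover have "extrinsic_argmin_set m M X = {P \<in> rp (r_m m). \<forall>Q\<in>(rp (r_m m) :: (real^'n::{finite,linorder}) set set). ?I (phi m P) \<le> ?I (phi m Q)}"
  proof -
    have "{P \<in> R. f P \<in> {z \<in> f ` R. \<forall>w\<in>f ` R. I z \<le> I w}} = {P \<in> R. \<forall>Q\<in>R. I (f P) \<le> I (f Q)}"
      for R :: "'p set" and f :: "'p \<Rightarrow> real list" and I :: "real list \<Rightarrow> real"
      by auto
    from this[of "rp (r_m m)" "phi m" ?I] show ?thesis unfolding extrinsic_argmin_set_def .
  qed
  ultimately show ?thesis
    unfolding quad_argmax_def by blast
qed

text \<open>Prepares the exchange of expectation and coordinate sum when \<open>E_phi\<close> is
  paired with a point of the image. The proof follows the three blocks of the recursion: old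
  coordinates, mixed terms, and the trace term.\<close>

lemma F_nth_measurable:
  assumes "\<And>i. i < m + 1 \<Longrightarrow> (\<lambda>\<omega>. xs \<omega> ! i) \<in> borel_measurable M" and "\<And>\<omega>. m + 1 \<le> length (xs \<omega>)"
    and "k < m * (m + 3) div 2"
  shows "(\<lambda>\<omega>. F m (xs \<omega>) (xs \<omega>) ! k) \<in> borel_measurable M"
  using assms
proof (induction m arbitrary: xs k rule: nat_induct)
  case 0
  then show ?case by simp
next
  case (Suc m)
  show ?case
  proof (cases m)
    case 0
    have [measurable]: "(\<lambda>\<omega>. xs \<omega> ! 0) \<in> borel_measurable M" "(\<lambda>\<omega>. xs \<omega> ! Suc 0) \<in> borel_measurable M"
      using Suc.prems(1) 0 by auto
    have "k = 0 \<or> k = 1" using Suc.prems(3) 0 by auto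
    then show ?thesis using 0 by auto
  next
    case (Suc l)
    define x where "x \<omega> = take (m + 1) (xs \<omega>)" for \<omega>
    have meas[measurable]: "(\<lambda>\<omega>. xs \<omega> ! i) \<in> borel_measurable M" if "i \<le> m + 1" for i
      using Suc.prems(1)[of i] that by auto
    have x_meas[measurable]: "(\<lambda>\<omega>. x \<omega> ! i) \<in> borel_measurable M" if "i < m + 1" for i
      unfolding x_def using that meas[of i] by simp
    have len: "m + 1 \<le> length (x \<omega>)" for \<omega> using Suc.prems(2)[of \<omega>] by (simp add: x_def)
    let ?n = "m * (m + 3) div 2"
    have F: "F (Suc m) (xs \<omega>) (xs \<omega>) = F m (x \<omega>) (x \<omega>) @
        map (\<lambda>i. xs \<omega> ! (m + 1) * x \<omega> ! i + xs \<omega> ! (m + 1) * x \<omega> ! i) [0..<m + 1] @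
        [sqrt (2 / ((real m + 1) * (real m + 2))) * ((\<Sum>i<m + 1. x \<omega> ! i * x \<omega> ! i) - (real m + 1) * xs \<omega> ! (m + 1) * xs \<omega> ! (m + 1))]" for \<omega>
      unfolding Suc by (simp only: F.simps Let_def x_def Suc)
    have "Suc m * (Suc m + 3) div 2 = length (F (Suc m) (xs undefined) (xs undefined))"
      by (simp only: length_F)
    also have "\<dots> = ?n + (m + 1) + 1"
      unfolding F by (simp add: length_F del: upt_Suc)
    finally have k: "k < ?n + (m + 1) + 1" using Suc.prems(3) by (simp only:)
    consider "k < ?n" | "?n \<le> k" "k < ?n + (m + 1)" | "k = ?n + (m + 1)" using k by linarith
    then show ?thesis
    proof cases
      case 1
      then have "F (Suc m) (xs \<omega>) (xs \<omega>) ! k = F m (x \<omega>) (x \<omega>) ! k" for \<omega>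
        unfolding F by (simp add: nth_append length_F)
      then show ?thesis using Suc.IH[of x k] x_meas len 1 by simp
    next
      case 2
      then have j: "k - ?n < m + 1" by linarith
      have "F (Suc m) (xs \<omega>) (xs \<omega>) ! k = xs \<omega> ! (m + 1) * x \<omega> ! (k - ?n) + xs \<omega> ! (m + 1) * x \<omega> ! (k - ?n)" for \<omega>
        unfolding F using 2 j by (simp add: nth_append length_F del: upt_Suc)
      then show ?thesis using meas[of "m + 1"] x_meas[OF j] by simp
    next
      case 3
      have "F (Suc m) (xs \<omega>) (xs \<omega>) ! k = sqrt (2 / ((real m + 1) * (real m + 2))) *
          ((\<Sum>i<m + 1. x \<omega> ! i * x \<omega> ! i) - (real m + 1) * xs \<omega> ! (m + 1) * xs \<omega> ! (m + 1))" for \<omega>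
        unfolding F using 3 by (simp add: nth_append length_F del: upt_Suc sum.lessThan_Suc)
      moreover have "(\<lambda>\<omega>. \<Sum>i<m + 1. x \<omega> ! i * x \<omega> ! i) \<in> borel_measurable M"
        by (intro borel_measurable_sum borel_measurable_times x_meas) auto
      ultimately show ?thesis using meas[of "m + 1"] by simp
    qed
  qed
qed

lemma phi_vec_integrable:
  fixes X :: "'a \<Rightarrow> real^'n::{finite,linorder}"
  assumes "rp_random_point m (r_m m) M X" and k: "k < m * (m + 3) div 2"
  shows "integrable M (\<lambda>\<omega>. phi_vec m (X \<omega>) ! k)"
proof -
  interpret rp_random_point m "r_m m" M X by fact
  have coord: "(\<lambda>\<omega>. coords (X \<omega>) ! i) \<in> borel_measurable M" if "i < m + 1" for i
  proof -
    have "coords (X \<omega>) ! i = X \<omega> $ (sorted_list_of_set UNIV ! i)" for \<omega>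
      unfolding coords_def using that card by simp
    moreover have "(\<lambda>\<omega>. X \<omega> $ j) \<in> borel_measurable M" for j
      using X_meas by (rule measurable_compose) (intro borel_measurable_continuous_onI continuous_intros)
    ultimately show ?thesis by simp
  qed
  have "(\<lambda>\<omega>. F m (coords (X \<omega>)) (coords (X \<omega>)) ! k) \<in> borel_measurable M"
    by (rule F_nth_measurable[OF coord _ k]) (simp_all add: length_coords card)
  then have meas: "(\<lambda>\<omega>. phi_vec m (X \<omega>) ! k) \<in> borel_measurable M"
    using k by (simp add: phi_vec_def length_F)
  show ?thesis
  proof (rule integrable_const_bound[where B = 1, OF AE_I2 meas])
    fix \<omega> assume "\<omega> \<in> space M"
    then have one: "ldot (phi_vec m (X \<omega>)) (phi_vec m (X \<omega>)) = 1"
      by (intro phi_vec_unit m card X_norm)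
    have "(phi_vec m (X \<omega>) ! k)\<^sup>2 \<le> (\<Sum>i<length (phi_vec m (X \<omega>)). (phi_vec m (X \<omega>) ! i)\<^sup>2)"
      by (rule member_le_sum) (use k in \<open>auto simp: length_phi_vec\<close>)
    also have "\<dots> = 1" using one by (simp add: ldot_def power2_eq_square)
    finally show "norm (phi_vec m (X \<omega>) ! k) \<le> 1" by (simp add: abs_square_le_1)
  qed
qed

theorem theorem3p15:
  fixes m :: nat
    and M :: "'a measure"
    and X :: "'a \<Rightarrow> real^'n::{finite,linorder}"
  assumes "m \<ge> 2"
    and "CARD('n) = m + 1"
    and "prob_space M"
    and "X \<in> borel_measurable M"
    and "\<forall>\<omega>\<in>space M. norm (X \<omega>) = r_m m"
  shows "E_lower m (r_m m) M X \<subseteq> extrinsic_argmin_set m M X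
       \<and> E_upper m (r_m m) M X \<subseteq> extrinsic_argmin_set m M X
       \<and> (top_eigenvalue_simple (second_moment M X) \<longrightarrow>
            E_lower m (r_m m) M X = extrinsic_argmin_set m M X
          \<and> E_upper m (r_m m) M X = extrinsic_argmin_set m M X)
       \<and> (top_eigenvalue_simple (second_moment M X)
          \<and> E_phi m M X \<noteq> replicate (m * (m + 3) div 2) 0
          \<and> map (\<lambda>a. a / lnorm (E_phi m M X)) (E_phi m M X) \<in> phi m ` (rp (r_m m) :: (real^'n::{finite,linorder}) set set) \<longrightarrow>
            (\<exists>P\<in>rp (r_m m). phi m P = map (\<lambda>a. a / lnorm (E_phi m M X)) (E_phi m M X)
               \<and> E_lower m (r_m m) M X = {P} \<and> E_upper m (r_m m) M X = {P}))"
proof -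
  have m: "1 \<le> m" using assms(1) by simp
  have loc: "rp_random_point m (r_m m) M X"
    using m r_m_pos[OF m] assms(2-5)
    by (auto simp: rp_random_point_def rp_random_point_axioms_def sphere_heat_def)
  interpret rp_random_point m "r_m m" M X by (rule loc)
  note ext = extrinsic_argmin_set_eq[OF loc]
  let ?L = "lnorm (E_phi m M X)" and ?n = "m * (m + 3) div 2"
  have part2: "\<exists>P\<in>rp (r_m m). phi m P = map (\<lambda>a. a / ?L) (E_phi m M X)
      \<and> E_lower m (r_m m) M X = {P} \<and> E_upper m (r_m m) M X = {P}"
    if simple: "top_eigenvalue_simple (second_moment M X)" and nz: "E_phi m M X \<noteq> replicate ?n 0"
      and P: "P \<in> rp (r_m m)" "map (\<lambda>a. a / ?L) (E_phi m M X) = phi m P"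
    for P :: "(real^'n::{finite,linorder}) set"
  proof -
    have len: "length (E_phi m M X) = ?n" by (simp add: E_phi_def)
    have L: "0 < ?L"
    proof (rule ccontr)
      assume "\<not> 0 < ?L"
      then have "(\<Sum>k<?n. (E_phi m M X ! k)\<^sup>2) \<le> 0" by (simp add: lnorm_def len not_less)
      then have "(\<Sum>k<?n. (E_phi m M X ! k)\<^sup>2) = 0" by (intro antisym sum_nonneg) auto
      then have "\<forall>k<?n. E_phi m M X ! k = 0" by (simp add: sum_nonneg_eq_0_iff)
      then have "E_phi m M X = replicate ?n 0" using len by (intro nth_equalityI) auto
      then show False using nz by contradiction
    qed
    have nth: "(\<integral>\<omega>. phi_vec m (X \<omega>) ! k \<partial>M) = ?L * phi m P ! k" if "k < ?n" for k
    proof -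
      have "phi m P ! k = E_phi m M X ! k / ?L" using P(2) that len by (metis nth_map)
      then show ?thesis using L that by (simp add: E_phi_def)
    qed
    \<comment> \<open>Both sides are the mean of the inner product of the embedded \<open>X\<close>
      with the image of \<open>Q\<close>: once by the formula in terms of \<open>quad\<close>, once
      through \<open>E_phi\<close>, which is \<open>?L\<close> times the image of
      \<open>P\<close>.\<close>
    have key: "real m / (4 * (real m + 1)) * quad (rep Q) - 1 / real m = ?L * ldot (phi m P) (phi m Q)"
      if Q: "Q \<in> rp (r_m m)" for Q
    proof -
      have "(\<integral>\<omega>. ldot (phi_vec m (X \<omega>)) (phi m Q) \<partial>M) =
          (\<integral>\<omega>. real m / (4 * (real m + 1)) * (X \<omega> \<bullet> rep Q)\<^sup>2 - 1 / real m \<partial>M)"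
        unfolding phi_def
        by (rule Bochner_Integration.integral_cong[OF refl], rule phi_vec_inner[OF m card X_norm rp_rep(1)[OF Q]])
      also have "\<dots> = real m / (4 * (real m + 1)) * quad (rep Q) - 1 / real m"
        unfolding quad_eq using inner_sq_integrable by (simp add: prob_space)
      finally have "real m / (4 * (real m + 1)) * quad (rep Q) - 1 / real m =
          (\<integral>\<omega>. (\<Sum>k<?n. phi_vec m (X \<omega>) ! k * phi m Q ! k) \<partial>M)"
        by (simp add: ldot_def length_phi_vec)
      also have "\<dots> = (\<Sum>k<?n. (\<integral>\<omega>. phi_vec m (X \<omega>) ! k \<partial>M) * phi m Q ! k)"
        using phi_vec_integrable[OF loc] by (subst Bochner_Integration.integral_sum) auto
      also have "\<dots> = (\<Sum>k<?n. ?L * (phi m P ! k * phi m Q ! k))"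
        by (intro sum.cong refl) (simp add: nth)
      also have "\<dots> = ?L * ldot (phi m P) (phi m Q)"
        by (simp add: ldot_def phi_def length_phi_vec sum_distrib_left)
      finally show ?thesis .
    qed
    have unit: "ldot (phi m Q) (phi m Q) = 1" if "Q \<in> rp (r_m m)" for Q :: "(real^'n::{finite,linorder}) set"
      unfolding phi_def by (rule phi_vec_unit[OF m card rp_rep(1)[OF that]])
    have "quad (rep Q) \<le> quad (rep P)" if Q: "Q \<in> rp (r_m m)" for Q :: "(real^'n::{finite,linorder}) set"
    proof -
      \<comment> \<open>Cauchy-Schwarz for unit vectors, from nonnegativity of a squared distance;
        by \<open>key\<close> it shows that \<open>P\<close> maximizes \<open>quad\<close>.\<close>
      have "0 \<le> ldot (phi m P) (phi m P) + ldot (phi m Q) (phi m Q) - 2 * ldot (phi m P) (phi m Q)"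
        by (subst lnorm_ldiff[symmetric]) (simp_all add: phi_def length_phi_vec)
      then have "ldot (phi m P) (phi m Q) \<le> ldot (phi m P) (phi m P)" using unit[OF P(1)] unit[OF Q] by simp
      then have "real m / (4 * (real m + 1)) * quad (rep Q) - 1 / real m \<le>
          real m / (4 * (real m + 1)) * quad (rep P) - 1 / real m"
        unfolding key[OF P(1)] key[OF Q] using L by (intro mult_left_mono) auto
      moreover have "0 < real m / (4 * (real m + 1))" using m by simp
      ultimately show ?thesis by (simp only: diff_conv_add_uminus add_le_cancel_right mult_le_cancel_left_pos)
    qed
    then have "P \<in> quad_argmax" using P(1) by (simp add: quad_argmax_def)
    then have "E_lower m (r_m m) M X = {P}" "E_upper m (r_m m) M X = {P}"
      using quad_argmax_unique[OF simple] E_eq_quad_argmax[OF simple] by auto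
    then show ?thesis using P by metis
  qed
  show ?thesis
    unfolding ext
    using E_lower_subset_E_upper E_upper_subset E_eq_quad_argmax part2 by blast
qed

end
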